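(* Let $I$ be a nonzero proper ideal of $\mathcal O_n$ such that $\overline I$ is a monomial ideal. Then, for all $k\in\{1,\dots,n\}$, $$\operatorname{lct}^{(k)}(I)=\inf\left\{\frac{\sum_i a_i-(n-k)a_{\min}}{\ell(a,I)}:a\in S^{(k)}\right\}=\inf\left\{\frac{\sum_ia_i-(n-k)}{\ell(a,I)}:a\in S^{(k)}\cap A\right\},$$ where $A=\{a=(a_1,\dots,a_n):\min\{a_1,\dots,a_n\}=1\}$.
   Context: $\mathcal O_n$ is the ring of complex analytic function germs $(\mathbb C^n,0)\to\mathbb C$; $\overline I$ is the integral closure; a monomial ideal is one generated by monomials. For $a=(a_1,\dots,a_n)\in\mathbb R^n_{\geq0}$: $a_{\min}=\min_i a_i$ and $A(a)=\{j:a_j=a_{\min}\}$. For $k\in\{1,\dots,n\}$, $S^{(k)}=\{a\in\mathbb R^n_{>0}:\#A(a)\geq n+1-k\}$. The Newton polyhedron $\Gamma_+(I)$ of $I=\langle g_1,\dots,g_r\rangle$ is the convex hull of $\Gamma_+(g_1)\cup\dots\cup\Gamma_+(g_r)$, where for $h=\sum_kc_kx^k\neq0$, $\Gamma_+(h)$ is the convex hull of $\{k+u:c_k\neq0,\ u\in\mathbb R^n_{\geq0}\}$, and $\Gamma_+(0)=\emptyset$. $\ell(a,I)=\min\{\langle a,k\rangle:k\in\Gamma_+(I)\}$. For an ideal $I=\langle g_1,\dots,g_r\rangle$ of analytic germs at $0$ of a complex vector space, $\operatorname{lct}(I)$ is the supremum of those $s\geq0$ such that $(|g_1|^2+\cdots+|g_r|^2)^{-s}$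 is integrable on some compact neighbourhood of $0$. $\operatorname{lct}^{(k)}(I)=\operatorname{lct}(I|_L)$, where $L$ is a generic $k$-dimensional linear subspace of $\mathbb C^n$ (in a suitable nonempty Zariski open subset of the Grassmannian) and $I|_L$ is the ideal generated by the restrictions to $L$ of elements of $I$; the value is the maximal one among such $L$. *)

theory Defs
  imports "HOL-Analysis.Analysis"
begin

section \<open>Germs of analytic functions\<close>

text \<open>
  The space \<open>\<complex>\<^sup>n\<close> is \<^typ>\<open>complex^'n\<close>, so that \<open>n = CARD('n) \<ge> 1\<close>; exponents of monomials
  are of type \<^typ>\<open>nat^'n\<close>.
\<close>

definition monom_fun :: "nat^'n \<Rightarrow> complex^'n \<Rightarrow> complex" where
  "monom_fun m x = (\<Prod>i\<in>UNIV. x $ i ^ (m $ i))"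

definition has_power_series :: "(complex^'n \<Rightarrow> complex) \<Rightarrow> (nat^'n \<Rightarrow> complex) \<Rightarrow> bool" where
  "has_power_series f c \<longleftrightarrow>
     (\<forall>\<^sub>F x in nhds 0. ((\<lambda>m. c m * monom_fun m x) has_sum f x) UNIV)"

definition analytic_at_zero :: "(complex^'n \<Rightarrow> complex) \<Rightarrow> bool" where
  "analytic_at_zero f \<longleftrightarrow> (\<exists>c. has_power_series f c)"

lemma monom_fun_add: "monom_fun (p + q) x = monom_fun p x * monom_fun q x"
  by (simp add: monom_fun_def power_add prod.distrib)

lemma monom_fun_zero [simp]: "monom_fun 0 x = 1"
  by (simp add: monom_fun_def)

lemma has_power_series_monom: "has_power_series (monom_fun m) (\<lambda>k. if k = m then 1 else 0)"
  unfolding has_power_series_def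
proof (intro always_eventually allI)
  fix x :: "complex^'a"
  have "((\<lambda>k. (if k = m then 1 else 0) * monom_fun k x) has_sum monom_fun m x) {m}"
    by (rule has_sum_finiteI) auto
  then show "((\<lambda>k. (if k = m then 1 else 0) * monom_fun k x) has_sum monom_fun m x) UNIV"
    by (rule has_sum_cong_neutral[THEN iffD1, rotated -1]) auto
qed

lemma has_power_series_zero: "has_power_series (\<lambda>_. 0) (\<lambda>_. 0)"
  by (simp add: has_power_series_def)

lemma has_power_series_add:
  assumes "has_power_series f c" "has_power_series g d"
  shows "has_power_series (\<lambda>x. f x + g x) (\<lambda>m. c m + d m)"
  using assms unfolding has_power_series_def
  by eventually_elim (auto intro: has_sum_add simp: distrib_right)

lemma has_power_series_uminus:
  assumes "has_power_series f c"
  shows "has_power_series (\<lambda>x. - f x) (\<lambda>m. - c m)"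
  using assms unfolding has_power_series_def
  by eventually_elim (auto simp: has_sum_uminus)

lemma finite_antidiagonal: "finite {(p, q). p + q = (m :: nat^'n)}"
proof (rule finite_subset)
  show "{(p, q). p + q = m} \<subseteq> {p. \<forall>i. p $ i \<le> m $ i} \<times> {p. \<forall>i. p $ i \<le> m $ i}"
    by auto
  have "inj_on vec_nth {p. \<forall>i. p $ i \<le> m $ i}"
    by (auto simp: inj_on_def vec_eq_iff)
  moreover have "vec_nth ` {p. \<forall>i. p $ i \<le> m $ i} \<subseteq> PiE UNIV (\<lambda>i. {..m $ i})"
    by auto
  ultimately have "finite {p. \<forall>i. p $ i \<le> m $ i}"
    by (meson finite_PiE finite_atMost finite_code finite_imageD finite_subset)
  then show "finite ({p. \<forall>i. p $ i \<le> m $ i} \<times> {p. \<forall>i. p $ i \<le> m $ i})"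
    by simp
qed

lemma has_power_series_mult:
  assumes "has_power_series f c" "has_power_series g d"
  shows "has_power_series (\<lambda>x. f x * g x) (\<lambda>m. \<Sum>(p, q)\<in>{(p, q). p + q = m}. c p * d q)"
  using assms unfolding has_power_series_def
proof eventually_elim
  case (elim x)
  define F where "F p = c p * monom_fun p x" for p
  define G where "G q = d q * monom_fun q x" for q
  have F: "(F has_sum f x) UNIV" and G: "(G has_sum g x) UNIV"
    using elim by (simp_all add: F_def[abs_def] G_def[abs_def])
  have "(\<lambda>p. norm (F p)) summable_on UNIV" "(\<lambda>p. norm (G p)) summable_on UNIV"
    using F G by (auto simp: summable_on_iff_abs_summable_on_complex[symmetric] summable_on_def)
  then have "(\<lambda>(p, q). norm (F p) * norm (G q)) summable_on UNIV \<times> UNIV"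
    by (intro summable_on_SigmaI[where g = "\<lambda>p. norm (F p) * (\<Sum>\<^sub>\<infinity>q. norm (G q))"])
       (auto intro!: has_sum_cmult_right has_sum_infsum summable_on_cmult_left)
  then have "(\<lambda>(p, q). F p * G q) summable_on UNIV \<times> UNIV"
    by (subst summable_on_iff_abs_summable_on_complex) (simp add: case_prod_unfold norm_mult)
  moreover have "((\<lambda>p. F p * g x) has_sum f x * g x) UNIV"
    using F by (rule has_sum_cmult_left)
  ultimately have "((\<lambda>(p, q). F p * G q) has_sum f x * g x) (UNIV \<times> UNIV)"
    using G by (intro has_sum_SigmaI[where g = "\<lambda>p. F p * g x"]) (auto intro: has_sum_cmult_right)
  moreover have "bij_betw snd (Sigma UNIV (\<lambda>m. {(p, q). p + q = m})) (UNIV \<times> UNIV)"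
    by (auto simp: bij_betw_def inj_on_def image_def)
  ultimately have "((\<lambda>(m, (p, q)). F p * G q) has_sum f x * g x)
                     (Sigma UNIV (\<lambda>m. {(p, q). p + q = m}))"
    by (subst (asm) has_sum_reindex_bij_betw[symmetric]) (auto simp: case_prod_unfold)
  then have "((\<lambda>m. \<Sum>(p, q)\<in>{(p, q). p + q = m}. F p * G q) has_sum f x * g x) UNIV"
    by (rule has_sum_SigmaD)
       (simp add: finite_antidiagonal[unfolded case_prod_unfold] case_prod_unfold has_sum_finite)
  moreover have "(\<Sum>(p, q)\<in>{(p, q). p + q = m}. F p * G q) =
                 (\<Sum>(p, q)\<in>{(p, q). p + q = m}. c p * d q) * monom_fun m x" for m
    unfolding sum_distrib_right
    by (rule sum.cong) (auto simp: F_def G_def monom_fun_add mult_ac)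
  ultimately show ?case by simp
qed

lemma analytic_at_zero_intros:
  "analytic_at_zero (\<lambda>_. 0)"
  "analytic_at_zero (\<lambda>_. 1)"
  "analytic_at_zero (monom_fun m)"
  "analytic_at_zero f \<Longrightarrow> analytic_at_zero g \<Longrightarrow> analytic_at_zero (\<lambda>x. f x + g x)"
  "analytic_at_zero f \<Longrightarrow> analytic_at_zero (\<lambda>x. - f x)"
  "analytic_at_zero f \<Longrightarrow> analytic_at_zero g \<Longrightarrow> analytic_at_zero (\<lambda>x. f x * g x)"
  using has_power_series_monom[of 0]
  by (auto simp: analytic_at_zero_def monom_fun_zero[abs_def]
      intro: has_power_series_zero has_power_series_monom has_power_series_add
        has_power_series_uminus has_power_series_mult)

definition same_germ :: "(complex^'n \<Rightarrow> complex) \<Rightarrow> (complex^'n \<Rightarrow> complex) \<Rightarrow> bool" where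
  "same_germ f g \<longleftrightarrow> analytic_at_zero f \<and> analytic_at_zero g \<and> (\<forall>\<^sub>F x in nhds 0. f x = g x)"

quotient_type 'n germ = "complex^'n \<Rightarrow> complex" / partial: same_germ
proof (rule part_equivpI)
  show "\<exists>f :: complex^'n \<Rightarrow> complex. same_germ f f"
    by (auto simp: same_germ_def intro: analytic_at_zero_intros)
  show "symp (same_germ :: (complex^'n \<Rightarrow> complex) \<Rightarrow> _)"
    by (auto simp: symp_def same_germ_def eq_commute)
  show "transp (same_germ :: (complex^'n \<Rightarrow> complex) \<Rightarrow> _)"
    by (auto simp: transp_def same_germ_def elim: eventually_elim2)
qed

instantiation germ :: (finite) comm_ring_1
begin

lift_definition zero_germ :: "'a germ" is "\<lambda>_. 0"
  by (auto simp: same_germ_def intro: analytic_at_zero_intros)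

lift_definition one_germ :: "'a germ" is "\<lambda>_. 1"
  by (auto simp: same_germ_def intro: analytic_at_zero_intros)

lift_definition plus_germ :: "'a germ \<Rightarrow> 'a germ \<Rightarrow> 'a germ" is "\<lambda>f g x. f x + g x"
  by (auto simp: same_germ_def elim: eventually_elim2
      intro: analytic_at_zero_intros)

lift_definition uminus_germ :: "'a germ \<Rightarrow> 'a germ" is "\<lambda>f x. - f x"
  by (auto simp: same_germ_def elim: eventually_mono
      intro: analytic_at_zero_intros)

definition minus_germ :: "'a germ \<Rightarrow> 'a germ \<Rightarrow> 'a germ" where
  "minus_germ f g = f + - g"

lift_definition times_germ :: "'a germ \<Rightarrow> 'a germ \<Rightarrow> 'a germ" is "\<lambda>f g x. f x * g x"
  by (auto simp: same_germ_def elim: eventually_elim2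
      intro: analytic_at_zero_intros)

instance
proof
  fix f g h :: "'a germ"
  show "f * g * h = f * (g * h)"
    by transfer (auto simp: same_germ_def mult_ac
        intro!: analytic_at_zero_intros)
  show "f * g = g * f"
    by transfer (auto simp: same_germ_def mult_ac
        intro!: analytic_at_zero_intros)
  show "1 * f = f"
    by transfer (auto simp: same_germ_def)
  show "f + g + h = f + (g + h)"
    by transfer (auto simp: same_germ_def add_ac
        intro!: analytic_at_zero_intros)
  show "f + g = g + f"
    by transfer (auto simp: same_germ_def add_ac
        intro!: analytic_at_zero_intros)
  show "0 + f = f"
    by transfer (auto simp: same_germ_def)
  show "- f + f = 0"
    by transfer (auto simp: same_germ_def intro: analytic_at_zero_intros)
  show "f - g = f + - g"
    by (simp add: minus_germ_def)
  show "(f + g) * h = f * h + g * h"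
    by transfer (auto simp: same_germ_def distrib_right
        intro!: analytic_at_zero_intros)
  show "(0 :: 'a germ) \<noteq> 1"
    by transfer (auto simp: same_germ_def dest: eventually_nhds_x_imp_x)
qed

end

lift_definition germ_monom :: "nat^'n \<Rightarrow> 'n::finite germ" is monom_fun
  by (auto simp: same_germ_def intro: analytic_at_zero_intros)

definition germ_coeff :: "'n::finite germ \<Rightarrow> nat^'n \<Rightarrow> complex" where
  "germ_coeff h = (THE c. has_power_series (rep_germ h) c)"


section \<open>Ideals\<close>

text \<open>
  Ideals of a commutative ring are the submodules of the ring over itself: \<open>ideal.subspace I\<close>
  says that \<open>I\<close> is an ideal, and \<open>ideal.span G\<close> is the ideal generated by \<open>G\<close>.
\<close>

global_interpretation ideal: module "(*) :: 'a \<Rightarrow> 'a \<Rightarrow> 'a::comm_ring_1"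
  by unfold_locales (auto simp: algebra_simps)

primrec ideal_power :: "'a::comm_ring_1 set \<Rightarrow> nat \<Rightarrow> 'a set" where
  "ideal_power I 0 = UNIV"
| "ideal_power I (Suc j) = ideal.span {x * y | x y. x \<in> I \<and> y \<in> ideal_power I j}"

definition integral_closure :: "'a::comm_ring_1 set \<Rightarrow> 'a set" where
  "integral_closure I =
     {h. \<exists>m\<ge>1. \<exists>a. (\<forall>i\<in>{1..m}. a i \<in> ideal_power I i) \<and>
           h ^ m + (\<Sum>i=1..m. a i * h ^ (m - i)) = 0}"

definition monomial_ideal :: "'n::finite germ set \<Rightarrow> bool" where
  "monomial_ideal J \<longleftrightarrow> (\<exists>M. J = ideal.span (germ_monom ` M))"

text \<open>
  An arbitrarily chosen finite system of generators \<open>g\<^sub>1, \<dots>, g\<^sub>r\<close> of an ideal. Such a system exists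
  since the ring of germs is Noetherian; the notions defined through it below do not depend on
  the choice.
\<close>

definition ideal_gens :: "'a::comm_ring_1 set \<Rightarrow> 'a list" where
  "ideal_gens I = (SOME gs. I = ideal.span (set gs))"


section \<open>Newton polyhedra\<close>

definition newton_germ :: "'n::finite germ \<Rightarrow> (real^'n) set" where
  "newton_germ h =
     convex hull {(\<chi> i. real (k $ i)) + u | k u. germ_coeff h k \<noteq> 0 \<and> (\<forall>i. u $ i \<ge> 0)}"

definition newton_ideal :: "'n::finite germ set \<Rightarrow> (real^'n) set" where
  "newton_ideal I = convex hull (\<Union>g\<in>set (ideal_gens I). newton_germ g)"

definition ell :: "real^'n \<Rightarrow> 'n::finite germ set \<Rightarrow> real" where
  "ell a I = (INF k\<in>newton_ideal I. a \<bullet> k)"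

definition vec_min :: "real^'n \<Rightarrow> real" where
  "vec_min a = Min (range (($) a))"

definition argmin_set :: "real^'n \<Rightarrow> 'n set" where
  "argmin_set a = {j. a $ j = vec_min a}"

definition S_set :: "nat \<Rightarrow> (real^'n) set" where
  "S_set k = {a. (\<forall>i. a $ i > 0) \<and> card (argmin_set a) \<ge> CARD('n) + 1 - k}"

definition A_set :: "(real^'n) set" where
  "A_set = {a. vec_min a = 1}"


section \<open>Log canonical thresholds\<close>

text \<open>
  The function \<open>t\<^sup>-\<^sup>s\<close> for \<open>s, t \<ge> 0\<close>, with value \<open>\<infinity>\<close> for \<open>t = 0 < s\<close>. In particular the
  zero ideal has log canonical threshold \<open>0\<close>.
\<close>

definition neg_power :: "real \<Rightarrow> real \<Rightarrow> ennreal" where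
  "neg_power t s = (if s = 0 then 1 else inverse (ennreal (t powr s)))"

definition lct_gens :: "'n::finite germ list \<Rightarrow> ereal" where
  "lct_gens gs =
     Sup {ereal s | s. s \<ge> 0 \<and>
            (\<exists>K. compact K \<and> 0 \<in> interior K \<and>
               (\<integral>\<^sup>+x\<in>K. neg_power (\<Sum>g\<leftarrow>gs. (cmod (rep_germ g x))\<^sup>2) s \<partial>lborel) < \<infinity>)}"

definition lct :: "'n::finite germ set \<Rightarrow> ereal" where
  "lct I = lct_gens (ideal_gens I)"

text \<open>
  A \<open>k\<close>-dimensional linear subspace \<open>L\<close> of \<open>\<complex>\<^sup>n\<close>, where \<open>k = CARD('k)\<close>, is the range of an
  injective linear map \<open>\<complex>\<^sup>k \<rightarrow> \<complex>\<^sup>n\<close>, and germs on \<open>L\<close> are identified with germs on \<open>\<complex>\<^sup>k\<close>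
  by means of it. The log canonical threshold does not depend on the linear coordinates chosen
  on \<open>L\<close>.
\<close>

definition grassmannian :: "nat \<Rightarrow> (complex^'n) set set" where
  "grassmannian k = {L. vec.subspace L \<and> vec.dim L = k}"

definition coordinates :: "(complex^'n) set \<Rightarrow> complex^'k^'n" where
  "coordinates L = (SOME M. range ((*v) M) = L)"

definition restrict_germ :: "(complex^'n) set \<Rightarrow> 'n::finite germ \<Rightarrow> 'k::finite germ" where
  "restrict_germ L h = abs_germ (\<lambda>z. rep_germ h ((coordinates L :: complex^'k^'n) *v z))"

definition restrict_ideal :: "(complex^'n) set \<Rightarrow> 'n::finite germ set \<Rightarrow> 'k::finite germ set" where
  "restrict_ideal L I = ideal.span (restrict_germ L ` I)"

inductive_set polynomial_functions :: "(complex^'k^'n \<Rightarrow> complex) set" where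
  const: "(\<lambda>_. c) \<in> polynomial_functions"
| entry: "(\<lambda>M. M $ i $ j) \<in> polynomial_functions"
| add: "p \<in> polynomial_functions \<Longrightarrow> q \<in> polynomial_functions \<Longrightarrow>
    (\<lambda>M. p M + q M) \<in> polynomial_functions"
| mult: "p \<in> polynomial_functions \<Longrightarrow> q \<in> polynomial_functions \<Longrightarrow>
    (\<lambda>M. p M * q M) \<in> polynomial_functions"

definition zariski_open :: "(complex^'k^'n) set \<Rightarrow> bool" where
  "zariski_open V \<longleftrightarrow> (\<exists>P\<subseteq>polynomial_functions. V = {M. \<exists>p\<in>P. p M \<noteq> 0})"

text \<open>
  The Zariski topology of the Grassmannian is the quotient topology under \<open>M \<mapsto> range M\<close> from
  the Zariski open set of injective matrices.
\<close>

definition grassmann_zariski_open :: "'k::finite itself \<Rightarrow> (complex^'n) set set \<Rightarrow> bool" where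
  "grassmann_zariski_open _ U \<longleftrightarrow>
     U \<subseteq> grassmannian CARD('k) \<and>
     zariski_open {M :: complex^'k^'n. inj ((*v) M) \<and> range ((*v) M) \<in> U}"

text \<open>
  \<open>lct\<^sup>(\<^sup>k\<^sup>)(I)\<close> for \<open>k = CARD('k)\<close>: the value of \<open>lct (I|\<^sub>L)\<close> for generic \<open>L\<close>, which is the
  maximal one.
\<close>

definition lct_generic :: "'k::finite itself \<Rightarrow> 'n::finite germ set \<Rightarrow> ereal" where
  "lct_generic _ I =
     (THE v. (\<exists>U. grassmann_zariski_open TYPE('k) U \<and> U \<noteq> {} \<and>
                (\<forall>L\<in>U. lct (restrict_ideal L I :: 'k germ set) = v)) \<and>
             (\<forall>L\<in>grassmannian CARD('k). lct (restrict_ideal L I :: 'k germ set) \<le> v))"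

end

theory Submission
  imports Defs
begin

text \<open>
  Let \<open>V\<close> be the infimum over \<open>S_set k\<close>. For a subspace \<open>L\<close>, parametrized by an \<open>n \<times> k\<close> matrix, let
  \<open>l\<^sub>1, \<dots>, l\<^sub>n\<close> be the coordinate functions of \<open>\<complex>\<^sup>n\<close> pulled back to \<open>\<complex>\<^sup>k\<close>, and let \<open>F\<close> be the sum of
  the squared absolute values of generators of the restricted ideal. Up to constant factors, \<open>F\<close> is
  the pull-back of the corresponding sum for \<open>I\<close>.

  The threshold is at most \<open>V\<close> for every \<open>L\<close> (\<open>lct_restrict_ideal_le\<close>). For a weight \<open>a\<close>, consider
  the points with \<open>\<bar>z\<bar> < \<eta> t\<^sup>\<alpha>\<close> and \<open>\<bar>l\<^sub>i(z)\<bar> \<le> r t\<^sup>b\<close>, where \<open>\<alpha>\<close> is the least entry of \<open>a\<close> and \<open>b\<close>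
  is its entry \<open>a $ i\<close>. There \<open>F\<close> is at most a constant times the power of \<open>t\<close> with exponent
  \<open>2 * ell a I\<close>, while a pigeonhole argument shows that the volume is at least a constant times the
  power with exponent twice the numerator that belongs to \<open>a\<close>. Letting \<open>t\<close> tend to 0 bounds
  every \<open>s\<close> for which the power \<open>-s\<close> of \<open>F\<close> is integrable.

  The threshold is at least \<open>V\<close> if any \<open>k\<close> of the forms \<open>l\<^sub>i\<close> are linearly independent
  (\<open>le_lct_restrict_ideal\<close>), which is a nonempty Zariski open condition on \<open>L\<close>. Integral dependence
  bounds \<open>F\<close> from below by the squares of finitely many monomials in the \<open>l\<^sub>i\<close> that generate an ideal
  containing \<open>I\<close>; so for each \<open>a\<close> one of them has weight at most \<open>ell a I\<close>. Given a point \<open>z\<close> close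
  to 0 where no \<open>l\<^sub>i\<close> vanishes, let \<open>T\<close> consist of the indices of the \<open>k\<close> smallest numbers \<open>\<bar>l\<^sub>i(z)\<bar>\<close> and let \<open>r\<close> be the largest
  of these \<open>k\<close> numbers. The weight with entries \<open>log r (min \<bar>l\<^sub>i(z)\<bar> r)\<close> has minimum 1, attained at all
  indices outside \<open>T\<close> and at least at one index in \<open>T\<close>, so it lies in \<open>S_set k\<close>. For \<open>s < s' < V\<close>, the inequality
  that the definition of \<open>V\<close> gives for this weight says that the power \<open>s\<close> of \<open>F\<close> is bounded
  below by a constant times the product of \<open>\<bar>l\<^sub>i(z)\<bar>\<close> over \<open>T\<close> raised to \<open>2 * s / s'\<close>. The reciprocal of
  that product is locally integrable, as the \<open>k\<close> forms are linear coordinates and \<open>s / s' < 1\<close>.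

  Both notions of the statement, \<open>germ_coeff\<close> and \<open>ideal_gens\<close>, rest on facts about convergent power
  series: coefficients are unique, and ideals are finitely generated. Both follow from one device.
  Exponents are ordered by the integers \<open>p\<^sub>1\<^bsup>m\<^sub>1\<^esup> \<dots> p\<^sub>n\<^bsup>m\<^sub>n\<^esup>\<close> for distinct primes; at the points with
  coordinates \<open>p\<^sub>i\<^bsup>-s\<^esup>\<close> a power series turns into a Dirichlet series in \<open>s\<close>, whose first
  term dominates as \<open>s\<close> grows. This isolates leading coefficients, and it makes the division algorithm with
  respect to this order converge.
\<close>

section \<open>A monomial order from prime factorization\<close>

definition prime_of :: "'n::finite \<Rightarrow> nat" where
  "prime_of = (SOME p. inj p \<and> (\<forall>i. prime (p i)))"

lemma prime_of: "inj (prime_of :: 'n::finite \<Rightarrow> nat)" "prime (prime_of (i :: 'n))"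
proof -
  have "infinite {p::nat. prime p}"
    by (rule primes_infinite)
  then obtain A where A: "A \<subseteq> {p::nat. prime p}" "finite A" "card A = CARD('n)"
    by (meson infinite_arbitrarily_large)
  then obtain p :: "'n \<Rightarrow> nat" where "bij_betw p UNIV A"
    using finite_same_card_bij[of "UNIV :: 'n set" A] by auto
  with A have "inj p \<and> (\<forall>i. prime (p i))"
    by (auto simp: bij_betw_def)
  then have "inj (prime_of :: 'n \<Rightarrow> nat) \<and> (\<forall>i :: 'n. prime (prime_of i))"
    unfolding prime_of_def by (rule someI[where P = "\<lambda>p. inj p \<and> (\<forall>i. prime (p i))"])
  then show "inj (prime_of :: 'n \<Rightarrow> nat)" "prime (prime_of i)"
    by auto
qed

lemma prime_of_ge_2: "prime_of i \<ge> 2"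
  by (simp add: prime_of prime_ge_2_nat)

text \<open>
  By unique factorization this is an injective homomorphism from exponents to positive integers.
  Ordering exponents by it gives a monomial order whose initial segments are finite.
\<close>

definition prime_code :: "nat^'n \<Rightarrow> nat" where
  "prime_code m = (\<Prod>i\<in>UNIV. prime_of i ^ (m $ i))"

lemma prime_code_add: "prime_code (p + q) = prime_code p * prime_code q"
  by (simp add: prime_code_def power_add prod.distrib)

lemma prime_code_zero [simp]: "prime_code 0 = 1"
  by (simp add: prime_code_def)

lemma prime_code_pos [simp]: "prime_code m > 0"
  by (simp add: prime_code_def prod_pos prime_gt_0_nat prime_of)

lemma prime_code_ge_1: "1 \<le> prime_code m"
  by (simp add: Suc_leI)

lemma inj_prime_code: "inj prime_code"
proof (rule injI)
  fix m m' :: "nat^'n"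
  assume eq: "prime_code m = prime_code m'"
  have mult: "multiplicity (prime_of i) (prime_code m) = m $ i" for m :: "nat^'n" and i
  proof -
    have "prime_code m = (\<Prod>p\<in>range (prime_of :: 'n \<Rightarrow> nat). p ^ (m $ inv prime_of p))"
      unfolding prime_code_def
      by (subst prod.reindex) (auto simp: prime_of inv_f_f)
    then have "multiplicity (prime_of i) (prime_code m) =
        multiplicity (prime_of i) (\<Prod>p\<in>range (prime_of :: 'n \<Rightarrow> nat). p ^ (m $ inv prime_of p))"
      by simp
    also have "\<dots> = m $ i"
      by (subst multiplicity_prod_prime_powers) (auto simp: prime_of inv_f_f)
    finally show ?thesis .
  qed
  show "m = m'"
    using eq by (metis mult vec_eq_iff)
qed

lemma finite_prime_code_le: "finite {m. prime_code m \<le> n}"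
  using finite_vimageI[OF finite_atMost[of n] inj_prime_code] by (simp add: vimage_def)


section \<open>Power series as weighted summable families\<close>

text \<open>
  Evaluating the monomial with exponent \<open>m\<close> at this point gives the power \<open>-s\<close> of \<open>prime_code m\<close>.
\<close>

definition test_point :: "nat \<Rightarrow> complex^'n" where
  "test_point s = (\<chi> i. complex_of_real (1 / real (prime_of i) ^ s))"

lemma monom_fun_test_point:
  "monom_fun m (test_point s) = complex_of_real (1 / real (prime_code m) ^ s)"
proof -
  have "monom_fun m (test_point s) =
          (\<Prod>i\<in>UNIV. complex_of_real (1 / real (prime_of i) ^ s) ^ (m $ i))"
    by (simp add: monom_fun_def test_point_def)
  also have "\<dots> = complex_of_real (\<Prod>i\<in>UNIV. (1 / real (prime_of i) ^ s) ^ (m $ i))"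
    by (simp only: of_real_power of_real_prod)
  also have "(\<Prod>i\<in>UNIV. (1 / real (prime_of i) ^ s) ^ (m $ i)) = 1 / real (prime_code m) ^ s"
    by (simp add: prime_code_def power_divide prod_dividef prod_power_distrib mult.commute
        flip: power_mult)
  finally show ?thesis .
qed

lemma test_point_tendsto_0: "(test_point :: nat \<Rightarrow> complex^'n) \<longlonglongrightarrow> 0"
proof (rule vec_tendstoI)
  fix i :: 'n
  have "(\<lambda>s. inverse (real (prime_of i)) ^ s) \<longlonglongrightarrow> 0"
    using prime_of_ge_2[of i] by (intro LIMSEQ_power_zero) (simp add: inverse_less_1_iff)
  then have "(\<lambda>s. complex_of_real (inverse (real (prime_of i)) ^ s)) \<longlonglongrightarrow> complex_of_real 0"
    by (rule tendsto_of_real)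
  then show "(\<lambda>s. (test_point s :: complex^'n) $ i) \<longlonglongrightarrow> 0 $ i"
    by (simp add: test_point_def power_inverse inverse_eq_divide[symmetric])
qed

text \<open>
  Absolute convergence of the power series with coefficients \<open>c\<close> at \<open>test_point s\<close>.
\<close>

definition weighted_summable :: "nat \<Rightarrow> (nat^'n \<Rightarrow> complex) \<Rightarrow> bool" where
  "weighted_summable s c \<longleftrightarrow> (\<lambda>m. cmod (c m) / real (prime_code m) ^ s) summable_on UNIV"

lemma weighted_summable_mono:
  assumes "weighted_summable s c" "s \<le> s'"
  shows "weighted_summable s' c"
  unfolding weighted_summable_def
proof (rule summable_on_comparison_test)
  show "(\<lambda>m. cmod (c m) / real (prime_code m) ^ s) summable_on UNIV"
    using assms by (simp add: weighted_summable_def)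
  show "cmod (c m) / real (prime_code m) ^ s' \<le> cmod (c m) / real (prime_code m) ^ s" for m
    using assms(2) prime_code_ge_1[of m]
    by (intro divide_left_mono power_increasing) auto
qed auto

lemma norm_monom_fun: "cmod (monom_fun m x) = (\<Prod>i\<in>UNIV. cmod (x $ i) ^ (m $ i))"
  by (simp add: monom_fun_def norm_power flip: prod_norm)

lemma norm_monom_fun_mono:
  assumes "\<And>i. cmod (x $ i) \<le> cmod (y $ i)"
  shows "cmod (monom_fun m x) \<le> cmod (monom_fun m y)"
  unfolding norm_monom_fun using assms by (intro prod_mono) (auto intro: power_mono)

lemma norm_monom_fun_le_test_point:
  assumes "\<And>i. cmod (x $ i) \<le> cmod (test_point s $ i)"
  shows "cmod (monom_fun m x) \<le> 1 / real (prime_code m) ^ s"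
  using norm_monom_fun_mono[OF assms, of m] by (simp add: monom_fun_test_point norm_divide norm_power)

lemma eventually_small_coords:
  fixes r :: "'n::finite \<Rightarrow> real"
  assumes "\<And>i. r i > 0"
  shows "\<forall>\<^sub>F x in nhds (0 :: complex^'n). \<forall>i. cmod (x $ i) \<le> r i"
proof (rule eventually_all_finite)
  fix i :: 'n
  have "((\<lambda>x :: complex^'n. cmod (x $ i)) \<longlongrightarrow> cmod (0 $ i)) (nhds 0)"
    by (intro tendsto_intros filterlim_ident)
  then have "\<forall>\<^sub>F x in nhds (0 :: complex^'n). cmod (x $ i) < r i"
    using assms[of i] by (intro order_tendstoD) auto
  then show "\<forall>\<^sub>F x in nhds (0 :: complex^'n). cmod (x $ i) \<le> r i"
    by eventually_elim simp
qed

lemma eventually_le_test_point: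
  "\<forall>\<^sub>F x in nhds (0 :: complex^'n::finite). \<forall>i. cmod (x $ i) \<le> cmod (test_point s $ i)"
  using prime_of_ge_2
  by (intro eventually_small_coords) (auto simp: test_point_def zero_less_norm_iff prime_gt_0_nat prime_of)

lemma weighted_summable_abs_summable:
  assumes "weighted_summable s c" "\<And>i. cmod (x $ i) \<le> cmod (test_point s $ i)"
  shows "(\<lambda>m. cmod (c m * monom_fun m x)) summable_on UNIV"
proof (rule summable_on_comparison_test)
  show "(\<lambda>m. cmod (c m) / real (prime_code m) ^ s) summable_on UNIV"
    using assms by (simp add: weighted_summable_def)
  show "cmod (c m * monom_fun m x) \<le> cmod (c m) / real (prime_code m) ^ s" for m
    using mult_left_mono[OF norm_monom_fun_le_test_point[OF assms(2), of m], of "cmod (c m)"]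
    by (simp add: norm_mult)
qed auto

text \<open>
  Since the test points tend to 0, a series that represents a function near 0 converges absolutely at
  one of them; and absolute convergence there passes to all points with smaller coordinates.
\<close>

lemma has_power_series_iff:
  "(\<exists>f. has_power_series f c) \<longleftrightarrow> (\<exists>s. weighted_summable s (c :: nat^'n::finite \<Rightarrow> complex))"
proof
  assume "\<exists>f. has_power_series f c"
  then obtain f where "\<forall>\<^sub>F x in nhds 0. ((\<lambda>m. c m * monom_fun m x) has_sum f x) UNIV"
    by (auto simp: has_power_series_def)
  then have "\<forall>\<^sub>F s in sequentially.
      ((\<lambda>m. c m * monom_fun m (test_point s)) has_sum f (test_point s)) UNIV"
    by (rule eventually_compose_filterlim[OF _ test_point_tendsto_0])
  then obtain s where "((\<lambda>m. c m * monom_fun m (test_point s)) has_sum f (test_point s)) UNIV"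
    by (meson eventually_sequentially order_refl)
  then have "(\<lambda>m. c m * monom_fun m (test_point s)) summable_on UNIV"
    by (auto simp: summable_on_def)
  then show "\<exists>s. weighted_summable s c"
    by (subst (asm) summable_on_iff_abs_summable_on_complex)
       (auto simp: weighted_summable_def monom_fun_test_point norm_mult norm_divide norm_power)
next
  assume "\<exists>s. weighted_summable s c"
  then obtain s where s: "weighted_summable s c"
    by blast
  have "has_power_series (\<lambda>x. \<Sum>\<^sub>\<infinity>m. c m * monom_fun m x) c"
    unfolding has_power_series_def using eventually_le_test_point[of s]
  proof eventually_elim
    case (elim x)
    then have "(\<lambda>m. c m * monom_fun m x) summable_on UNIV"
      using weighted_summable_abs_summable[OF s]
      by (subst summable_on_iff_abs_summable_on_complex) auto
    then show ?case
      by (rule has_sum_infsum)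
  qed
  then show "\<exists>f. has_power_series f c" by blast
qed

definition weighted_norm :: "nat \<Rightarrow> (nat^'n \<Rightarrow> complex) \<Rightarrow> real" where
  "weighted_norm s c = (\<Sum>\<^sub>\<infinity>m. cmod (c m) / real (prime_code m) ^ s)"

text \<open>
  Every code that occurs is at least \<open>n + 1\<close>, so each term decays at least like the power \<open>s\<close> of
  \<open>n / (n + 1)\<close>: far enough out, a leading term of code \<open>n\<close> outweighs everything behind it.
\<close>

lemma weighted_norm_decay:
  assumes s0: "weighted_summable s0 t"
    and supp: "\<And>m. t m \<noteq> 0 \<Longrightarrow> n < prime_code m" and "\<epsilon> > 0"
  shows "\<forall>\<^sub>F s in sequentially. real n ^ s * weighted_norm s t \<le> \<epsilon>"
proof -
  define q where "q = real n / real (Suc n)"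
  have q: "0 \<le> q" "q < 1"
    by (auto simp: q_def)
  have "\<forall>\<^sub>F s in sequentially.
          real n ^ s * weighted_norm s t \<le> real n ^ s0 * weighted_norm s0 t * q ^ (s - s0)"
    using eventually_ge_at_top[of s0]
  proof eventually_elim
    case (elim s)
    have split: "x ^ s = x ^ s0 * x ^ (s - s0)" for x :: real
      using elim by (simp flip: power_add)
    have summ: "(\<lambda>m. real n ^ s * (cmod (t m) / real (prime_code m) ^ s)) summable_on UNIV"
      using weighted_summable_mono[OF s0 elim]
      by (intro summable_on_cmult_right) (simp add: weighted_summable_def)
    have summ0: "(\<lambda>m. real n ^ s0 * q ^ (s - s0) * (cmod (t m) / real (prime_code m) ^ s0))
             summable_on UNIV"
      using s0 by (intro summable_on_cmult_right) (simp add: weighted_summable_def)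
    have le: "real n ^ s * (cmod (t m) / real (prime_code m) ^ s) \<le>
                 real n ^ s0 * q ^ (s - s0) * (cmod (t m) / real (prime_code m) ^ s0)" for m
    proof (cases "t m = 0")
      case False
      then have m: "n < prime_code m" using supp by blast
      have "real n / real (prime_code m) \<le> q"
        unfolding q_def using m by (intro divide_left_mono) auto
      then have "(real n / real (prime_code m)) ^ (s - s0) \<le> q ^ (s - s0)"
        by (intro power_mono) auto
      then have "real n ^ s0 * (cmod (t m) / real (prime_code m) ^ s0) *
            (real n / real (prime_code m)) ^ (s - s0)
          \<le> real n ^ s0 * (cmod (t m) / real (prime_code m) ^ s0) * q ^ (s - s0)"
        by (intro mult_left_mono) auto
      moreover have "real n ^ s * (cmod (t m) / real (prime_code m) ^ s) =
         real n ^ s0 * (cmod (t m) / real (prime_code m) ^ s0) *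
            (real n / real (prime_code m)) ^ (s - s0)"
        by (simp add: power_divide split)
      ultimately show ?thesis by (simp only: mult_ac)
    qed (use q in auto)
    have "real n ^ s * weighted_norm s t =
            (\<Sum>\<^sub>\<infinity>m. real n ^ s * (cmod (t m) / real (prime_code m) ^ s))"
      unfolding weighted_norm_def by (rule infsum_cmult_right'[symmetric])
    also have "\<dots> \<le> (\<Sum>\<^sub>\<infinity>m. real n ^ s0 * q ^ (s - s0) *
            (cmod (t m) / real (prime_code m) ^ s0))"
      using summ summ0 le by (rule infsum_mono)
    also have "\<dots> = real n ^ s0 * q ^ (s - s0) * weighted_norm s0 t"
      unfolding weighted_norm_def by (rule infsum_cmult_right')
    finally show ?case by (simp only: mult_ac)
  qed
  moreover have "\<forall>\<^sub>F s in sequentially. real n ^ s0 * weighted_norm s0 t * q ^ (s - s0) < \<epsilon>"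
  proof (rule order_tendstoD(2))
    show "(\<lambda>s. real n ^ s0 * weighted_norm s0 t * q ^ (s - s0)) \<longlonglongrightarrow>
            real n ^ s0 * weighted_norm s0 t * 0"
    proof (intro tendsto_intros)
      have "(\<lambda>s. q ^ s) \<longlonglongrightarrow> 0"
        using q by (intro LIMSEQ_power_zero) auto
      then show "(\<lambda>s. q ^ (s - s0)) \<longlonglongrightarrow> 0"
        by (intro LIMSEQ_offset[of "\<lambda>s. q ^ (s - s0)" s0]) simp
    qed
  qed (use \<open>\<epsilon> > 0\<close> in simp)
  ultimately show ?thesis
    by eventually_elim simp
qed

lemma ex_minimal_prime_code:
  assumes "P m"
  shows "\<exists>k. P k \<and> (\<forall>l. P l \<longrightarrow> l \<noteq> k \<longrightarrow> prime_code k < prime_code l)"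
proof -
  obtain k where k: "P k" "\<And>l. P l \<Longrightarrow> prime_code k \<le> prime_code l"
    using arg_min_natI[of P m prime_code] arg_min_nat_le[of P _ prime_code] assms by metis
  then show ?thesis
    using inj_prime_code by (metis injD order_neq_le_trans)
qed

text \<open>
  As for Dirichlet series: compared with the nonzero term of smallest code, all others become
  negligible at test points close to 0.
\<close>

lemma weighted_coeffs_eq_0:
  fixes c :: "nat^'n::finite \<Rightarrow> complex"
  assumes s0: "weighted_summable s0 c"
    and zero: "\<forall>\<^sub>F s in sequentially. ((\<lambda>m. c m * monom_fun m (test_point s)) has_sum 0) UNIV"
  shows "c m = 0"
proof (rule ccontr)
  assume "c m \<noteq> 0"
  then obtain k where k: "c k \<noteq> 0"
      "\<And>l. c l \<noteq> 0 \<Longrightarrow> l \<noteq> k \<Longrightarrow> prime_code k < prime_code l"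
    using ex_minimal_prime_code[of "\<lambda>m. c m \<noteq> 0"] by blast
  define t where "t = c(k := 0)"
  have t: "weighted_summable s0 t"
    using s0 unfolding weighted_summable_def
    by (rule summable_on_comparison_test) (auto simp: t_def)
  have "\<forall>\<^sub>F s in sequentially. real (prime_code k) ^ s * weighted_norm s t \<le> cmod (c k) / 2"
    by (rule weighted_norm_decay[OF t]) (use k in \<open>auto simp: t_def split: if_splits\<close>)
  with zero eventually_ge_at_top[of s0] have "\<forall>\<^sub>F s in sequentially. False"
  proof eventually_elim
    case (elim s)
    have "((\<lambda>m. c m * monom_fun m (test_point s)) has_sum
            (0 - c k * monom_fun k (test_point s))) (UNIV - {k})"
      using elim(1) by (rule has_sum_Diff) (auto intro!: has_sum_finiteI)
    then have *: "((\<lambda>m. t m * monom_fun m (test_point s)) has_sum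
            (- c k * monom_fun k (test_point s))) UNIV"
      by (subst has_sum_cong_neutral[where T = "UNIV - {k}"]) (auto simp: t_def)
    have "cmod (- c k * monom_fun k (test_point s)) \<le> weighted_norm s t"
    proof (rule norm_infsum_le[OF *])
      show "((\<lambda>m. cmod (t m) / real (prime_code m) ^ s) has_sum weighted_norm s t) UNIV"
        unfolding weighted_norm_def using weighted_summable_mono[OF t elim(2)]
        by (intro has_sum_infsum) (simp add: weighted_summable_def)
    qed (auto simp: monom_fun_test_point norm_mult norm_divide norm_power)
    then have "cmod (c k) \<le> real (prime_code k) ^ s * weighted_norm s t"
      by (simp add: monom_fun_test_point norm_mult norm_divide norm_power field_simps)
    moreover have "cmod (c k) > 0" using k(1) by simp
    ultimately show ?case using elim(3) by linarith
  qed
  then show False by simp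
qed

lemma has_power_series_unique:
  fixes c d :: "nat^'n::finite \<Rightarrow> complex"
  assumes "has_power_series f c" "has_power_series g d" "\<forall>\<^sub>F x in nhds 0. f x = g x"
  shows "c = d"
proof
  fix m
  define e where "e m = c m + - d m" for m
  have e: "has_power_series (\<lambda>x. f x + - g x) e"
    unfolding e_def by (intro has_power_series_add has_power_series_uminus assms)
  then obtain s0 where "weighted_summable s0 e"
    using has_power_series_iff by blast
  moreover have "\<forall>\<^sub>F x in nhds 0. ((\<lambda>m. e m * monom_fun m x) has_sum 0) UNIV"
    using e assms(3) unfolding has_power_series_def by eventually_elim auto
  then have "\<forall>\<^sub>F s in sequentially. ((\<lambda>m. e m * monom_fun m (test_point s)) has_sum 0) UNIV"
    by (rule eventually_compose_filterlim[OF _ test_point_tendsto_0])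
  ultimately have "e m = 0"
    by (rule weighted_coeffs_eq_0)
  then show "c m = d m"
    by (simp add: e_def)
qed

section \<open>Germs and their coefficients\<close>

lemma same_germ_rep: "same_germ (rep_germ h) (rep_germ h)"
  using Quotient_rep_reflp[OF Quotient_germ] .

lemma abs_rep_germ [simp]: "abs_germ (rep_germ h) = h"
  using Quotient_abs_rep[OF Quotient_germ] .

lemma rep_abs_germ:
  assumes "analytic_at_zero f"
  shows "\<forall>\<^sub>F x in nhds 0. rep_germ (abs_germ f) x = f x"
proof -
  have "same_germ f f"
    using assms by (simp add: same_germ_def)
  then have "same_germ (rep_germ (abs_germ f)) f"
    using Quotient_rep_abs[OF Quotient_germ] by blast
  then show ?thesis
    by (simp add: same_germ_def)
qed

lemma germ_eqI:
  assumes "\<forall>\<^sub>F x in nhds 0. rep_germ g x = rep_germ h x"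
  shows "g = h"
proof -
  have "same_germ (rep_germ g) (rep_germ h)"
    using assms same_germ_rep[of g] same_germ_rep[of h] by (simp add: same_germ_def)
  then show ?thesis
    using Quotient_rel_rep[OF Quotient_germ] by blast
qed

lemma has_power_series_cong:
  assumes "has_power_series f c" "\<forall>\<^sub>F x in nhds 0. g x = f x"
  shows "has_power_series g c"
  using assms unfolding has_power_series_def by eventually_elim auto

lemma germ_coeff_eqI:
  assumes "has_power_series (rep_germ h) c"
  shows "germ_coeff h = c"
  unfolding germ_coeff_def
  by (rule the_equality) (use assms in \<open>auto intro: has_power_series_unique\<close>)

lemma has_power_series_germ: "has_power_series (rep_germ h) (germ_coeff h)"
proof -
  obtain c where "has_power_series (rep_germ h) c"
    using same_germ_rep[of h] by (auto simp: same_germ_def analytic_at_zero_def)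
  then show ?thesis
    using germ_coeff_eqI by blast
qed

lemma weighted_summable_germ: "\<exists>s. weighted_summable s (germ_coeff h)"
  using has_power_series_germ has_power_series_iff by blast

lemma ex_germ_coeff:
  assumes "weighted_summable s c"
  shows "\<exists>h. germ_coeff h = c"
proof -
  obtain f where f: "has_power_series f c"
    using assms has_power_series_iff by blast
  then have "analytic_at_zero f"
    by (auto simp: analytic_at_zero_def)
  then show ?thesis
    using f rep_abs_germ has_power_series_cong germ_coeff_eqI by blast
qed

lemma germ_eq_iff_coeff: "g = h \<longleftrightarrow> germ_coeff g = germ_coeff h"
proof
  assume "germ_coeff g = germ_coeff h"
  then have h: "has_power_series (rep_germ h) (germ_coeff g)"
    using has_power_series_germ[of h] by simp
  have "\<forall>\<^sub>F x in nhds 0. rep_germ g x = rep_germ h x"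
    using has_power_series_germ[of g] h unfolding has_power_series_def
    by eventually_elim (rule has_sum_unique)
  then show "g = h"
    by (rule germ_eqI)
qed simp

lemma rep_germ_plus: "\<forall>\<^sub>F x in nhds 0. rep_germ (g + h) x = rep_germ g x + rep_germ h x"
  using rep_abs_germ[of "\<lambda>x. rep_germ g x + rep_germ h x"] same_germ_rep[of g] same_germ_rep[of h]
  by (simp add: plus_germ_def map_fun_def same_germ_def analytic_at_zero_intros)

lemma rep_germ_times: "\<forall>\<^sub>F x in nhds 0. rep_germ (g * h) x = rep_germ g x * rep_germ h x"
  using rep_abs_germ[of "\<lambda>x. rep_germ g x * rep_germ h x"] same_germ_rep[of g] same_germ_rep[of h]
  by (simp add: times_germ_def map_fun_def same_germ_def analytic_at_zero_intros)

lemma rep_germ_zero: "\<forall>\<^sub>F x in nhds 0. rep_germ 0 x = 0"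
  using rep_abs_germ[of "\<lambda>x. 0"] by (simp add: zero_germ_def analytic_at_zero_intros)

lemma rep_germ_one: "\<forall>\<^sub>F x in nhds 0. rep_germ 1 x = 1"
  using rep_abs_germ[of "\<lambda>x. 1"] by (simp add: one_germ_def analytic_at_zero_intros)

lemma rep_germ_monom: "\<forall>\<^sub>F x in nhds 0. rep_germ (germ_monom m) x = monom_fun m x"
  using rep_abs_germ[of "monom_fun m"] by (simp add: germ_monom_def analytic_at_zero_intros)

lemma rep_germ_power: "\<forall>\<^sub>F x in nhds 0. rep_germ (h ^ d) x = rep_germ h x ^ d"
proof (induction d)
  case 0
  then show ?case using rep_germ_one by simp
next
  case (Suc d)
  from Suc rep_germ_times[of h "h ^ d"]
  have "\<forall>\<^sub>F x in nhds 0. rep_germ (h * h ^ d) x = rep_germ h x * rep_germ h x ^ d"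
    by eventually_elim simp
  then show ?case by simp
qed

lemma rep_germ_sum:
  assumes "finite A"
  shows "\<forall>\<^sub>F x in nhds 0. rep_germ (\<Sum>a\<in>A. f a) x = (\<Sum>a\<in>A. rep_germ (f a) x)"
  using assms
proof induction
  case empty
  then show ?case using rep_germ_zero by simp
next
  case (insert a A)
  from insert.IH rep_germ_plus[of "f a" "sum f A"]
  have "\<forall>\<^sub>F x in nhds 0.
      rep_germ (f a + sum f A) x = rep_germ (f a) x + (\<Sum>a\<in>A. rep_germ (f a) x)"
    by eventually_elim simp
  then show ?case using insert.hyps by simp
qed

lemma germ_coeff_plus: "germ_coeff (g + h) m = germ_coeff g m + germ_coeff h m"
  by (simp add: germ_coeff_eqI[OF has_power_series_cong[OF has_power_series_add rep_germ_plus,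
      OF has_power_series_germ has_power_series_germ]])

lemma germ_coeff_times:
  "germ_coeff (g * h) m = (\<Sum>(p, q)\<in>{(p, q). p + q = m}. germ_coeff g p * germ_coeff h q)"
  by (simp add: germ_coeff_eqI[OF has_power_series_cong[OF has_power_series_mult rep_germ_times,
      OF has_power_series_germ has_power_series_germ]])

lemma germ_coeff_zero [simp]: "germ_coeff 0 m = 0"
  by (simp add: germ_coeff_eqI[OF has_power_series_cong[OF has_power_series_zero rep_germ_zero]])

lemma germ_coeff_monom: "germ_coeff (germ_monom k) m = (if m = k then 1 else 0)"
  by (simp add: germ_coeff_eqI[OF has_power_series_cong[OF has_power_series_monom rep_germ_monom]])

lemma germ_coeff_sum:
  "finite A \<Longrightarrow> germ_coeff (\<Sum>a\<in>A. f a) m = (\<Sum>a\<in>A. germ_coeff (f a) m)"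
  by (induction A rule: finite_induct) (auto simp: germ_coeff_plus)

lemma germ_coeff_eq_0_iff: "h = 0 \<longleftrightarrow> (\<forall>m. germ_coeff h m = 0)"
  by (auto simp: germ_eq_iff_coeff fun_eq_iff)

section \<open>Dickson's lemma\<close>

lemma nat_seq_incseq_subseq:
  fixes g :: "nat \<Rightarrow> nat"
  shows "\<exists>r. strict_mono r \<and> incseq (\<lambda>n. g (r n))"
proof -
  obtain h where h: "strict_mono h" "monoseq (\<lambda>n. g (h n))"
    using seq_monosub by blast
  show ?thesis
  proof (cases "incseq (\<lambda>n. g (h n))")
    case False
    then have dec: "g (h n) \<le> g (h m)" if "m \<le> n" for m n
      using h(2) that by (auto simp: monoseq_iff decseq_def)
    obtain a where a: "\<And>n. g (h a) \<le> g (h n)"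
      using ex_has_least_nat[of "\<lambda>_. True" undefined "\<lambda>n. g (h n)"] by auto
    have "g (h (a + n)) = g (h a)" for n
      using a[of "a + n"] dec[of a "a + n"] by simp
    then have "incseq (\<lambda>n. g (h (a + n)))"
      by (simp add: incseq_def)
    moreover have "strict_mono (\<lambda>n. h (a + n))"
      using h(1) by (simp add: strict_mono_def)
    ultimately show ?thesis by blast
  qed (use h in blast)
qed

text \<open>
  Passing to subsequences makes the coordinates nondecreasing one after the other.
\<close>

lemma nat_vec_seq_comparable:
  fixes f :: "nat \<Rightarrow> nat^'n::finite"
  shows "\<exists>i j. i < j \<and> f i \<le> f j"
proof -
  have "\<exists>r :: nat \<Rightarrow> nat. strict_mono r \<and> (\<forall>i\<in>F. incseq (\<lambda>n. f (r n) $ i))" for F :: "'n set"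
    using finite[of F]
  proof induction
    case empty
    show ?case by (intro exI[of _ id]) (simp add: strict_mono_def)
  next
    case (insert i F)
    then obtain r where r: "strict_mono r" "\<forall>i\<in>F. incseq (\<lambda>n. f (r n) $ i)"
      by blast
    obtain h where h: "strict_mono h" "incseq (\<lambda>n. f (r (h n)) $ i)"
      using nat_seq_incseq_subseq[of "\<lambda>n. f (r n) $ i"] by blast
    have "strict_mono (r \<circ> h)"
      using r(1) h(1) by (rule strict_mono_o)
    moreover have "\<forall>i\<in>F. incseq (\<lambda>n. f (r (h n)) $ i)"
      using r(2) h(1) by (auto simp: incseq_def strict_mono_less_eq)
    ultimately show ?case
      using h(2) by (intro exI[of _ "r \<circ> h"]) (auto simp: o_def)
  qed
  from this[of UNIV] obtain r :: "nat \<Rightarrow> nat"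
    where r: "strict_mono r" "\<forall>i. incseq (\<lambda>n. f (r n) $ i)" by auto
  then have "r 0 < r 1" "f (r 0) \<le> f (r 1)"
    by (auto simp: strict_mono_def less_eq_vec_def incseq_def)
  then show ?thesis by blast
qed

text \<open>
  Distinct minimal elements are incomparable, while any sequence has a comparable pair.
\<close>

lemma finite_minimal_exponents:
  fixes E :: "(nat^'n::finite) set"
  shows "finite {e \<in> E. \<forall>e'\<in>E. e' \<le> e \<longrightarrow> e' = e}" (is "finite ?M")
proof (rule ccontr)
  assume "infinite ?M"
  then obtain f :: "nat \<Rightarrow> nat^'n" where f: "inj f" "range f \<subseteq> ?M"
    using infinite_countable_subset by blast
  obtain i j where ij: "i < j" "f i \<le> f j"
    using nat_vec_seq_comparable by blast
  have "f i \<in> E" "f j \<in> ?M" using f by auto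
  with ij have "f i = f j" by blast
  then show False using f(1) ij(1) by (auto simp: inj_def)
qed

lemma nat_vec_le_iff_add: "e \<le> m \<longleftrightarrow> (\<exists>q. m = q + (e :: nat^'n))"
proof
  assume "e \<le> m"
  then have "m = (m - e) + e"
    by (auto simp: less_eq_vec_def vec_eq_iff)
  then show "\<exists>q. m = q + e" ..
qed (auto simp: less_eq_vec_def)

lemma minimal_exponent_below:
  fixes E :: "(nat^'n::finite) set"
  assumes "m \<in> E"
  shows "\<exists>e \<in> {e \<in> E. \<forall>e'\<in>E. e' \<le> e \<longrightarrow> e' = e}. e \<le> m"
proof -
  obtain e where e: "e \<in> E" "e \<le> m"
      "\<And>l. l \<in> E \<Longrightarrow> l \<le> m \<Longrightarrow> l \<noteq> e \<Longrightarrow> prime_code e < prime_code l"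
    using ex_minimal_prime_code[of "\<lambda>e. e \<in> E \<and> e \<le> m" m] assms by auto
  have "e' = e" if "e' \<in> E" "e' \<le> e" for e'
  proof (rule ccontr)
    assume "e' \<noteq> e"
    then have "prime_code e < prime_code e'"
      using e that order_trans by blast
    moreover obtain q where "e = q + e'"
      using \<open>e' \<le> e\<close> nat_vec_le_iff_add by blast
    ultimately show False
      using prime_code_ge_1[of q] by (simp add: prime_code_add)
  qed
  with e show ?thesis by blast
qed

section \<open>Division of power series\<close>

lemma sum_antidiagonal_delta:
  fixes F :: "nat^'n::finite \<Rightarrow> complex"
  shows "(\<Sum>(a, u)\<in>{(a, u). a + u = p}. F a * (if u = e then 1 else 0)) =
           (if e \<le> p then F (p - e) else 0)"
proof -
  have "(\<Sum>(a, u)\<in>{(a, u). a + u = p}. F a * (if u = e then 1 else 0)) =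
        (\<Sum>(a, u)\<in>{(a, u). a + u = p} \<inter> {(a, u). u = e}. F a)"
    by (rule sum.mono_neutral_cong_right) (auto simp: finite_antidiagonal split: if_splits)
  also have "\<dots> = (if e \<le> p then F (p - e) else 0)"
  proof (cases "e \<le> p")
    case True
    then obtain q where "p = q + e" using nat_vec_le_iff_add by blast
    then have "{(a, u). a + u = p} \<inter> {(a, u). u = e} = {(p - e, e)}"
      by auto
    with True show ?thesis by simp
  next
    case False
    then have "{(a, u). a + u = p} \<inter> {(a, u). u = e} = {}"
      using nat_vec_le_iff_add by blast
    with False show ?thesis by simp
  qed
  finally show ?thesis .
qed

lemma ex_const_germ: "\<exists>k :: 'n::finite germ. \<forall>h m. germ_coeff (k * h) m = a * germ_coeff h m"
proof -
  define c :: "nat^'n \<Rightarrow> complex" where "c m = (if m = 0 then a else 0)" for m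
  have "weighted_summable 0 c"
    unfolding weighted_summable_def
    by (rule summable_on_cong_neutral[where T = "{0}", THEN iffD2]) (auto simp: c_def)
  then obtain k where k: "germ_coeff k = c"
    using ex_germ_coeff by blast
  have "germ_coeff (k * h) m = a * germ_coeff h m" for h m
  proof -
    have "germ_coeff (h * k) m =
      (\<Sum>(p, q)\<in>{(p, q). p + q = m}. (a * germ_coeff h p) * (if q = 0 then 1 else 0))"
      unfolding germ_coeff_times k by (intro sum.cong) (auto simp: c_def)
    also have "\<dots> = a * germ_coeff h m"
      by (subst sum_antidiagonal_delta) (auto simp: less_eq_vec_def)
    finally show ?thesis by (simp add: mult.commute)
  qed
  then show ?thesis by (intro exI[of _ k]) simp
qed

text \<open>
  The next two functions describe the division of a series by the series \<open>x\<^sup>e - t e\<close> for \<open>e \<in> E\<close>. The map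
  \<open>\<sigma>\<close> selects, for an exponent that some element of \<open>E\<close> divides, the divisor whose leading monomial is used to
  cancel it; \<open>quot_part \<sigma> D e\<close> collects the coefficients of \<open>D\<close> assigned to \<open>e\<close>, divided by \<open>x\<^sup>e\<close>, and
  \<open>div_step\<close> is what the cancellation by means of these quotients brings back through the tails. If
  \<open>D = c + div_step E \<sigma> t D\<close>, then the quotients of \<open>c\<close> are the quotient parts of \<open>D\<close>.
\<close>

definition quot_part :: "(nat^'n \<Rightarrow> nat^'n) \<Rightarrow> (nat^'n \<Rightarrow> complex) \<Rightarrow> nat^'n \<Rightarrow> nat^'n \<Rightarrow> complex" where
  "quot_part \<sigma> D e a = (if \<sigma> (a + e) = e then D (a + e) else 0)"

definition div_step :: "(nat^'n) set \<Rightarrow> (nat^'n \<Rightarrow> nat^'n) \<Rightarrow> (nat^'n \<Rightarrow> nat^'n \<Rightarrow> complex) \<Rightarrow>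
    (nat^'n \<Rightarrow> complex) \<Rightarrow> nat^'n \<Rightarrow> complex" where
  "div_step E \<sigma> t D p = (\<Sum>e\<in>E. \<Sum>(a, u)\<in>{(a, u). a + u = p}. quot_part \<sigma> D e a * t e u)"

context
  fixes E :: "(nat^'n::finite) set" and \<sigma> :: "nat^'n \<Rightarrow> nat^'n"
    and t :: "nat^'n \<Rightarrow> nat^'n \<Rightarrow> complex" and c :: "nat^'n \<Rightarrow> complex"
  assumes finE: "finite E"
    and tail: "\<And>e u. e \<in> E \<Longrightarrow> t e u \<noteq> 0 \<Longrightarrow> prime_code e < prime_code u"
begin

text \<open>
  The exponents of a tail \<open>t e\<close> are larger than \<open>e\<close>, so a coefficient of \<open>div_step E \<sigma> t D\<close> only depends
  on coefficients of \<open>D\<close> of smaller code. This is a well-founded recursion.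
\<close>

lemma ex_div_fixpoint: "\<exists>D. \<forall>p. D p = c p + div_step E \<sigma> t D p"
proof -
  define F where "F D p = c p + div_step E \<sigma> t D p" for D p
  have "adm_wf (Wellfounded.measure prime_code) F"
    unfolding adm_wf_def
  proof (intro allI impI)
    fix f g :: "nat^'n \<Rightarrow> complex" and p
    assume eq: "\<forall>z. (z, p) \<in> Wellfounded.measure prime_code \<longrightarrow> f z = g z"
    have "quot_part \<sigma> f e a * t e u = quot_part \<sigma> g e a * t e u" if "e \<in> E" "a + u = p" for e a u
    proof (cases "t e u = 0")
      case False
      then have "prime_code e < prime_code u" using tail that by blast
      then have "prime_code (a + e) < prime_code p"
        using that by (auto simp: prime_code_add)
      then have "f (a + e) = g (a + e)" using eq by simp
      then show ?thesis by (simp add: quot_part_def)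
    qed simp
    then show "F f p = F g p"
      unfolding F_def div_step_def by (intro arg_cong2[where f = "(+)"] sum.cong refl) auto
  qed
  then have "wfrec (Wellfounded.measure prime_code) F = F (wfrec (Wellfounded.measure prime_code) F)"
    by (intro wfrec_fixpoint) auto
  then show ?thesis
    unfolding F_def by metis
qed

text \<open>
  With tails this small, one division step at least halves the norm of the part of a series up to a given
  code. That part is a finite sum, so \<open>S \<le> \<parallel>c\<parallel> + S / 2\<close> can be solved for it, which bounds all partial
  sums of \<open>D\<close> at once.
\<close>

lemma weighted_summable_div_fixpoint:
  assumes D: "\<And>p. D p = c p + div_step E \<sigma> t D p"
    and c: "weighted_summable s c"
    and t: "\<And>e. e \<in> E \<Longrightarrow> weighted_summable s (t e)"
    and small: "\<And>e. e \<in> E \<Longrightarrow> real (prime_code e) ^ s * weighted_norm s (t e) \<le> 1 / 2"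
  shows "weighted_summable s D"
proof -
  define w where "w m = 1 / real (prime_code m) ^ s" for m :: "nat^'n"
  have w_add: "w (a + b) = w a * w b" for a b
    by (simp add: w_def prime_code_add power_mult_distrib)
  have w_pos: "w a \<ge> 0" for a by (simp add: w_def)
  let ?f = "\<lambda>e a u. cmod (quot_part \<sigma> D e a) * w a * (cmod (t e u) * w u)"
  define P where "P n = {m :: nat^'n. prime_code m \<le> n}" for n
  have finP: "finite (P n)" for n
    by (simp add: P_def finite_prime_code_le)
  define S where "S n = (\<Sum>m\<in>P n. cmod (D m) * w m)" for n
  have summ_c: "(\<lambda>m. cmod (c m) * w m) summable_on UNIV"
    using c by (simp add: weighted_summable_def w_def)
  have norm_c: "(\<Sum>m\<in>P n. cmod (c m) * w m) \<le> weighted_norm s c" for n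
  proof -
    have "(\<Sum>m\<in>P n. cmod (c m) * w m) \<le> (\<Sum>\<^sub>\<infinity>m. cmod (c m) * w m)"
      using summ_c finP w_pos by (intro finite_sum_le_infsum) auto
    then show ?thesis by (simp add: weighted_norm_def w_def)
  qed
  have norm_t: "(\<Sum>u\<in>P n. cmod (t e u) * w u) \<le> w e / 2" if "e \<in> E" for e n
  proof -
    have "(\<lambda>u. cmod (t e u) * w u) summable_on UNIV"
      using t[OF that] by (simp add: weighted_summable_def w_def)
    then have "(\<Sum>u\<in>P n. cmod (t e u) * w u) \<le> (\<Sum>\<^sub>\<infinity>u. cmod (t e u) * w u)"
      using finP w_pos by (intro finite_sum_le_infsum) auto
    also have "\<dots> = weighted_norm s (t e)"
      by (simp add: weighted_norm_def w_def)
    also have "\<dots> \<le> w e / 2"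
    proof -
      have "0 < real (prime_code e) ^ s" by simp
      then have "weighted_norm s (t e) \<le> (1 / 2) / real (prime_code e) ^ s"
        using small[OF that] by (simp only: pos_le_divide_eq mult.commute)
      then show ?thesis by (simp add: w_def)
    qed
    finally show ?thesis .
  qed
  have step: "(\<Sum>p\<in>P n. cmod (div_step E \<sigma> t D p) * w p) \<le> S n / 2" for n
  proof -
    define A where "A e = {a. a + e \<in> P n}" for e
    have finA: "finite (A e)" for e
      using finite_vimageI[OF finP[of n], of "\<lambda>a. a + e"] by (simp add: A_def vimage_def inj_def)
    have "(\<Sum>p\<in>P n. cmod (div_step E \<sigma> t D p) * w p) \<le>
        (\<Sum>p\<in>P n. \<Sum>e\<in>E. \<Sum>(a, u)\<in>{(a, u). a + u = p}. ?f e a u)"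
    proof (rule sum_mono)
      fix p assume "p \<in> P n"
      have "cmod (div_step E \<sigma> t D p) \<le>
          (\<Sum>e\<in>E. \<Sum>(a, u)\<in>{(a, u). a + u = p}. cmod (quot_part \<sigma> D e a * t e u))"
        unfolding div_step_def case_prod_unfold
        by (intro order_trans[OF norm_sum] sum_mono norm_sum)
      then have "cmod (div_step E \<sigma> t D p) * w p \<le>
          (\<Sum>e\<in>E. \<Sum>(a, u)\<in>{(a, u). a + u = p}. cmod (quot_part \<sigma> D e a * t e u)) * w p"
        by (intro mult_right_mono w_pos)
      also have "\<dots> = (\<Sum>e\<in>E. \<Sum>(a, u)\<in>{(a, u). a + u = p}.
          ?f e a u)"
        unfolding sum_distrib_right
        by (intro sum.cong) (auto simp: norm_mult w_add)
      finally show "cmod (div_step E \<sigma> t D p) * w p \<le> \<dots>" .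
    qed
    also have "\<dots> = (\<Sum>e\<in>E. \<Sum>p\<in>P n. \<Sum>(a, u)\<in>{(a, u). a + u = p}.
          ?f e a u)"
      by (rule sum.swap)
    also have "\<dots> \<le> (\<Sum>e\<in>E. \<Sum>a\<in>A e. cmod (D (a + e)) * w (a + e) * (if \<sigma> (a + e) = e then 1 else 0) / 2)"
    proof (rule sum_mono)
      fix e assume e: "e \<in> E"
      have "(\<Sum>p\<in>P n. \<Sum>(a, u)\<in>{(a, u). a + u = p}.
              ?f e a u) =
            (\<Sum>x\<in>Sigma (P n) (\<lambda>p. {(a, u). a + u = p}).
              cmod (quot_part \<sigma> D e (fst (snd x))) * w (fst (snd x)) * (cmod (t e (snd (snd x))) * w (snd (snd x))))"
        using finP finite_antidiagonal
        by (subst sum.Sigma) (auto simp: case_prod_unfold)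
      also have "\<dots> = (\<Sum>(a, u)\<in>{(a, u). a + u \<in> P n}. ?f e a u)"
        by (rule sum.reindex_bij_witness[of _ "\<lambda>(a, u). (a + u, (a, u))" snd]) auto
      also have "\<dots> \<le> (\<Sum>(a, u)\<in>A e \<times> P n. ?f e a u)"
      proof -
        \<comment> \<open>As \<open>e\<close> precedes \<open>u\<close>, the code of \<open>a + e\<close> is at most that of \<open>a + u\<close>.\<close>
        have "(a, u) \<in> A e \<times> P n" if "a + u \<in> P n" "t e u \<noteq> 0" for a u
        proof -
          have "prime_code e \<le> prime_code u"
            using tail[OF e that(2)] by simp
          then have "prime_code (a + e) \<le> prime_code (a + u)" "prime_code u \<le> prime_code (a + u)"
            using prime_code_ge_1[of a] by (auto simp: prime_code_add)
          with that(1) show ?thesis by (auto simp: A_def P_def)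
        qed
        then have sub: "{(a, u). a + u \<in> P n \<and> t e u \<noteq> 0} \<subseteq> A e \<times> P n" by auto
        have "{(a, u). a + u \<in> P n} = (\<Union>p\<in>P n. {(a, u). a + u = p})"
          by auto
        moreover have "finite (\<Union>p\<in>P n. {(a, u). a + u = p})"
          using finP by (rule finite_UN_I) (rule finite_antidiagonal)
        ultimately have "finite {(a, u). a + u \<in> P n}" by simp
        then have "(\<Sum>(a, u)\<in>{(a, u). a + u \<in> P n}. ?f e a u) =
          (\<Sum>(a, u)\<in>{(a, u). a + u \<in> P n \<and> t e u \<noteq> 0}. ?f e a u)"
        proof (rule sum.mono_neutral_right)
          show "\<forall>x\<in>{(a, u). a + u \<in> P n} - {(a, u). a + u \<in> P n \<and> t e u \<noteq> 0}.
              (case x of (a, u) \<Rightarrow> ?f e a u) = 0"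
            by clarsimp
        qed blast
        also have "\<dots> \<le> (\<Sum>(a, u)\<in>A e \<times> P n. ?f e a u)"
          using sub finA finP w_pos by (intro sum_mono2) auto
        finally show ?thesis .
      qed
      also have "\<dots> = (\<Sum>a\<in>A e. cmod (quot_part \<sigma> D e a) * w a * (\<Sum>u\<in>P n. cmod (t e u) * w u))"
        by (simp add: sum.cartesian_product sum_distrib_left)
      also have "\<dots> \<le> (\<Sum>a\<in>A e. cmod (quot_part \<sigma> D e a) * w a * (w e / 2))"
        by (intro sum_mono mult_left_mono norm_t e) (auto simp: w_pos)
      also have "\<dots> = (\<Sum>a\<in>A e. cmod (D (a + e)) * w (a + e) * (if \<sigma> (a + e) = e then 1 else 0) / 2)"
        by (intro sum.cong) (auto simp: quot_part_def w_add)
      finally show "(\<Sum>p\<in>P n. \<Sum>(a, u)\<in>{(a, u). a + u = p}.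
              ?f e a u) \<le> \<dots>" .
    qed
    also have "\<dots> \<le> (\<Sum>e\<in>E. \<Sum>m\<in>P n. cmod (D m) * w m * (if \<sigma> m = e then 1 else 0) / 2)"
    proof (rule sum_mono)
      fix e
      have "(\<Sum>a\<in>A e. cmod (D (a + e)) * w (a + e) * (if \<sigma> (a + e) = e then 1 else 0) / 2) =
            (\<Sum>m\<in>(\<lambda>a. a + e) ` A e. cmod (D m) * w m * (if \<sigma> m = e then 1 else 0) / 2)"
        by (subst sum.reindex) (auto simp: inj_on_def)
      also have "\<dots> \<le> (\<Sum>m\<in>P n. cmod (D m) * w m * (if \<sigma> m = e then 1 else 0) / 2)"
        using finP w_pos by (intro sum_mono2) (auto simp: A_def)
      finally show "(\<Sum>a\<in>A e. cmod (D (a + e)) * w (a + e) * (if \<sigma> (a + e) = e then 1 else 0) / 2) \<le> \<dots>" .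
    qed
    also have "\<dots> = (\<Sum>m\<in>P n. \<Sum>e\<in>E. cmod (D m) * w m * (if \<sigma> m = e then 1 else 0) / 2)"
      by (rule sum.swap)
    \<comment> \<open>Each exponent is assigned to at most one \<open>e\<close>, so no factor \<open>card E\<close> appears.\<close>
    also have "\<dots> \<le> (\<Sum>m\<in>P n. cmod (D m) * w m / 2)"
    proof (rule sum_mono)
      fix m
      have "(\<Sum>e\<in>E. cmod (D m) * w m * (if \<sigma> m = e then 1 else 0) / 2) =
            (\<Sum>e\<in>E. if \<sigma> m = e then cmod (D m) * w m / 2 else 0)"
        by (intro sum.cong) auto
      also have "\<dots> \<le> cmod (D m) * w m / 2"
        using finE w_pos[of m] by (subst sum.delta') auto
      finally show "(\<Sum>e\<in>E. cmod (D m) * w m * (if \<sigma> m = e then 1 else 0) / 2) \<le> \<dots>" .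
    qed
    also have "\<dots> = S n / 2"
      by (simp add: S_def sum_divide_distrib)
    finally show ?thesis .
  qed
  have "S n \<le> 2 * weighted_norm s c" for n
  proof -
    have "S n \<le> (\<Sum>m\<in>P n. cmod (c m) * w m + cmod (div_step E \<sigma> t D m) * w m)"
      unfolding S_def distrib_right[symmetric]
      by (intro sum_mono mult_right_mono w_pos) (subst D, rule norm_triangle_ineq)
    also have "\<dots> \<le> weighted_norm s c + S n / 2"
      using norm_c[of n] step[of n] by (simp add: sum.distrib)
    finally show ?thesis by simp
  qed
  note S = this
  have "(\<lambda>m. cmod (D m) * w m) summable_on UNIV"
  proof (rule nonneg_bdd_above_summable_on)
    have "sum (\<lambda>m. cmod (D m) * w m) F \<le> 2 * weighted_norm s c" if "finite F" for F
    proof -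
      have "F \<subseteq> P (Max (prime_code ` F))"
        using that by (auto simp: P_def)
      then have "sum (\<lambda>m. cmod (D m) * w m) F \<le> S (Max (prime_code ` F))"
        unfolding S_def using finP w_pos by (intro sum_mono2) auto
      with S show ?thesis using order_trans by blast
    qed
    then show "bdd_above (sum (\<lambda>m. cmod (D m) * w m) ` {F. F \<subseteq> UNIV \<and> finite F})"
      by (auto simp: bdd_above_def)
  qed (use w_pos in auto)
  then show ?thesis
    by (simp add: weighted_summable_def w_def)
qed

end

lemma weighted_summable_shift:
  assumes "weighted_summable s D" "\<And>a. cmod (q a) \<le> cmod (D (a + e))"
  shows "weighted_summable s q"
  unfolding weighted_summable_def
proof (rule summable_on_comparison_test)
  have "((\<lambda>m. cmod (D m) / real (prime_code m) ^ s) \<circ> (\<lambda>a. a + e)) summable_on UNIV"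
    using assms(1) unfolding weighted_summable_def
    by (subst summable_on_reindex[symmetric])
       (auto simp: inj_def intro: summable_on_subset_banach)
  then have "(\<lambda>a. real (prime_code e) ^ s * (cmod (D (a + e)) / real (prime_code (a + e)) ^ s)) summable_on UNIV"
    by (intro summable_on_cmult_right) (simp add: o_def)
  then show "(\<lambda>a. cmod (D (a + e)) / real (prime_code a) ^ s) summable_on UNIV"
    by (simp add: prime_code_add power_mult_distrib)
  show "cmod (q a) / real (prime_code a) ^ s \<le> cmod (D (a + e)) / real (prime_code a) ^ s" for a
    using assms(2) by (intro divide_right_mono) auto
qed auto

definition initial_exponent :: "'n::finite germ \<Rightarrow> nat^'n \<Rightarrow> bool" where
  "initial_exponent h m \<longleftrightarrow>
     germ_coeff h m \<noteq> 0 \<and> (\<forall>k. germ_coeff h k \<noteq> 0 \<longrightarrow> k \<noteq> m \<longrightarrow> prime_code m < prime_code k)"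

lemma ex_initial_exponent: "h \<noteq> 0 \<Longrightarrow> \<exists>m. initial_exponent h m"
  unfolding initial_exponent_def germ_coeff_eq_0_iff
  using ex_minimal_prime_code[of "\<lambda>m. germ_coeff h m \<noteq> 0"] by blast

text \<open>
  The division theorem of Grauert and Hironaka. For large \<open>s\<close> each tail is small at \<open>test_point s\<close>
  compared with its leading monomial, so the quotients found by formal division converge.
\<close>

lemma germ_division:
  fixes E :: "(nat^'n::finite) set" and g :: "nat^'n \<Rightarrow> 'n germ"
  assumes finE: "finite E"
    and g: "\<And>e. e \<in> E \<Longrightarrow> initial_exponent (g e) e" "\<And>e. e \<in> E \<Longrightarrow> germ_coeff (g e) e = 1"
  shows "\<exists>q r. f = (\<Sum>e\<in>E. q e * g e) + r \<and>
           (\<forall>m. germ_coeff r m \<noteq> 0 \<longrightarrow> (\<forall>e\<in>E. \<not> e \<le> m))"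
proof -
  define c where "c = germ_coeff f"
  define t where "t e u = (if u = e then 0 else - germ_coeff (g e) u)" for e u
  define \<sigma> where "\<sigma> m = (SOME e. e \<in> E \<and> e \<le> m)" for m
  have \<sigma>: "\<sigma> m \<in> E" "\<sigma> m \<le> m" if "e \<in> E" "e \<le> m" for m e
    using someI[of "\<lambda>e. e \<in> E \<and> e \<le> m" e] that by (auto simp: \<sigma>_def)
  have tail: "prime_code e < prime_code u" if "e \<in> E" "t e u \<noteq> 0" for e u
    using that g(1)[of e] by (auto simp: t_def initial_exponent_def split: if_splits)
  have "\<forall>\<^sub>F s in sequentially. weighted_summable s c"
    using weighted_summable_germ[of f] weighted_summable_mono
    by (auto simp: c_def eventually_sequentially)
  moreover have "\<forall>\<^sub>F s in sequentially. \<forall>e\<in>E. weighted_summable s (t e) \<and>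
      real (prime_code e) ^ s * weighted_norm s (t e) \<le> 1 / 2"
  proof (intro eventually_ball_finite finE ballI eventually_conj)
    fix e assume e: "e \<in> E"
    obtain s0 where s0: "weighted_summable s0 (germ_coeff (g e))"
      using weighted_summable_germ by blast
    then have t: "weighted_summable s0 (t e)"
      unfolding weighted_summable_def
      by (rule summable_on_comparison_test) (auto simp: t_def)
    then show "\<forall>\<^sub>F s in sequentially. weighted_summable s (t e)"
      using weighted_summable_mono by (auto simp: eventually_sequentially)
    show "\<forall>\<^sub>F s in sequentially. real (prime_code e) ^ s * weighted_norm s (t e) \<le> 1 / 2"
      using t tail[OF e] by (intro weighted_norm_decay) auto
  qed
  ultimately have "\<forall>\<^sub>F s in sequentially. weighted_summable s c \<and> (\<forall>e\<in>E. weighted_summable s (t e) \<and>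
      real (prime_code e) ^ s * weighted_norm s (t e) \<le> 1 / 2)"
    by (rule eventually_conj)
  then obtain s where s: "weighted_summable s c" "\<And>e. e \<in> E \<Longrightarrow> weighted_summable s (t e)"
      "\<And>e. e \<in> E \<Longrightarrow> real (prime_code e) ^ s * weighted_norm s (t e) \<le> 1 / 2"
    by (auto simp: eventually_sequentially)
  obtain D where D: "\<And>p. D p = c p + div_step E \<sigma> t D p"
    using ex_div_fixpoint[OF finE tail, where c = c and \<sigma> = \<sigma>] by blast
  have sD: "weighted_summable s D"
    using weighted_summable_div_fixpoint[OF finE tail D s] .
  have "\<exists>q. \<forall>e. germ_coeff (q e) = quot_part \<sigma> D e"
  proof (intro choice allI ex_germ_coeff)
    show "weighted_summable s (quot_part \<sigma> D e)" for e
      using sD by (rule weighted_summable_shift) (auto simp: quot_part_def)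
  qed
  then obtain q where q: "\<And>e. germ_coeff (q e) = quot_part \<sigma> D e" by blast
  define R where "R m = (if \<exists>e\<in>E. e \<le> m then 0 else D m)" for m
  have "weighted_summable s R"
    using weighted_summable_shift[OF sD, of R 0] by (auto simp: R_def)
  then obtain r where r: "germ_coeff r = R"
    using ex_germ_coeff by blast
  have "f = (\<Sum>e\<in>E. q e * g e) + r"
    unfolding germ_eq_iff_coeff
  proof
    fix p
    have coeff_g: "germ_coeff (g e) u = (if u = e then 1 else 0) - t e u" if "e \<in> E" for e u
      using g(2)[OF that] by (simp add: t_def)
    have "germ_coeff ((\<Sum>e\<in>E. q e * g e) + r) p =
        (\<Sum>e\<in>E. \<Sum>(a, u)\<in>{(a, u). a + u = p}. quot_part \<sigma> D e a * ((if u = e then 1 else 0) - t e u)) + R p"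
      by (simp add: germ_coeff_plus germ_coeff_sum finE germ_coeff_times q r coeff_g)
    also have "\<dots> = (\<Sum>e\<in>E. \<Sum>(a, u)\<in>{(a, u). a + u = p}. quot_part \<sigma> D e a * (if u = e then 1 else 0))
        - div_step E \<sigma> t D p + R p"
      by (simp add: div_step_def right_diff_distrib sum_subtractf case_prod_unfold)
    also have "(\<Sum>e\<in>E. \<Sum>(a, u)\<in>{(a, u). a + u = p}. quot_part \<sigma> D e a * (if u = e then 1 else 0))
        = (\<Sum>e\<in>E. if e = \<sigma> p then (if \<exists>e\<in>E. e \<le> p then D p else 0) else 0)"
    proof (rule sum.cong)
      fix e assume e: "e \<in> E"
      show "(\<Sum>(a, u)\<in>{(a, u). a + u = p}. quot_part \<sigma> D e a * (if u = e then 1 else 0)) =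
          (if e = \<sigma> p then (if \<exists>e\<in>E. e \<le> p then D p else 0) else 0)"
      proof (cases "e \<le> p")
        case True
        then have "p - e + e = p" by (auto simp: vec_eq_iff less_eq_vec_def)
        with True e show ?thesis
          by (subst sum_antidiagonal_delta) (auto simp: quot_part_def)
      next
        case False
        with e \<sigma>[of _ p] show ?thesis
          by (subst sum_antidiagonal_delta) auto
      qed
    qed simp
    also have "\<dots> = (if \<exists>e\<in>E. e \<le> p then D p else 0)"
      using \<sigma>[of _ p] finE by (auto simp: sum.delta)
    also have "\<dots> - div_step E \<sigma> t D p + R p = c p"
      using D[of p] by (auto simp: R_def)
    finally show "germ_coeff f p = germ_coeff ((\<Sum>e\<in>E. q e * g e) + r) p"
      by (simp add: c_def)
  qed
  moreover have "\<forall>m. germ_coeff r m \<noteq> 0 \<longrightarrow> (\<forall>e\<in>E. \<not> e \<le> m)"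
    by (auto simp: r R_def)
  ultimately show ?thesis by blast
qed

text \<open>
  Divide by elements whose initial exponents are the finitely many minimal ones of the ideal. The
  remainder is in the ideal, but none of its exponents is an initial exponent of the ideal, so it is 0.
\<close>

theorem germ_ideal_finitely_generated:
  fixes I :: "'n::finite germ set"
  assumes "ideal.subspace I"
  shows "\<exists>gs. I = ideal.span (set gs)"
proof -
  define X where "X = {m. \<exists>h\<in>I. initial_exponent h m}"
  define E where "E = {e \<in> X. \<forall>e'\<in>X. e' \<le> e \<longrightarrow> e' = e}"
  have finE: "finite E"
    unfolding E_def by (rule finite_minimal_exponents)
  have "\<forall>e\<in>E. \<exists>g. g \<in> I \<and> initial_exponent g e \<and> germ_coeff g e = 1"
  proof
    fix e assume "e \<in> E"
    then obtain h where h: "h \<in> I" "initial_exponent h e"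
      by (auto simp: E_def X_def)
    obtain k where k: "\<And>m. germ_coeff (k * h) m = inverse (germ_coeff h e) * germ_coeff h m"
      using ex_const_germ by blast
    have "k * h \<in> I"
      using h(1) by (rule ideal.subspace_scale[OF assms])
    then show "\<exists>g. g \<in> I \<and> initial_exponent g e \<and> germ_coeff g e = 1"
      using h(2) by (intro exI[of _ "k * h"]) (auto simp: initial_exponent_def k)
  qed
  from bchoice[OF this] obtain g
    where "\<forall>e\<in>E. g e \<in> I \<and> initial_exponent (g e) e \<and> germ_coeff (g e) e = 1" ..
  then have g: "\<And>e. e \<in> E \<Longrightarrow> g e \<in> I" "\<And>e. e \<in> E \<Longrightarrow> initial_exponent (g e) e"
      "\<And>e. e \<in> E \<Longrightarrow> germ_coeff (g e) e = 1"
    by simp_all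
  obtain gs where gs: "set gs = g ` E"
    using finite_list[OF finite_imageI[OF finE]] ..
  have "f \<in> ideal.span (g ` E)" if f: "f \<in> I" for f
  proof -
    obtain q r where qr: "f = (\<Sum>e\<in>E. q e * g e) + r"
        "\<And>m e. germ_coeff r m \<noteq> 0 \<Longrightarrow> e \<in> E \<Longrightarrow> \<not> e \<le> m"
      using germ_division[OF finE g(2,3), of f] by blast
    have sum_in: "(\<Sum>e\<in>E. q e * g e) \<in> ideal.span (g ` E)"
      by (intro ideal.span_sum ideal.span_scale ideal.span_base imageI)
    moreover have "ideal.span (g ` E) \<subseteq> I"
      using g(1) by (intro ideal.span_minimal assms) auto
    ultimately have "f - (\<Sum>e\<in>E. q e * g e) \<in> I"
      using f by (intro ideal.subspace_diff assms) auto
    then have "r \<in> I" by (simp add: qr(1))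
    have "r = 0"
    proof (rule ccontr)
      assume "r \<noteq> 0"
      then obtain m where m: "initial_exponent r m"
        using ex_initial_exponent by blast
      with \<open>r \<in> I\<close> have "m \<in> X" by (auto simp: X_def)
      then obtain e where "e \<in> E" "e \<le> m"
        using minimal_exponent_below[of m X] unfolding E_def by blast
      with qr(2) m show False by (auto simp: initial_exponent_def)
    qed
    with qr(1) sum_in show ?thesis by simp
  qed
  moreover have "ideal.span (g ` E) \<subseteq> I"
    using g(1) by (intro ideal.span_minimal assms) auto
  ultimately have "I = ideal.span (set gs)"
    unfolding gs by blast
  then show ?thesis ..
qed

lemma span_ideal_gens:
  assumes "ideal.subspace (I :: 'n::finite germ set)"
  shows "I = ideal.span (set (ideal_gens I))"
  unfolding ideal_gens_def using germ_ideal_finitely_generated[OF assms] by (rule someI_ex)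

section \<open>Growth of germs near the origin\<close>

text \<open>
  Scaling the \<open>i\<close>-th coordinate by \<open>t powr (a $ i)\<close> multiplies the monomial with exponent \<open>k\<close> by \<open>t\<close> to the power
  \<open>a \<bullet> k\<close>, which is at most \<open>t powr l\<close>; what remains is an absolutely convergent series.
\<close>

lemma weighted_growth_bound:
  fixes a :: "real^'n::finite"
  assumes a: "\<And>i. a $ i \<ge> 0"
    and supp: "\<And>k. germ_coeff h k \<noteq> 0 \<Longrightarrow> l \<le> a \<bullet> (\<chi> i. real (k $ i))"
  shows "\<exists>r0>0. \<exists>C. \<forall>t\<in>{0<..1}. \<forall>x. (\<forall>i. cmod (x $ i) \<le> r0 * t powr (a $ i)) \<longrightarrow>
            cmod (rep_germ h x) \<le> C * t powr l"
proof -
  define c where "c = germ_coeff h"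
  obtain s where s: "weighted_summable s c"
    using weighted_summable_germ by (auto simp: c_def)
  have "\<forall>\<^sub>F x in nhds 0. ((\<lambda>m. c m * monom_fun m x) has_sum rep_germ h x) UNIV"
    using has_power_series_germ[of h] by (simp add: has_power_series_def c_def)
  then obtain d where d: "d > 0"
      "\<And>x. dist x 0 < d \<Longrightarrow> ((\<lambda>m. c m * monom_fun m x) has_sum rep_germ h x) UNIV"
    by (auto simp: eventually_nhds_metric)
  define r where "r = Min (insert (d / (2 * real CARD('n))) (range (\<lambda>i :: 'n. 1 / real (prime_of i) ^ s)))"
  have pos: "real (prime_of i) > 0" for i :: 'n
    using prime_of_ge_2[of i] by linarith
  have r: "r > 0" "r \<le> d / (2 * real CARD('n))"
    using d pos by (auto simp: r_def)
  have r_le: "r \<le> 1 / real (prime_of i) ^ s" for i :: 'n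
    unfolding r_def by (rule Min_le) auto
  define C where "C = weighted_norm s c"
  have "cmod (rep_germ h x) \<le> C * t powr l"
    if t: "t \<in> {0<..1}" and x: "\<And>i. cmod (x $ i) \<le> r * t powr (a $ i)" for t x
  proof -
    have "cmod (x $ i) \<le> r" for i
    proof -
      have "t powr (a $ i) \<le> t powr 0"
        using t a by (intro powr_mono') auto
      then have "r * t powr (a $ i) \<le> r * 1"
        using t r(1) by (intro mult_left_mono) auto
      with x[of i] show ?thesis by simp
    qed
    then have "norm x \<le> (\<Sum>i\<in>(UNIV :: 'n set). r)"
      unfolding norm_vec_def by (intro order_trans[OF L2_set_le_sum] sum_mono) auto
    also have "\<dots> \<le> d / 2"
    proof -
      have "real CARD('n) * r \<le> real CARD('n) * (d / (2 * real CARD('n)))"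
        using r(2) by (intro mult_left_mono) auto
      then show ?thesis by simp
    qed
    finally have "((\<lambda>m. c m * monom_fun m x) has_sum rep_germ h x) UNIV"
      using d by simp
    then show ?thesis
    proof (rule norm_infsum_le)
      have "((\<lambda>m. cmod (c m) / real (prime_code m) ^ s) has_sum C) UNIV"
        unfolding C_def weighted_norm_def using s
        by (intro has_sum_infsum) (simp add: weighted_summable_def)
      then show "((\<lambda>m. cmod (c m) / real (prime_code m) ^ s * t powr l) has_sum C * t powr l) UNIV"
        by (rule has_sum_cmult_left)
      show "cmod (c m * monom_fun m x) \<le> cmod (c m) / real (prime_code m) ^ s * t powr l" for m
      proof (cases "c m = 0")
        case False
        have "cmod (monom_fun m x) \<le> (\<Prod>i\<in>UNIV. (1 / real (prime_of i) ^ s * t powr (a $ i)) ^ (m $ i))"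
          unfolding norm_monom_fun
        proof (intro prod_mono conjI power_mono)
          show "cmod (x $ i) \<le> 1 / real (prime_of i) ^ s * t powr (a $ i)" for i
            using x[of i] mult_right_mono[OF r_le[of i], of "t powr a $ i"] by simp
        qed auto
        also have "\<dots> = (\<Prod>i\<in>UNIV. (1 / real (prime_of i) ^ s) ^ (m $ i)) * (\<Prod>i\<in>UNIV. (t powr (a $ i)) ^ (m $ i))"
          by (simp only: power_mult_distrib prod.distrib)
        also have "(\<Prod>i\<in>UNIV. (1 / real (prime_of i) ^ s) ^ (m $ i)) = 1 / real (prime_code m) ^ s"
          by (simp add: prime_code_def power_divide prod_dividef prod_power_distrib mult.commute
             flip: power_mult)
        also have "(\<Prod>i\<in>UNIV. (t powr (a $ i)) ^ (m $ i)) = t powr (a \<bullet> (\<chi> i. real (m $ i)))"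
          using t by (simp add: inner_vec_def powr_sum powr_powr flip: powr_realpow)
        also have "1 / real (prime_code m) ^ s * t powr (a \<bullet> (\<chi> i. real (m $ i)))
            \<le> 1 / real (prime_code m) ^ s * t powr l"
          using t supp[of m] False by (intro mult_left_mono powr_mono') (auto simp: c_def)
        finally have "cmod (c m) * cmod (monom_fun m x) \<le> cmod (c m) * (1 / real (prime_code m) ^ s * t powr l)"
          by (intro mult_left_mono) auto
        then show ?thesis by (simp add: norm_mult)
      qed auto
    qed
  qed
  then show ?thesis using r(1) by blast
qed

lemma germ_bounded: "\<exists>B. \<forall>\<^sub>F x in nhds 0. cmod (rep_germ h x) \<le> B"
proof -
  obtain r C where r: "r > 0" and C: "\<forall>t\<in>{0<..1}. \<forall>x. (\<forall>i. cmod (x $ i) \<le> r * t powr (0 $ i)) \<longrightarrow>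
      cmod (rep_germ h x) \<le> C * t powr 0"
    using weighted_growth_bound[of 0 h 0] by auto
  have "\<forall>\<^sub>F x in nhds 0. cmod (rep_germ h x) \<le> C"
    using eventually_small_coords[of "\<lambda>_. r", OF r]
  proof eventually_elim
    case (elim x)
    with bspec[OF C, of 1] show ?case by simp
  qed
  then show ?thesis ..
qed

definition dominated :: "(complex^'n \<Rightarrow> real) \<Rightarrow> 'n::finite germ \<Rightarrow> bool" where
  "dominated G h \<longleftrightarrow> (\<exists>C. \<forall>\<^sub>F x in nhds 0. cmod (rep_germ h x) \<le> C * G x)"

lemma dominated_mult:
  assumes "dominated G g" "dominated H h"
  shows "dominated (\<lambda>x. G x * H x) (g * h)"
proof -
  obtain C D where CD: "\<forall>\<^sub>F x in nhds 0. cmod (rep_germ g x) \<le> C * G x"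
     "\<forall>\<^sub>F x in nhds 0. cmod (rep_germ h x) \<le> D * H x"
    using assms by (auto simp: dominated_def)
  then have "\<forall>\<^sub>F x in nhds 0. cmod (rep_germ (g * h) x) \<le> (C * D) * (G x * H x)"
    using rep_germ_times[of g h]
  proof eventually_elim
    case (elim x)
    have "cmod (rep_germ (g * h) x) = cmod (rep_germ g x) * cmod (rep_germ h x)"
      using elim by (simp add: norm_mult)
    also have "\<dots> \<le> (C * G x) * (D * H x)"
      using elim order_trans[OF norm_ge_zero elim(1)] by (intro mult_mono) auto
    finally show ?case by (simp only: mult_ac)
  qed
  then show ?thesis unfolding dominated_def by blast
qed

lemma dominated_const_1: "dominated (\<lambda>_. 1) h"
  using germ_bounded[of h] by (simp add: dominated_def)

text \<open>
  Germs are bounded near 0, so domination passes from generators to the ideal that they generate.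
\<close>

lemma subspace_dominated: "ideal.subspace {h. dominated G h}"
proof (rule ideal.subspaceI)
  have "\<forall>\<^sub>F x in nhds 0. cmod (rep_germ 0 x) \<le> 0 * G x"
    using rep_germ_zero by eventually_elim simp
  then show "0 \<in> {h. dominated G h}"
    unfolding dominated_def by blast
next
  fix g h assume "g \<in> {h. dominated G h}" "h \<in> {h. dominated G h}"
  then obtain C D where "\<forall>\<^sub>F x in nhds 0. cmod (rep_germ g x) \<le> C * G x"
     "\<forall>\<^sub>F x in nhds 0. cmod (rep_germ h x) \<le> D * G x"
    by (auto simp: dominated_def)
  then have "\<forall>\<^sub>F x in nhds 0. cmod (rep_germ (g + h) x) \<le> (C + D) * G x"
    using rep_germ_plus[of g h]
    by eventually_elim (metis add_mono distrib_right norm_triangle_ineq order_trans)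
  then show "g + h \<in> {h. dominated G h}"
    unfolding dominated_def by blast
next
  fix c h assume "h \<in> {h. dominated G h}"
  then show "c * h \<in> {h. dominated G h}"
    using dominated_mult[OF dominated_const_1, of G h c] by simp
qed

definition gens_norm :: "'n::finite germ list \<Rightarrow> complex^'n \<Rightarrow> real" where
  "gens_norm gs x = sqrt (\<Sum>g\<leftarrow>gs. (cmod (rep_germ g x))\<^sup>2)"

lemma gens_norm_nonneg [simp]: "gens_norm gs x \<ge> 0"
  by (auto simp: gens_norm_def intro!: sum_list_nonneg)

lemma gens_norm_squared: "(gens_norm gs x)\<^sup>2 = (\<Sum>g\<leftarrow>gs. (cmod (rep_germ g x))\<^sup>2)"
  unfolding gens_norm_def by (rule real_sqrt_pow2) (auto intro!: sum_list_nonneg)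

lemma dominated_gen: "g \<in> set gs \<Longrightarrow> dominated (gens_norm gs) g"
proof -
  assume "g \<in> set gs"
  then have "(cmod (rep_germ g x))\<^sup>2 \<le> (gens_norm gs x)\<^sup>2" for x
    unfolding gens_norm_squared by (intro member_le_sum_list) auto
  then have "cmod (rep_germ g x) \<le> 1 * gens_norm gs x" for x
    by (metis gens_norm_nonneg mult_1 power2_le_imp_le)
  then show ?thesis unfolding dominated_def by (intro exI[of _ 1]) simp
qed

lemma dominated_span:
  "(\<And>g. g \<in> X \<Longrightarrow> dominated G g) \<Longrightarrow> h \<in> ideal.span X \<Longrightarrow> dominated G h"
  using ideal.span_minimal[OF _ subspace_dominated, of X G] by blast

lemma gens_norm_squared_bound:
  assumes "\<And>g. g \<in> set gs \<Longrightarrow> \<forall>\<^sub>F x in F. cmod (rep_germ g (u x)) \<le> C g * G x"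
  shows "\<exists>D\<ge>0. \<forall>\<^sub>F x in F. (gens_norm gs (u x))\<^sup>2 \<le> D * (G x)\<^sup>2"
  using assms unfolding gens_norm_squared
proof (induction gs)
  case (Cons g gs)
  then obtain D where D: "D \<ge> 0"
     "\<forall>\<^sub>F x in F. (\<Sum>g\<leftarrow>gs. (cmod (rep_germ g (u x)))\<^sup>2) \<le> D * (G x)\<^sup>2"
    by auto
  have "\<forall>\<^sub>F x in F. cmod (rep_germ g (u x)) \<le> C g * G x"
    using Cons.prems by simp
  with D(2) have "\<forall>\<^sub>F x in F. (\<Sum>g\<leftarrow>g # gs. (cmod (rep_germ g (u x)))\<^sup>2) \<le> ((C g)\<^sup>2 + D) * (G x)\<^sup>2"
  proof eventually_elim
    case (elim x)
    have "(cmod (rep_germ g (u x)))\<^sup>2 \<le> (C g * G x)\<^sup>2"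
      using elim(2) by (intro power_mono) auto
    with elim(1) show ?case by (simp add: power_mult_distrib distrib_right)
  qed
  moreover have "(C g)\<^sup>2 + D \<ge> 0" using D(1) by simp
  ultimately show ?case by blast
qed (auto intro: exI[of _ 0])

lemma dominated_ideal_power:
  assumes "\<And>g. g \<in> I \<Longrightarrow> dominated G g" "h \<in> ideal_power I i"
  shows "dominated (\<lambda>x. G x ^ i) h"
  using assms(2)
proof (induction i arbitrary: h)
  case 0
  then show ?case using dominated_const_1 by simp
next
  case (Suc i)
  show ?case
  proof (rule dominated_span)
    show "h \<in> ideal.span {x * y |x y. x \<in> I \<and> y \<in> ideal_power I i}"
      using Suc.prems by simp
    show "dominated (\<lambda>x. G x ^ Suc i) g"
      if "g \<in> {x * y |x y. x \<in> I \<and> y \<in> ideal_power I i}" for g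
      using that dominated_mult[OF assms(1) Suc.IH] by auto
  qed
qed

text \<open>
  Cauchy's bound for the zeros of a monic polynomial, in homogeneous form: the \<open>i\<close>-th coefficient is
  bounded by a multiple of the \<open>i\<close>-th power of \<open>G\<close>, and so a zero is bounded by a multiple of \<open>G\<close>.
\<close>

lemma root_bound:
  fixes y G :: real
  assumes "d \<ge> 1" "y \<ge> 0" "G \<ge> 0" "\<And>i. i \<in> {1..d} \<Longrightarrow> C i \<ge> 0"
    and le: "y ^ d \<le> (\<Sum>i=1..d. C i * G ^ i * y ^ (d - i))"
  shows "y \<le> (1 + (\<Sum>i=1..d. C i)) * G"
proof (rule ccontr)
  define B where "B = 1 + (\<Sum>i=1..d. C i)"
  have "(\<Sum>i=1..d. C i) \<ge> 0" using assms(4) by (intro sum_nonneg)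
  then have B: "B \<ge> 1" by (simp add: B_def)
  assume "\<not> y \<le> (1 + (\<Sum>i=1..d. C i)) * G"
  then have y: "B * G < y" by (simp add: B_def)
  have ypos: "y > 0"
  proof -
    have "0 \<le> B * G" using B \<open>G \<ge> 0\<close> by simp
    with y show ?thesis by linarith
  qed
  have Gy: "G \<le> y / B" using y B by (simp add: field_simps)
  have "C i * G ^ i * y ^ (d - i) \<le> C i * (y ^ d / B)" if i: "i \<in> {1..d}" for i
  proof -
    have "G ^ i \<le> (y / B) ^ i" using Gy \<open>G \<ge> 0\<close> by (rule power_mono)
    also have "\<dots> = y ^ i / B ^ i" by (simp add: power_divide)
    also have "\<dots> \<le> y ^ i / B"
      using B i ypos self_le_power[of B i] by (intro divide_left_mono) auto
    finally have "G ^ i * y ^ (d - i) \<le> y ^ i / B * y ^ (d - i)"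
      using ypos by (intro mult_right_mono) auto
    also have "\<dots> = y ^ d / B"
      using i by (simp flip: power_add)
    finally have "C i * (G ^ i * y ^ (d - i)) \<le> C i * (y ^ d / B)"
      by (rule mult_left_mono) (rule assms(4)[OF i])
    then show ?thesis by (simp only: mult.assoc)
  qed
  then have "(\<Sum>i=1..d. C i * G ^ i * y ^ (d - i)) \<le> (\<Sum>i=1..d. C i * (y ^ d / B))"
    by (rule sum_mono)
  with le have "y ^ d \<le> (\<Sum>i=1..d. C i * (y ^ d / B))"
    by linarith
  also have "\<dots> = (B - 1) * (y ^ d / B)"
    unfolding sum_distrib_right[symmetric] by (simp add: B_def)
  also have "\<dots> = y ^ d - y ^ d / B"
    using B by (simp add: left_diff_distrib diff_divide_distrib)
  finally show False
    using B zero_less_power[OF ypos, of d] divide_pos_pos[of "y ^ d" B] by linarith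
qed

text \<open>
  In an integral equation of \<open>h\<close> over \<open>I\<close>, the \<open>i\<close>-th coefficient is dominated by the \<open>i\<close>-th power of \<open>G\<close>.
\<close>

lemma dominated_integral_closure:
  assumes I: "\<And>g. g \<in> I \<Longrightarrow> dominated G g" and G: "\<And>x. G x \<ge> 0"
    and h: "h \<in> integral_closure I"
  shows "dominated G h"
proof -
  obtain d a where d: "d \<ge> 1" and a: "\<And>i. i \<in> {1..d} \<Longrightarrow> a i \<in> ideal_power I i"
    and eq: "h ^ d + (\<Sum>i=1..d. a i * h ^ (d - i)) = 0"
    using h unfolding integral_closure_def by blast
  have "\<forall>i\<in>{1..d}. \<exists>C. \<forall>\<^sub>F x in nhds 0. cmod (rep_germ (a i) x) \<le> C * G x ^ i"
    using dominated_ideal_power[OF I a] unfolding dominated_def by blast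
  from bchoice[OF this] obtain C
    where C: "\<forall>i\<in>{1..d}. \<forall>\<^sub>F x in nhds 0. cmod (rep_germ (a i) x) \<le> C i * G x ^ i" ..
  have "\<forall>\<^sub>F x in nhds 0. \<forall>i\<in>{1..d}. cmod (rep_germ (a i) x) \<le> C i * G x ^ i"
    using C by (simp add: eventually_ball_finite)
  moreover have "\<forall>\<^sub>F x in nhds 0. \<forall>i\<in>{1..d}. rep_germ (a i * h ^ (d - i)) x =
      rep_germ (a i) x * rep_germ h x ^ (d - i)"
  proof (intro eventually_ball_finite ballI)
    fix i
    show "\<forall>\<^sub>F x in nhds 0. rep_germ (a i * h ^ (d - i)) x = rep_germ (a i) x * rep_germ h x ^ (d - i)"
      using rep_germ_times[of "a i" "h ^ (d - i)"] rep_germ_power[of h "d - i"]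
      by eventually_elim simp
  qed simp
  moreover have "\<forall>\<^sub>F x in nhds 0. rep_germ h x ^ d + (\<Sum>i=1..d. rep_germ (a i * h ^ (d - i)) x) = 0"
    using rep_germ_plus[of "h ^ d" "\<Sum>i=1..d. a i * h ^ (d - i)"] rep_germ_power[of h d]
      rep_germ_sum[of "{1..d}" "\<lambda>i. a i * h ^ (d - i)", simplified] rep_germ_zero
    unfolding eq by eventually_elim simp
  ultimately have "\<forall>\<^sub>F x in nhds 0. cmod (rep_germ h x) \<le> (1 + (\<Sum>i=1..d. \<bar>C i\<bar>)) * G x"
  proof eventually_elim
    case (elim x)
    have "rep_germ h x ^ d = - (\<Sum>i=1..d. rep_germ (a i) x * rep_germ h x ^ (d - i))"
      using elim(2,3) by (simp add: eq_neg_iff_add_eq_0)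
    then have "cmod (rep_germ h x) ^ d = cmod (\<Sum>i=1..d. rep_germ (a i) x * rep_germ h x ^ (d - i))"
      by (simp only: norm_power[symmetric] norm_minus_cancel)
    also have "\<dots> \<le> (\<Sum>i=1..d. cmod (rep_germ (a i) x * rep_germ h x ^ (d - i)))"
      by (rule norm_sum)
    also have "\<dots> \<le> (\<Sum>i=1..d. \<bar>C i\<bar> * G x ^ i * cmod (rep_germ h x) ^ (d - i))"
    proof (rule sum_mono)
      fix i assume i: "i \<in> {1..d}"
      have "cmod (rep_germ (a i) x) \<le> C i * G x ^ i" using elim(1) i by blast
      also have "\<dots> \<le> \<bar>C i\<bar> * G x ^ i" using G[of x] by (intro mult_right_mono) auto
      finally show "cmod (rep_germ (a i) x * rep_germ h x ^ (d - i)) \<le>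
          \<bar>C i\<bar> * G x ^ i * cmod (rep_germ h x) ^ (d - i)"
        unfolding norm_mult norm_power by (rule mult_right_mono) simp
    qed
    finally show ?case
      using G[of x] by (intro root_bound[OF d]) auto
  qed
  then show ?thesis unfolding dominated_def by blast
qed

lemma subset_integral_closure:
  assumes "ideal.subspace I"
  shows "I \<subseteq> integral_closure I"
proof
  fix h assume h: "h \<in> I"
  then have "h * 1 \<in> ideal.span {x * y |x y. x \<in> I \<and> y \<in> (UNIV :: 'a set)}"
    by (intro ideal.span_base) blast
  then have "- h \<in> ideal_power I 1"
    using ideal.span_neg by fastforce
  then show "h \<in> integral_closure I"
    unfolding integral_closure_def by (intro CollectI exI[of _ 1] exI[of _ "\<lambda>_. - h"]) auto
qed

lemma ideal_power_subset:
  assumes "ideal.subspace I" "i \<ge> 1"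
  shows "ideal_power I i \<subseteq> I"
proof -
  obtain j where i: "i = Suc j" using assms(2) by (cases i) auto
  have "x * y \<in> I" if "x \<in> I" for x y
    using ideal.subspace_scale[OF assms(1) that, of y] by (simp add: mult.commute)
  then have "ideal.span {x * y |x y. x \<in> I \<and> y \<in> ideal_power I j} \<subseteq> I"
    by (intro ideal.span_minimal assms(1)) auto
  then show ?thesis
    by (simp add: i)
qed

text \<open>
  An integral equation of 1 expresses 1 as an element of \<open>I\<close>.
\<close>

lemma one_in_integral_closure:
  assumes "ideal.subspace I" "1 \<in> integral_closure I"
  shows "I = UNIV"
proof -
  obtain d a where d: "d \<ge> 1" and a: "\<And>i. i \<in> {1..d} \<Longrightarrow> a i \<in> ideal_power I i"
    and eq: "1 ^ d + (\<Sum>i=1..d. a i * 1 ^ (d - i)) = 0"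
    using assms(2) unfolding integral_closure_def by blast
  have "(\<Sum>i=1..d. a i) \<in> I"
    using a ideal_power_subset[OF assms(1)] by (intro ideal.subspace_sum assms(1)) auto
  then have "- (\<Sum>i=1..d. a i) \<in> I"
    by (rule ideal.subspace_neg[OF assms(1)])
  moreover have "- (\<Sum>i=1..d. a i) = 1"
    using eq by (simp add: eq_neg_iff_add_eq_0 flip: eq_neg_iff_add_eq_0)
  ultimately have "1 \<in> I" by simp
  then have "x \<in> I" for x
    using ideal.subspace_scale[OF assms(1), of 1 x] by simp
  then show ?thesis by blast
qed

lemma finite_generating_subset:
  assumes "finite X" "X \<subseteq> ideal.span Y"
  shows "\<exists>Z\<subseteq>Y. finite Z \<and> X \<subseteq> ideal.span Z"
  using assms
proof (induction X)
  case (insert x X)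
  then obtain Z where Z: "Z \<subseteq> Y" "finite Z" "X \<subseteq> ideal.span Z" by auto
  have "x \<in> ideal.span Y" using insert.prems by simp
  then obtain t r where t: "finite t" "t \<subseteq> Y" "x = (\<Sum>a\<in>t. r a * a)"
    by (auto simp: ideal.span_explicit)
  have "x \<in> ideal.span t"
    unfolding t(3) by (intro ideal.span_sum ideal.span_scale ideal.span_base)
  with Z t have "insert x X \<subseteq> ideal.span (Z \<union> t)"
    using ideal.span_mono[of Z "Z \<union> t"] ideal.span_mono[of t "Z \<union> t"] by auto
  with Z t show ?case by (intro exI[of _ "Z \<union> t"]) auto
qed auto

text \<open>
  For nonnegative weights, multiplication by a germ cannot lower the weight of the support.
\<close>

lemma subspace_supported:
  fixes a :: "real^'n::finite"
  assumes a: "\<And>i. a $ i \<ge> 0"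
  shows "ideal.subspace {h. \<forall>k. germ_coeff h k \<noteq> 0 \<longrightarrow> l \<le> a \<bullet> (\<chi> i. real (k $ i))}" (is "ideal.subspace ?V")
proof (rule ideal.subspaceI)
  fix g h assume "g \<in> ?V" "h \<in> ?V"
  then show "g + h \<in> ?V" by (auto simp: germ_coeff_plus) (metis add.left_neutral add.right_neutral)
next
  fix c h assume h: "h \<in> ?V"
  show "c * h \<in> ?V"
  proof (intro CollectI allI impI)
    fix k assume "germ_coeff (c * h) k \<noteq> 0"
    then obtain p q where pq: "p + q = k" "germ_coeff h q \<noteq> 0"
      unfolding germ_coeff_times by (rule sum.not_neutral_contains_not_neutral) auto
    have "l \<le> a \<bullet> (\<chi> i. real (q $ i))" using h pq by auto
    also have "\<dots> \<le> a \<bullet> (\<chi> i. real (k $ i))"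
      unfolding inner_vec_def pq(1)[symmetric] using a by (auto intro!: sum_mono mult_left_mono)
    finally show "l \<le> a \<bullet> (\<chi> i. real (k $ i))" .
  qed
qed auto

section \<open>Restriction of germs and ideals to subspaces\<close>

text \<open>
  The monomial with exponent \<open>m\<close> in the linear forms given by a matrix is a product of forms with one factor for each
  pair \<open>(i, t)\<close>, \<open>t < m $ i\<close>. Choosing one column of the matrix for each such pair yields the terms
  of its expansion; \<open>choice_exponent\<close> is the exponent of the resulting monomial.
\<close>

definition factor_slots :: "nat^'n \<Rightarrow> ('n \<times> nat) set" where
  "factor_slots m = Sigma UNIV (\<lambda>i. {..<m $ i})"

definition column_choices :: "nat^'n \<Rightarrow> ('n \<times> nat \<Rightarrow> 'k) set" where
  "column_choices m = PiE (factor_slots m) (\<lambda>_. UNIV)"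

definition choice_exponent :: "nat^'n \<Rightarrow> ('n \<times> nat \<Rightarrow> 'k) \<Rightarrow> nat^'k" where
  "choice_exponent m \<phi> = (\<chi> j. card {d \<in> factor_slots m. \<phi> d = j})"

lemma finite_factor_slots [simp]: "finite (factor_slots (m :: nat^'n::finite))"
  by (simp add: factor_slots_def)

lemma finite_column_choices: "finite (column_choices m :: ('n::finite \<times> nat \<Rightarrow> 'k::finite) set)"
  unfolding column_choices_def by (intro finite_PiE) auto

lemma prod_power_factor_slots:
  "(\<Prod>i\<in>UNIV. f i ^ (m $ i)) = (\<Prod>(i, t)\<in>factor_slots m. f i :: 'a::comm_monoid_mult)"
  unfolding factor_slots_def by (subst prod.Sigma[symmetric]) auto

lemma prod_power_sum_expand:
  fixes F :: "'n::finite \<Rightarrow> 'k::finite \<Rightarrow> 'a::comm_semiring_1"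
  shows "(\<Prod>i\<in>UNIV. (\<Sum>j\<in>UNIV. F i j) ^ (m $ i)) =
     (\<Sum>\<phi>\<in>column_choices m. \<Prod>d\<in>factor_slots m. F (fst d) (\<phi> d))"
  unfolding prod_power_factor_slots column_choices_def
  by (subst prod_sum_PiE[symmetric]) (auto simp: case_prod_unfold)

lemma prod_choice_exponent:
  fixes z :: "complex^'k::finite"
  shows "(\<Prod>d\<in>factor_slots m. z $ (\<phi> d)) = monom_fun (choice_exponent m \<phi>) z"
proof -
  have "(\<Prod>d\<in>factor_slots m. z $ (\<phi> d)) =
      (\<Prod>j\<in>UNIV. \<Prod>d\<in>{d \<in> factor_slots m. \<phi> d = j}. z $ (\<phi> d))"
    by (rule prod.group[symmetric]) auto
  also have "\<dots> = (\<Prod>j\<in>UNIV. \<Prod>d\<in>{d \<in> factor_slots m. \<phi> d = j}. z $ j)"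
    by (intro prod.cong) auto
  finally show ?thesis by (simp add: monom_fun_def choice_exponent_def)
qed

lemma filterlim_matrix_vector_mult: "filterlim ((*v) (M :: complex^'k::finite^'n::finite)) (nhds 0) (nhds 0)"
proof -
  have "((\<lambda>z. M *v z) \<longlongrightarrow> (M *v 0)) (nhds 0)"
    unfolding matrix_vector_mult_def
    by (intro tendsto_intros filterlim_ident)
  then show ?thesis by simp
qed

text \<open>
  Expanding every monomial gives a double series. Its absolute values add up to those of the original series
  at the point with coordinates \<open>\<Sum>j. \<bar>M $ i $ j\<bar> * \<bar>z $ j\<bar>\<close>, which is small if \<open>z\<close> is. So the double series
  converges absolutely and may be regrouped by the exponent of \<open>z\<close>.
\<close>

lemma analytic_at_zero_linear:
  fixes M :: "complex^'k::finite^'n::finite"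
  assumes "analytic_at_zero f"
  shows "analytic_at_zero (\<lambda>z. f (M *v z))"
proof -
  obtain c where c: "\<forall>\<^sub>F x in nhds 0. ((\<lambda>m. c m * monom_fun m x) has_sum f x) UNIV"
    using assms by (auto simp: analytic_at_zero_def has_power_series_def)
  define X where "X = Sigma UNIV (\<lambda>m. column_choices m :: ('n \<times> nat \<Rightarrow> 'k) set)"
  define coef where "coef = (\<lambda>(m, \<phi>). c m * (\<Prod>d\<in>factor_slots m. M $ fst d $ \<phi> d))"
  define ex where "ex = (\<lambda>(m :: nat^'n, \<phi>). choice_exponent m \<phi> :: nat^'k)"
  define N where "N z = (\<chi> i. complex_of_real (\<Sum>j\<in>UNIV. cmod (M $ i $ j) * cmod (z $ j)))" for z :: "complex^'k"
  have expand_term: "coef (m, \<phi>) * monom_fun (ex (m, \<phi>)) z =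
      c m * (\<Prod>d\<in>factor_slots m. M $ fst d $ \<phi> d * z $ \<phi> d)" for m \<phi> z
    by (simp only: coef_def ex_def split_conv prod.distrib prod_choice_exponent mult.assoc)
  have expand: "(\<Sum>\<phi>\<in>column_choices m. coef (m, \<phi>) * monom_fun (ex (m, \<phi>)) z) = c m * monom_fun m (M *v z)" for m z
  proof -
    have "monom_fun m (M *v z) = (\<Sum>\<phi>\<in>column_choices m. \<Prod>d\<in>factor_slots m. M $ fst d $ \<phi> d * z $ \<phi> d)"
      unfolding monom_fun_def matrix_vector_mult_def vec_lambda_beta by (rule prod_power_sum_expand)
    then show ?thesis
      by (simp only: expand_term sum_distrib_left)
  qed
  have expandN: "(\<Sum>\<phi>\<in>column_choices m. cmod (coef (m, \<phi>) * monom_fun (ex (m, \<phi>)) z)) =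
      cmod (c m * monom_fun m (N z))" for m z
  proof -
    have "cmod (monom_fun m (N z)) = (\<Prod>i\<in>UNIV. (\<Sum>j\<in>UNIV. cmod (M $ i $ j) * cmod (z $ j)) ^ (m $ i))"
      unfolding norm_monom_fun N_def by (simp add: sum_nonneg del: of_real_sum)
    also have "\<dots> = (\<Sum>\<phi>\<in>column_choices m. \<Prod>d\<in>factor_slots m. cmod (M $ fst d $ \<phi> d) * cmod (z $ \<phi> d))"
      by (rule prod_power_sum_expand)
    finally show ?thesis
      by (simp only: expand_term norm_mult prod_norm[symmetric] sum_distrib_left)
  qed
  have "(N \<longlongrightarrow> N 0) (nhds 0)"
    unfolding N_def by (intro tendsto_intros filterlim_ident)
  then have N: "filterlim N (nhds 0) (nhds 0)"
    by (simp add: N_def zero_vec_def)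
  have M: "filterlim ((*v) M) (nhds 0) (nhds 0)"
    by (rule filterlim_matrix_vector_mult)
  have "\<forall>\<^sub>F z in nhds 0. ((\<lambda>m. c m * monom_fun m (N z)) has_sum f (N z)) UNIV"
    by (rule eventually_compose_filterlim[OF c N])
  moreover have "\<forall>\<^sub>F z in nhds 0. ((\<lambda>m. c m * monom_fun m (M *v z)) has_sum f (M *v z)) UNIV"
    by (rule eventually_compose_filterlim[OF c M])
  ultimately have ev: "\<forall>\<^sub>F z in nhds 0. (\<lambda>x. cmod (coef x * monom_fun (ex x) z)) summable_on X \<and>
      ((\<lambda>x. coef x * monom_fun (ex x) z) has_sum f (M *v z)) X"
  proof eventually_elim
    case (elim z)
    have "(\<lambda>m. cmod (c m * monom_fun m (N z))) summable_on UNIV"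
      using elim(1) by (subst summable_on_iff_abs_summable_on_complex[symmetric]) (auto simp: summable_on_def)
    then have s: "(\<lambda>x. cmod (coef x * monom_fun (ex x) z)) summable_on X"
      unfolding X_def
      by (intro summable_on_SigmaI[where g = "\<lambda>m. cmod (c m * monom_fun m (N z))"])
         (auto intro!: has_sum_finiteI finite_column_choices simp: expandN)
    then have "(\<lambda>x. coef x * monom_fun (ex x) z) summable_on X"
      by (rule abs_summable_summable)
    then have "((\<lambda>x. coef x * monom_fun (ex x) z) has_sum f (M *v z)) X"
      unfolding X_def using elim(2)
      by (intro has_sum_SigmaI[where g = "\<lambda>m. c m * monom_fun m (M *v z)"])
         (auto intro!: has_sum_finiteI finite_column_choices simp: expand)
    with s show ?case ..
  qed
  have "\<forall>\<^sub>F s in sequentially. (\<lambda>x. cmod (coef x * monom_fun (ex x) (test_point s))) summable_on X"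
    using eventually_compose_filterlim[OF ev test_point_tendsto_0] by eventually_elim simp
  then obtain s where s: "(\<lambda>x. cmod (coef x * monom_fun (ex x) (test_point s))) summable_on X"
    by (auto simp: eventually_sequentially)
  define fib where "fib p = {x \<in> X. ex x = p}" for p
  \<comment> \<open>All terms of a fibre carry the same monomial, which does not vanish at a test point.\<close>
  have coef_summable: "coef summable_on fib p" for p
  proof -
    have "(\<lambda>x. cmod (coef x * monom_fun (ex x) (test_point s))) summable_on fib p"
      by (rule summable_on_subset_banach[OF s]) (auto simp: fib_def)
    then have "(\<lambda>x. real (prime_code p) ^ s * cmod (coef x * monom_fun (ex x) (test_point s))) summable_on fib p"
      by (rule summable_on_cmult_right)
    then have "(\<lambda>x. cmod (coef x)) summable_on fib p"
      by (rule summable_on_cong[THEN iffD1, rotated])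
         (auto simp: fib_def monom_fun_test_point norm_mult norm_divide norm_power)
    then show ?thesis by (rule abs_summable_summable)
  qed
  define d where "d p = infsum coef (fib p)" for p
  have "has_power_series (\<lambda>z. f (M *v z)) d"
    unfolding has_power_series_def using ev
  proof eventually_elim
    case (elim z)
    have bij: "bij_betw snd (Sigma UNIV fib) X"
      by (auto simp: bij_betw_def inj_on_def fib_def image_def)
    have "((\<lambda>(p, x). coef x * monom_fun p z) has_sum f (M *v z)) (Sigma UNIV fib)"
    proof (rule has_sum_cong[THEN iffD1])
      show "((\<lambda>y. coef (snd y) * monom_fun (ex (snd y)) z) has_sum f (M *v z)) (Sigma UNIV fib)"
        using elim by (subst has_sum_reindex_bij_betw[OF bij]) auto
    qed (auto simp: fib_def)
    then show "((\<lambda>p. d p * monom_fun p z) has_sum f (M *v z)) UNIV"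
      by (rule has_sum_SigmaD) (auto simp: d_def intro!: has_sum_cmult_left has_sum_infsum coef_summable)
  qed
  then show ?thesis by (auto simp: analytic_at_zero_def)
qed

lemma rep_restrict_germ:
  fixes L :: "(complex^'n::finite) set"
  shows "\<forall>\<^sub>F z in nhds 0. rep_germ (restrict_germ L h :: 'k::finite germ) z =
           rep_germ h ((coordinates L :: complex^'k^'n) *v z)"
  unfolding restrict_germ_def
  by (intro rep_abs_germ analytic_at_zero_linear) (use same_germ_rep[of h] in \<open>simp add: same_germ_def\<close>)

text \<open>
  Together with the next lemma: generators of the restricted ideal have, up to constants, the same size
  as the pull-backs of generators of \<open>I\<close>.
\<close>

lemma restrict_ideal_upper:
  fixes L :: "(complex^'n::finite) set" and hs :: "'k::finite germ list"
  assumes "I = ideal.span (set gs)" "restrict_ideal L I = ideal.span (set hs)"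
  shows "\<exists>C\<ge>0. \<forall>\<^sub>F z in nhds 0. (gens_norm hs z)\<^sup>2 \<le>
           C * (gens_norm gs ((coordinates L :: complex^'k^'n) *v z))\<^sup>2"
proof -
  let ?M = "coordinates L :: complex^'k^'n"
  have "dominated (\<lambda>z. gens_norm gs (?M *v z)) (restrict_germ L f :: 'k germ)" if "f \<in> I" for f
  proof -
    have "dominated (gens_norm gs) f"
      by (rule dominated_span[OF dominated_gen]) (use that assms(1) in auto)
    then obtain C where "\<forall>\<^sub>F x in nhds 0. cmod (rep_germ f x) \<le> C * gens_norm gs x"
      by (auto simp: dominated_def)
    then have "\<forall>\<^sub>F z in nhds 0. cmod (rep_germ f (?M *v z)) \<le> C * gens_norm gs (?M *v z)"
      by (rule eventually_compose_filterlim[OF _ filterlim_matrix_vector_mult])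
    then have "\<forall>\<^sub>F z in nhds 0. cmod (rep_germ (restrict_germ L f :: 'k germ) z) \<le> C * gens_norm gs (?M *v z)"
      using rep_restrict_germ[of L f] by eventually_elim simp
    then show ?thesis unfolding dominated_def by blast
  qed
  then have "dominated (\<lambda>z. gens_norm gs (?M *v z)) h" if "h \<in> restrict_ideal L I" for h :: "'k germ"
    using that unfolding restrict_ideal_def by (elim dominated_span[rotated]) auto
  then have "\<forall>h\<in>set hs. \<exists>C. \<forall>\<^sub>F z in nhds 0. cmod (rep_germ h z) \<le> C * gens_norm gs (?M *v z)"
    using ideal.span_base assms(2) unfolding dominated_def by blast
  from bchoice[OF this] obtain C
    where C: "\<forall>h\<in>set hs. \<forall>\<^sub>F z in nhds 0. cmod (rep_germ h z) \<le> C h * gens_norm gs (?M *v z)" ..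
  then show ?thesis by (intro gens_norm_squared_bound) blast
qed

lemma restrict_ideal_lower:
  fixes L :: "(complex^'n::finite) set" and hs :: "'k::finite germ list"
  assumes "I = ideal.span (set gs)" "restrict_ideal L I = ideal.span (set hs)"
    and "dominated (gens_norm gs) h"
  shows "\<exists>C\<ge>0. \<forall>\<^sub>F z in nhds 0. (cmod (rep_germ h ((coordinates L :: complex^'k^'n) *v z)))\<^sup>2 \<le>
           C * (gens_norm hs z)\<^sup>2"
proof -
  let ?M = "coordinates L :: complex^'k^'n"
  have "\<forall>g\<in>set gs. \<exists>C. \<forall>\<^sub>F z in nhds 0. cmod (rep_germ g (?M *v z)) \<le> C * gens_norm hs z"
  proof
    fix g assume "g \<in> set gs"
    then have "g \<in> I"
      unfolding assms(1) by (rule ideal.span_base)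
    then have "(restrict_germ L g :: 'k germ) \<in> restrict_ideal L I"
      unfolding restrict_ideal_def by (intro ideal.span_base imageI)
    then have "(restrict_germ L g :: 'k germ) \<in> ideal.span (set hs)"
      unfolding assms(2) .
    then have "dominated (gens_norm hs) (restrict_germ L g :: 'k germ)"
      by (elim dominated_span[rotated]) (rule dominated_gen)
    then obtain C where "\<forall>\<^sub>F z in nhds 0. cmod (rep_germ (restrict_germ L g :: 'k germ) z) \<le> C * gens_norm hs z"
      by (auto simp: dominated_def)
    then have "\<forall>\<^sub>F z in nhds 0. cmod (rep_germ g (?M *v z)) \<le> C * gens_norm hs z"
      using rep_restrict_germ[of L g] by eventually_elim simp
    then show "\<exists>C. \<forall>\<^sub>F z in nhds 0. cmod (rep_germ g (?M *v z)) \<le> C * gens_norm hs z" ..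
  qed
  from bchoice[OF this] obtain C
    where C: "\<forall>g\<in>set gs. \<forall>\<^sub>F z in nhds 0. cmod (rep_germ g (?M *v z)) \<le> C g * gens_norm hs z" ..
  then obtain D where D: "D \<ge> 0"
     "\<forall>\<^sub>F z in nhds 0. (gens_norm gs (?M *v z))\<^sup>2 \<le> D * (gens_norm hs z)\<^sup>2"
    using gens_norm_squared_bound[where u = "(*v) ?M"] by blast
  obtain B where "\<forall>\<^sub>F x in nhds 0. cmod (rep_germ h x) \<le> B * gens_norm gs x"
    using assms(3) by (auto simp: dominated_def)
  then have "\<forall>\<^sub>F z in nhds 0. cmod (rep_germ h (?M *v z)) \<le> B * gens_norm gs (?M *v z)"
    by (rule eventually_compose_filterlim[OF _ filterlim_matrix_vector_mult])
  with D(2) have "\<forall>\<^sub>F z in nhds 0. (cmod (rep_germ h (?M *v z)))\<^sup>2 \<le> (B\<^sup>2 * D) * (gens_norm hs z)\<^sup>2"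
  proof eventually_elim
    case (elim z)
    have "(cmod (rep_germ h (?M *v z)))\<^sup>2 \<le> (B * gens_norm gs (?M *v z))\<^sup>2"
      using elim(2) by (intro power_mono) auto
    also have "\<dots> \<le> B\<^sup>2 * (D * (gens_norm hs z)\<^sup>2)"
      using elim(1) unfolding power_mult_distrib by (intro mult_left_mono) auto
    finally show ?case by (simp only: mult.assoc)
  qed
  then show ?thesis using D(1) by (intro exI[of _ "B\<^sup>2 * D"]) auto
qed

section \<open>The upper bound for every subspace\<close>

lemma matrix_vector_mult_bounded:
  fixes M :: "complex^'k::finite^'n::finite"
  shows "linear ((*v) M)" "\<exists>C>0. \<forall>z. norm (M *v z) \<le> C * norm z"
proof -
  show lin: "linear ((*v) M)"
  proof (rule linearI)
    show "M *v (c *\<^sub>R z) = c *\<^sub>R (M *v z)" for c z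
      by (simp add: matrix_vector_mult_def vec_eq_iff scaleR_sum_right)
  qed (rule matrix_vector_right_distrib)
  show "\<exists>C>0. \<forall>z. norm (M *v z) \<le> C * norm z"
    using linear_bounded_pos[OF lin] by (metis mult.commute)
qed

lemma borel_measurable_linear:
  fixes h :: "'a::euclidean_space \<Rightarrow> 'b::real_normed_vector"
  shows "linear h \<Longrightarrow> h \<in> borel_measurable borel"
  by (intro borel_measurable_continuous_onI linear_continuous_on linear_conv_bounded_linear[THEN iffD1])

definition anisotropic_box :: "complex^'k^'n::finite \<Rightarrow> real \<Rightarrow> ('n \<Rightarrow> real) \<Rightarrow> (complex^'k::finite) set" where
  "anisotropic_box M \<rho> \<delta> = {z. norm z < \<rho> \<and> (\<forall>i. cmod ((M *v z) $ i) \<le> \<delta> i)}"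

lemma anisotropic_box_sets [measurable]: "anisotropic_box M \<rho> \<delta> \<in> sets borel"
proof -
  have "continuous_on UNIV (\<lambda>z. (M *v z) $ i)" for i
    using matrix_vector_mult_bounded(1)[of M]
    by (intro continuous_on_component linear_continuous_on linear_conv_bounded_linear[THEN iffD1])
  then have [measurable]: "(\<lambda>z. (M *v z) $ i) \<in> borel_measurable borel" for i
    by (rule borel_measurable_continuous_onI)
  show ?thesis unfolding anisotropic_box_def by measurable
qed

lemma card_int_interval_le:
  assumes "B \<ge> 0"
  shows "real (card {\<lfloor>- B\<rfloor>..\<lfloor>B\<rfloor>}) \<le> 2 * B + 2"
proof -
  have "real (card {\<lfloor>- B\<rfloor>..\<lfloor>B\<rfloor>}) = real_of_int (\<lfloor>B\<rfloor> + 1 - \<lfloor>- B\<rfloor>)"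
    using assms by (simp add: floor_mono le_add1 add_increasing2)
  also have "\<dots> \<le> 2 * B + 2"
    using of_int_floor_le[of B] floor_correct[of "- B"] by simp linarith
  finally show ?thesis .
qed

text \<open>
  Pigeonhole: cut the ball of half the radius into cells on which the real and imaginary parts of the
  \<open>i\<close>-th form vary by at most \<open>\<delta> i / 2\<close>. The differences of points of one cell lie in the box, so a translate of
  the box covers the cell, and the number of cells bounds the ratio of the volumes. This treats arbitrary linear
  forms, whatever the relations between them.
\<close>

lemma measure_ball_le_anisotropic_box:
  fixes M :: "complex^'k::finite^'n::finite"
  assumes C: "\<And>z. norm (M *v z) \<le> C * norm z" and pos: "\<rho> > 0" "C > 0" "\<And>i. \<delta> i > 0"
  shows "measure lborel (ball (0 :: complex^'k) (\<rho> / 2)) \<le>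
    (\<Prod>i\<in>UNIV. (2 * (C * \<rho> / \<delta> i) + 2)\<^sup>2) * measure lborel (anisotropic_box M \<rho> \<delta>)"
proof -
  let ?R = "anisotropic_box M \<rho> \<delta>" and ?Q = "ball (0 :: complex^'k) (\<rho> / 2)"
  define B where "B i = C * \<rho> / \<delta> i" for i
  have B: "B i \<ge> 0" for i using pos by (simp add: B_def less_imp_le)
  define cell where "cell z i = (\<lfloor>Re ((M *v z) $ i) / (\<delta> i / 2)\<rfloor>, \<lfloor>Im ((M *v z) $ i) / (\<delta> i / 2)\<rfloor>)"
    for z i
  define J where "J = (\<Pi>\<^sub>E i\<in>(UNIV :: 'n set). {\<lfloor>- B i\<rfloor>..\<lfloor>B i\<rfloor>} \<times> {\<lfloor>- B i\<rfloor>..\<lfloor>B i\<rfloor>})"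
  have finJ: "finite J" unfolding J_def by (intro finite_PiE) auto
  have cellJ: "cell z \<in> J" if z: "z \<in> ?Q" for z
  proof -
    have in_range: "floor (x / (\<delta> i / 2)) \<in> {\<lfloor>- B i\<rfloor>..\<lfloor>B i\<rfloor>}" if "\<bar>x\<bar> \<le> cmod ((M *v z) $ i)" for x i
    proof -
      have "\<bar>x\<bar> \<le> norm (M *v z)"
        using that order_trans[OF that Finite_Cartesian_Product.norm_nth_le[of "M *v z" i]] by blast
      also have "\<dots> \<le> C * norm z" by (rule C)
      also have "\<dots> \<le> C * (\<rho> / 2)"
        using z pos by (intro mult_left_mono) auto
      finally have "\<bar>x\<bar> \<le> C * (\<rho> / 2)" .
      then have "\<bar>x\<bar> / (\<delta> i / 2) \<le> C * (\<rho> / 2) / (\<delta> i / 2)"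
        using pos(3)[of i] by (intro divide_right_mono) auto
      also have "\<dots> = B i" by (simp add: B_def)
      finally have "\<bar>x / (\<delta> i / 2)\<bar> \<le> B i"
        using pos(3)[of i] by (simp add: abs_divide)
      then have "- B i \<le> x / (\<delta> i / 2)" "x / (\<delta> i / 2) \<le> B i"
        by linarith+
      then show ?thesis
        unfolding atLeastAtMost_iff by (intro conjI floor_mono)
    qed
    show ?thesis
      unfolding J_def cell_def by (intro PiE_I SigmaI in_range abs_Re_le_cmod abs_Im_le_cmod) simp
  qed
  define p where "p j = (SOME z. z \<in> ?Q \<and> cell z = j)" for j
  have cover: "?Q \<subseteq> (\<Union>j\<in>J. (+) (- p j) -` ?R)"
  proof
    fix z assume z: "z \<in> ?Q"
    define w where "w = p (cell z)"
    have "w \<in> ?Q \<and> cell w = cell z"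
      unfolding w_def p_def by (rule someI[of _ z]) (use z in simp)
    then have w: "w \<in> ?Q" "cell w = cell z"
      by blast+
    have close: "\<bar>x - y\<bar> \<le> \<delta> i / 2" if "\<lfloor>x / (\<delta> i / 2)\<rfloor> = \<lfloor>y / (\<delta> i / 2)\<rfloor>" for x y i
    proof -
      have "\<bar>x / (\<delta> i / 2) - y / (\<delta> i / 2)\<bar> \<le> 1"
        using that floor_correct[of "x / (\<delta> i / 2)"] floor_correct[of "y / (\<delta> i / 2)"] by linarith
      moreover have "\<bar>x - y\<bar> = \<bar>x / e - y / e\<bar> * e" if "e > 0" for e
      proof -
        have "x - y = (x / e - y / e) * e"
          using that by (simp add: left_diff_distrib)
        then show ?thesis using that by (simp only: abs_mult abs_of_pos)
      qed
      from this[of "\<delta> i / 2"] have "\<bar>x - y\<bar> = \<bar>x / (\<delta> i / 2) - y / (\<delta> i / 2)\<bar> * (\<delta> i / 2)"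
        using pos(3)[of i] by simp
      ultimately show ?thesis
        using mult_right_mono[of "\<bar>x / (\<delta> i / 2) - y / (\<delta> i / 2)\<bar>" 1 "\<delta> i / 2"] pos(3)[of i] by linarith
    qed
    have "cmod ((M *v (- w + z)) $ i) \<le> \<delta> i" for i
    proof -
      have eq: "(M *v (- w + z)) $ i = (M *v z) $ i - (M *v w) $ i"
        using linear_diff[OF matrix_vector_mult_bounded(1)[of M], of z w] by simp
      have "cell w i = cell z i" using w by simp
      then have cells: "\<lfloor>Re ((M *v z) $ i) / (\<delta> i / 2)\<rfloor> = \<lfloor>Re ((M *v w) $ i) / (\<delta> i / 2)\<rfloor>"
          "\<lfloor>Im ((M *v z) $ i) / (\<delta> i / 2)\<rfloor> = \<lfloor>Im ((M *v w) $ i) / (\<delta> i / 2)\<rfloor>"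
        unfolding cell_def prod.inject by (blast dest: sym)+
      show ?thesis
        using close[OF cells(1)] close[OF cells(2)]
        unfolding eq using cmod_le[of "(M *v z) $ i - (M *v w) $ i"] by simp
    qed
    moreover have "norm (- w + z) < \<rho>"
      using z w norm_triangle_ineq4[of z w] by auto
    ultimately have "- w + z \<in> ?R" by (simp add: anisotropic_box_def)
    then show "z \<in> (\<Union>j\<in>J. (+) (- p j) -` ?R)"
      using cellJ[OF z] by (auto simp: w_def)
  qed
  have trans: "emeasure lborel ((+) c -` ?R) = emeasure lborel ?R" for c
  proof -
    have "emeasure lborel ?R = emeasure (distr lborel borel ((+) c)) ?R"
      by (simp add: lborel_distr_plus)
    also have "\<dots> = emeasure lborel ((+) c -` ?R)"
      by (subst emeasure_distr) auto
    finally show ?thesis by simp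
  qed
  have meas: "(+) c -` ?R \<in> sets lborel" for c
    using measurable_sets_borel[of "(+) c" borel ?R] by simp
  have finR: "emeasure lborel ?R < \<infinity>"
    by (rule emeasure_bounded_finite, rule bounded_subset[OF bounded_ball[of 0 \<rho>]])
       (auto simp: anisotropic_box_def)
  have "emeasure lborel ?Q \<le> emeasure lborel (\<Union>j\<in>J. (+) (- p j) -` ?R)"
    using finJ meas by (intro emeasure_mono cover sets.finite_UN) auto
  also have "\<dots> \<le> (\<Sum>j\<in>J. emeasure lborel ((+) (- p j) -` ?R))"
    using finJ meas by (intro emeasure_subadditive_finite) auto
  also have "\<dots> = of_nat (card J) * emeasure lborel ?R"
    by (simp add: trans)
  finally have "emeasure lborel ?Q \<le> of_nat (card J) * emeasure lborel ?R" .
  then have "ennreal (measure lborel ?Q) \<le> ennreal (real (card J) * measure lborel ?R)"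
    using finR emeasure_lborel_ball_finite[of "0 :: complex^'k" "\<rho> / 2"]
    by (simp add: emeasure_eq_ennreal_measure ennreal_mult ennreal_of_nat_eq_real_of_nat)
  then have "measure lborel ?Q \<le> real (card J) * measure lborel ?R"
    by (simp add: ennreal_le_iff)
  also have "\<dots> \<le> (\<Prod>i\<in>UNIV. (2 * B i + 2)\<^sup>2) * measure lborel ?R"
  proof (rule mult_right_mono)
    have "real (card J) = (\<Prod>i\<in>UNIV. (real (card {\<lfloor>- B i\<rfloor>..\<lfloor>B i\<rfloor>}))\<^sup>2)"
      unfolding J_def by (simp only: card_PiE finite card_cartesian_product of_nat_prod of_nat_mult power2_eq_square)
    also have "\<dots> \<le> (\<Prod>i\<in>UNIV. (2 * B i + 2)\<^sup>2)"
      using card_int_interval_le[OF B] by (intro prod_mono conjI power_mono) auto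
    finally show "real (card J) \<le> \<dots>" .
  qed simp
  finally show ?thesis by (simp add: B_def)
qed

lemma vec_min_le: "vec_min a \<le> a $ i"
  by (simp add: vec_min_def)

lemma vec_min_pos: "(\<And>i. a $ i > 0) \<Longrightarrow> vec_min (a :: real^'n::finite) > 0"
  unfolding vec_min_def by (subst Min_gr_iff) auto

lemma powr_power_real: "0 < t \<Longrightarrow> (t powr x) ^ m = t powr (real m * x)" for t :: real
  by (simp add: powr_powr mult.commute flip: powr_realpow)

text \<open>
  The number of cells in the \<open>i\<close>-th direction is at most a constant times the square of
  \<open>t powr (vec_min a - a $ i)\<close>, and the ball has volume proportional to the power \<open>2 * CARD('k)\<close> of its radius.
\<close>

lemma measure_anisotropic_box_lower:
  fixes M :: "complex^'k::finite^'n::finite" and a :: "real^'n"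
  assumes pos: "\<eta> > 0" "r > 0"
  shows "\<exists>c>0. \<forall>t\<in>{0<..1}. c * t powr (2 * ((\<Sum>i\<in>UNIV. a $ i) - (real CARD('n) - real CARD('k)) * vec_min a))
     \<le> measure lborel (anisotropic_box M (\<eta> * t powr vec_min a) (\<lambda>i. r * t powr (a $ i)))"
proof -
  obtain C where C: "C > 0" "\<And>z. norm (M *v z) \<le> C * norm z"
    using matrix_vector_mult_bounded(2)[of M] by blast
  define \<alpha> where "\<alpha> = vec_min a"
  define D where "D = 2 * (C * \<eta> / r) + 2"
  have D: "D > 0" using C pos by (simp add: D_def add_pos_pos)
  define u where "u = unit_ball_vol (real (2 * CARD('k))) * (\<eta> / 2) ^ (2 * CARD('k))"
  have u: "u > 0" using pos by (simp add: u_def)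
  define N where "N = (\<Sum>i\<in>UNIV. a $ i) - (real CARD('n) - real CARD('k)) * \<alpha>"
  have "u / D ^ (2 * CARD('n)) * t powr (2 * N) \<le>
      measure lborel (anisotropic_box M (\<eta> * t powr \<alpha>) (\<lambda>i. r * t powr (a $ i)))" (is "_ \<le> ?m")
    if t: "t \<in> {0<..1}" for t
  proof -
    have tp: "t powr x > 0" for x using t by simp
    have vol: "measure lborel (ball (0 :: complex^'k) (\<eta> * t powr \<alpha> / 2)) = u * t powr (2 * real CARD('k) * \<alpha>)"
    proof -
      have "measure lborel (ball (0 :: complex^'k) (\<eta> * t powr \<alpha> / 2)) =
          unit_ball_vol (real (2 * CARD('k))) * ((\<eta> / 2) * t powr \<alpha>) ^ (2 * CARD('k))"
        using pos t by (subst content_ball) (auto simp: mult.commute)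
      also have "(t powr \<alpha>) ^ (2 * CARD('k)) = t powr (2 * real CARD('k) * \<alpha>)"
        using t by (subst powr_power_real) auto
      then have "unit_ball_vol (real (2 * CARD('k))) * ((\<eta> / 2) * t powr \<alpha>) ^ (2 * CARD('k)) =
           u * t powr (2 * real CARD('k) * \<alpha>)"
        unfolding power_mult_distrib u_def by simp
      finally show ?thesis .
    qed
    have cover: "measure lborel (ball (0 :: complex^'k) (\<eta> * t powr \<alpha> / 2)) \<le>
       (\<Prod>i\<in>UNIV. (2 * (C * (\<eta> * t powr \<alpha>) / (r * t powr (a $ i))) + 2)\<^sup>2) * ?m"
      using C pos tp by (intro measure_ball_le_anisotropic_box) auto
    have factors: "(\<Prod>i\<in>UNIV. (2 * (C * (\<eta> * t powr \<alpha>) / (r * t powr (a $ i))) + 2)\<^sup>2) \<le>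
        (\<Prod>i\<in>UNIV. (D * t powr (\<alpha> - a $ i))\<^sup>2)"
    proof (intro prod_mono conjI power_mono)
      fix i
      have ge1: "1 \<le> t powr (\<alpha> - a $ i)"
        using powr_mono'[of "\<alpha> - a $ i" 0 t] t vec_min_le[of a i] by (simp add: \<alpha>_def)
      have eq: "C * (\<eta> * t powr \<alpha>) / (r * t powr (a $ i)) = (C * \<eta> / r) * t powr (\<alpha> - a $ i)"
        using t by (simp add: powr_diff)
      have "2 * (x * y) + 2 \<le> (2 * x + 2) * y" if "y \<ge> 1" for x y :: real
        using that by (simp add: distrib_right)
      from this[OF ge1]
      show "2 * (C * (\<eta> * t powr \<alpha>) / (r * t powr (a $ i))) + 2 \<le> D * t powr (\<alpha> - a $ i)"
        unfolding eq D_def .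
      show "0 \<le> 2 * (C * (\<eta> * t powr \<alpha>) / (r * t powr (a $ i))) + 2"
        using C pos tp by (intro add_nonneg_nonneg mult_nonneg_nonneg divide_nonneg_nonneg) (auto intro: less_imp_le)
    qed simp
    have factors_eq: "(\<Prod>i\<in>UNIV. (D * t powr (\<alpha> - a $ i))\<^sup>2) =
        D ^ (2 * CARD('n)) * t powr (2 * (real CARD('n) * \<alpha> - (\<Sum>i\<in>UNIV. a $ i)))"
    proof -
      have "(\<Prod>i\<in>UNIV. (D * t powr (\<alpha> - a $ i))\<^sup>2) = (D ^ CARD('n) * (\<Prod>i\<in>UNIV. t powr (\<alpha> - a $ i)))\<^sup>2"
        by (simp only: prod_power_distrib[symmetric] prod.distrib prod_constant)
      also have "(\<Prod>i\<in>UNIV. t powr (\<alpha> - a $ i)) = t powr (\<Sum>i\<in>UNIV. \<alpha> - a $ i)"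
        using t by (simp add: powr_sum)
      also have "(\<Sum>i\<in>UNIV. \<alpha> - a $ i) = real CARD('n) * \<alpha> - (\<Sum>i\<in>UNIV. a $ i)"
        by (simp add: sum_subtractf)
      also have "(D ^ CARD('n) * t powr (real CARD('n) * \<alpha> - (\<Sum>i\<in>UNIV. a $ i)))\<^sup>2 =
          D ^ (2 * CARD('n)) * t powr (real 2 * (real CARD('n) * \<alpha> - (\<Sum>i\<in>UNIV. a $ i)))"
        using t by (simp only: power_mult_distrib power_mult[symmetric] powr_power_real mult.commute[of _ 2]
          greaterThanAtMost_iff)
      finally show ?thesis by (simp only: of_nat_numeral)
    qed
    have "u * t powr (2 * real CARD('k) * \<alpha>) \<le>
        D ^ (2 * CARD('n)) * t powr (2 * (real CARD('n) * \<alpha> - (\<Sum>i\<in>UNIV. a $ i))) * ?m"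
      using order_trans[OF cover mult_right_mono[OF factors measure_nonneg]]
      unfolding vol factors_eq .
    moreover have "t powr (2 * real CARD('k) * \<alpha>) =
        t powr (2 * N) * t powr (2 * (real CARD('n) * \<alpha> - (\<Sum>i\<in>UNIV. a $ i)))"
    proof -
      have "2 * real CARD('k) * \<alpha> = 2 * N + 2 * (real CARD('n) * \<alpha> - (\<Sum>i\<in>UNIV. a $ i))"
        by (simp add: N_def left_diff_distrib right_diff_distrib)
      then show ?thesis by (simp add: powr_add)
    qed
    ultimately have "(u * t powr (2 * N)) * t powr (2 * (real CARD('n) * \<alpha> - (\<Sum>i\<in>UNIV. a $ i))) \<le>
        (D ^ (2 * CARD('n)) * ?m) * t powr (2 * (real CARD('n) * \<alpha> - (\<Sum>i\<in>UNIV. a $ i)))"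
      by (simp only: mult_ac)
    then have "u * t powr (2 * N) \<le> D ^ (2 * CARD('n)) * ?m"
      using tp by (rule mult_right_le_imp_le)
    moreover have "0 < D ^ (2 * CARD('n))" using D by simp
    ultimately show ?thesis
      unfolding times_divide_eq_left by (simp only: pos_divide_le_eq mult.commute)
  qed
  moreover have "u / D ^ (2 * CARD('n)) > 0" using u D by simp
  ultimately show ?thesis unfolding N_def \<alpha>_def by blast
qed

lemma gens_uniform_growth:
  fixes a :: "real^'n::finite"
  assumes a: "\<And>i. a $ i \<ge> 0"
    and supp: "\<And>g k. g \<in> set gs \<Longrightarrow> germ_coeff g k \<noteq> 0 \<Longrightarrow> l \<le> a \<bullet> (\<chi> i. real (k $ i))"
  shows "\<exists>r>0. \<exists>D\<ge>0. \<forall>t\<in>{0<..1}. \<forall>x. (\<forall>i. cmod (x $ i) \<le> r * t powr (a $ i)) \<longrightarrow>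
            (gens_norm gs x)\<^sup>2 \<le> D * t powr (2 * l)"
  using supp
proof (induction gs)
  case Nil
  show ?case by (intro exI[of _ 1] conjI exI[of _ 0]) (auto simp: gens_norm_squared)
next
  case (Cons g gs)
  obtain r1 D1 where 1: "r1 > 0" "D1 \<ge> 0" "\<And>t x. t \<in> {0<..1} \<Longrightarrow> (\<forall>i. cmod (x $ i) \<le> r1 * t powr (a $ i)) \<Longrightarrow>
            (gens_norm gs x)\<^sup>2 \<le> D1 * t powr (2 * l)"
    using Cons by (metis list.set_intros(2))
  obtain r2 C where 2: "r2 > 0" "\<And>t x. t \<in> {0<..1} \<Longrightarrow> (\<forall>i. cmod (x $ i) \<le> r2 * t powr (a $ i)) \<Longrightarrow>
            cmod (rep_germ g x) \<le> C * t powr l"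
    using weighted_growth_bound[OF a, of g l] Cons.prems by (metis list.set_intros(1))
  have "(gens_norm (g # gs) x)\<^sup>2 \<le> (C\<^sup>2 + D1) * t powr (2 * l)"
    if t: "t \<in> {0<..1}" and x: "\<forall>i. cmod (x $ i) \<le> min r1 r2 * t powr (a $ i)" for t x
  proof -
    have "cmod (x $ i) \<le> r1 * t powr (a $ i)" "cmod (x $ i) \<le> r2 * t powr (a $ i)" for i
      using x order_trans[OF spec[OF x, of i] mult_right_mono[of "min r1 r2" _ "t powr a $ i"]] by auto
    then have "(gens_norm gs x)\<^sup>2 \<le> D1 * t powr (2 * l)" "cmod (rep_germ g x) \<le> C * t powr l"
      using 1(3) 2(2) t by blast+
    moreover from this(2) have "(cmod (rep_germ g x))\<^sup>2 \<le> (C * t powr l)\<^sup>2"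
      by (rule power_mono) simp
    moreover have "(C * t powr l)\<^sup>2 = C\<^sup>2 * t powr (2 * l)"
      using t unfolding power_mult_distrib by (subst powr_power_real) auto
    ultimately show ?thesis by (simp add: gens_norm_squared distrib_right)
  qed
  then show ?case
    using 1(1,2) 2(1) by (intro exI[of _ "min r1 r2"] conjI exI[of _ "C\<^sup>2 + D1"]) auto
qed

lemma ennreal_inverse_antimono: "a \<le> b \<Longrightarrow> inverse b \<le> inverse (a :: ennreal)"
  including ennreal.lifting by transfer (rule ereal_inverse_antimono)

text \<open>
  If the numerator \<open>W\<close> were less than \<open>s * l\<close>, then the contribution of the boxes with parameter \<open>t\<close> to the integral, at
  least a constant times \<open>t\<close> to the power \<open>2 * (W - s * l)\<close>, would be unbounded as \<open>t\<close> tends to 0.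
\<close>

theorem lct_restrict_ideal_le:
  fixes a :: "real^'n::finite" and L :: "(complex^'n) set"
  assumes I: "ideal.subspace I" and a: "\<And>i. a $ i > 0" and l: "l > 0"
    and supp: "\<And>g k. g \<in> set (ideal_gens I) \<Longrightarrow> germ_coeff g k \<noteq> 0 \<Longrightarrow> l \<le> a \<bullet> (\<chi> i. real (k $ i))"
  shows "lct (restrict_ideal L I :: 'k::finite germ set) \<le>
     ereal (((\<Sum>i\<in>UNIV. a $ i) - (real CARD('n) - real CARD('k)) * vec_min a) / l)"
proof -
  define W where "W = (\<Sum>i\<in>UNIV. a $ i) - (real CARD('n) - real CARD('k)) * vec_min a"
  let ?M = "coordinates L :: complex^'k^'n"
  define gs where "gs = ideal_gens I"
  define hs :: "'k germ list" where "hs = ideal_gens (restrict_ideal L I)"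
  have gs: "I = ideal.span (set gs)"
    unfolding gs_def by (rule span_ideal_gens[OF I])
  have hs: "restrict_ideal L I = ideal.span (set hs)"
    unfolding hs_def by (rule span_ideal_gens) (simp add: restrict_ideal_def)
  obtain C0 where C0: "C0 \<ge> 0" "\<forall>\<^sub>F z in nhds 0. (gens_norm hs z)\<^sup>2 \<le> C0 * (gens_norm gs (?M *v z))\<^sup>2"
    using restrict_ideal_upper[OF gs hs] by blast
  have "\<exists>r>0. \<exists>D\<ge>0. \<forall>t\<in>{0<..1}. \<forall>x. (\<forall>i. cmod (x $ i) \<le> r * t powr (a $ i)) \<longrightarrow>
            (gens_norm gs x)\<^sup>2 \<le> D * t powr (2 * l)"
    by (rule gens_uniform_growth) (use less_imp_le[OF a] supp in \<open>auto simp: gs_def\<close>)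
  then obtain r D where rD: "r > 0" "D \<ge> 0" "\<And>t x. t \<in> {0<..1} \<Longrightarrow> \<forall>i. cmod (x $ i) \<le> r * t powr (a $ i) \<Longrightarrow>
            (gens_norm gs x)\<^sup>2 \<le> D * t powr (2 * l)"
    by blast
  have min_pos: "vec_min a > 0" using a by (rule vec_min_pos)
  have W_pos: "W > 0"
  proof -
    have "real CARD('n) * vec_min a \<le> (\<Sum>i\<in>UNIV. a $ i)"
      using sum_mono[of UNIV "\<lambda>_ :: 'n. vec_min a" "\<lambda>i. a $ i"] vec_min_le[of a] by simp
    moreover have "real CARD('k) * vec_min a > 0" using min_pos by simp
    ultimately show ?thesis by (simp add: W_def left_diff_distrib)
  qed
  have "s \<le> W / l" if s: "s \<ge> 0" and K: "0 \<in> interior K"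
    and fin: "(\<integral>\<^sup>+z\<in>K. neg_power (\<Sum>g\<leftarrow>hs. (cmod (rep_germ g z))\<^sup>2) s \<partial>lborel) < \<infinity>" for s and K :: "(complex^'k) set"
  proof (rule ccontr)
    let ?J = "\<integral>\<^sup>+z\<in>K. neg_power (\<Sum>g\<leftarrow>hs. (cmod (rep_germ g z))\<^sup>2) s \<partial>lborel"
    assume "\<not> s \<le> W / l"
    then have sl: "W < s * l" using l by (simp add: divide_less_eq not_le)
    then have "s \<noteq> 0" using W_pos by auto
    with s have s_pos: "s > 0" by simp
    obtain e1 where e1: "e1 > 0" "ball 0 e1 \<subseteq> K"
      using K by (auto simp: mem_interior)
    obtain e2 where e2: "e2 > 0" "\<And>z. dist z 0 < e2 \<Longrightarrow> (gens_norm hs z)\<^sup>2 \<le> C0 * (gens_norm gs (?M *v z))\<^sup>2"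
      using C0(2) by (auto simp: eventually_nhds_metric)
    define \<eta> where "\<eta> = min e1 e2"
    have \<eta>: "\<eta> > 0" using e1 e2 by (simp add: \<eta>_def)
    obtain c where c: "c > 0" "\<And>t. t \<in> {0<..1} \<Longrightarrow> c * t powr (2 * W) \<le>
        measure lborel (anisotropic_box ?M (\<eta> * t powr vec_min a) (\<lambda>i. r * t powr (a $ i)))"
      using measure_anisotropic_box_lower[OF \<eta> rD(1), of a ?M] unfolding W_def by blast
    \<comment> \<open>Adding 1 makes the constant positive, so that its powers can be inverted.\<close>
    define E where "E = C0 * D + 1"
    have E: "E > 0" using C0(1) rD(2) by (simp add: E_def add_nonneg_pos)
    define J where "J = enn2real ?J"
    have J: "?J = ennreal J"
      using fin by (simp add: J_def)
    have bound: "c / E powr s * t powr (2 * (W - s * l)) \<le> J" if t: "t \<in> {0<..1}" for t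
    proof -
      let ?R = "anisotropic_box ?M (\<eta> * t powr vec_min a) (\<lambda>i. r * t powr (a $ i))"
      define v where "v = (E * t powr (2 * l)) powr s"
      have v: "v > 0" using E t by (simp add: v_def)
      have "t powr vec_min a \<le> 1"
        using powr_mono'[of 0 "vec_min a" t] t min_pos by simp
      then have t_le: "\<eta> * t powr vec_min a \<le> \<eta>"
        using \<eta> by (simp add: mult_left_le)
      have R_K: "?R \<subseteq> K"
        using e1(2) t_le by (auto simp: anisotropic_box_def \<eta>_def)
      have le: "inverse (ennreal v) \<le> neg_power (\<Sum>g\<leftarrow>hs. (cmod (rep_germ g z))\<^sup>2) s"
        if z: "z \<in> ?R" for z
      proof -
        have "norm z < \<eta>" using z t_le by (auto simp: anisotropic_box_def)
        then have "(gens_norm hs z)\<^sup>2 \<le> C0 * (gens_norm gs (?M *v z))\<^sup>2"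
          by (intro e2) (simp add: \<eta>_def)
        also have "\<dots> \<le> C0 * (D * t powr (2 * l))"
          using z rD(3)[OF t] C0(1) by (intro mult_left_mono) (auto simp: anisotropic_box_def)
        also have "\<dots> \<le> E * t powr (2 * l)"
          by (simp add: E_def distrib_right)
        finally have "((gens_norm hs z)\<^sup>2) powr s \<le> v"
          unfolding v_def using s by (intro powr_mono2) auto
        then have "inverse (ennreal v) \<le> inverse (ennreal (((gens_norm hs z)\<^sup>2) powr s))"
          by (intro ennreal_inverse_antimono ennreal_leI)
        then show ?thesis
          using \<open>s \<noteq> 0\<close> by (simp add: neg_power_def gens_norm_squared)
      qed
      have "ennreal (1 / v * (c * t powr (2 * W))) \<le> inverse (ennreal v) * emeasure lborel ?R"
      proof -
        have "emeasure lborel ?R < \<infinity>"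
          by (rule emeasure_bounded_finite, rule bounded_subset[OF bounded_ball[of 0 "\<eta> * t powr vec_min a"]])
             (auto simp: anisotropic_box_def)
        then have "emeasure lborel ?R = ennreal (measure lborel ?R)"
          by (simp add: emeasure_eq_ennreal_measure)
        then have "ennreal (c * t powr (2 * W)) \<le> emeasure lborel ?R"
          using c(2)[OF t] by (simp add: ennreal_leI)
        then have "ennreal (1 / v) * ennreal (c * t powr (2 * W)) \<le> ennreal (1 / v) * emeasure lborel ?R"
          by (rule mult_left_mono) simp
        moreover have "ennreal (1 / v * (c * t powr (2 * W))) = ennreal (1 / v) * ennreal (c * t powr (2 * W))"
          using v c(1) by (intro ennreal_mult) auto
        moreover have "inverse (ennreal v) = ennreal (1 / v)"
          using v by (simp add: inverse_ennreal inverse_eq_divide)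
        ultimately show ?thesis by simp
      qed
      also have "\<dots> = (\<integral>\<^sup>+z. inverse (ennreal v) * indicator ?R z \<partial>lborel)"
        by (subst nn_integral_cmult_indicator) auto
      also have "\<dots> \<le> (?J)"
        using le R_K by (intro nn_integral_mono) (auto simp: indicator_def)
      also have "\<dots> = ennreal J" by (rule J)
      finally have "1 / v * (c * t powr (2 * W)) \<le> J"
        by (subst (asm) ennreal_le_iff) (simp_all add: J_def)
      moreover have "1 / v * (c * t powr (2 * W)) = c / E powr s * t powr (2 * (W - s * l))"
      proof -
        have "v = E powr s * t powr (2 * l * s)"
          unfolding v_def using E t by (subst powr_mult) (auto simp: powr_powr)
        moreover have "t powr (2 * (W - s * l)) = t powr (2 * W) / t powr (2 * l * s)"
          unfolding powr_diff[symmetric] by (rule arg_cong[where f = "\<lambda>y. t powr y"]) (simp only: right_diff_distrib mult.assoc mult.commute[of s l])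
        ultimately show ?thesis by simp
      qed
      ultimately show ?thesis by simp
    qed
    \<comment> \<open>The parameter \<open>t\<close> is chosen such that the lower bound of the integral becomes at least \<open>J + 1\<close>.\<close>
    define X where "X = max 1 ((J + 1) / (c / E powr s))"
    define t where "t = X powr (1 / (2 * (W - s * l)))"
    have X: "X \<ge> 1" by (simp add: X_def)
    have neg: "2 * (W - s * l) < 0" using sl by simp
    have "t \<le> X powr 0"
      unfolding t_def using X neg by (intro powr_mono) (auto simp: divide_le_0_iff)
    then have t: "t \<in> {0<..1}"
      using X by (auto simp: t_def)
    have tX: "t powr (2 * (W - s * l)) = X"
      unfolding t_def powr_powr using X neg by simp
    have "c / E powr s > 0" using c E by simp
    moreover have "(J + 1) / (c / E powr s) \<le> X" by (simp add: X_def)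
    ultimately have "J + 1 \<le> X * (c / E powr s)"
      by (simp only: pos_divide_le_eq)
    then have "J + 1 \<le> c / E powr s * X"
      by (simp only: mult.commute)
    with bound[OF t] tX show False by simp
  qed
  then show ?thesis
    unfolding lct_def lct_gens_def hs_def[symmetric] W_def[symmetric]
    by (intro Sup_least) auto
qed

section \<open>Integrals under linear changes of coordinates\<close>

text \<open>
  A measure that agrees with Lebesgue measure on boxes is Lebesgue measure; the image measure does so after
  division by the absolute value of the determinant of the inverse map.
\<close>

lemma linear_change_of_variables_cart:
  fixes h :: "(real, 'm::{finite,wellorder}) vec \<Rightarrow> (real, 'm) vec"
  assumes "linear h" "inj h"
  shows "\<exists>d. \<forall>f\<in>borel_measurable borel. (\<integral>\<^sup>+x. f (h x) \<partial>lborel) = ennreal d * (\<integral>\<^sup>+x. f x \<partial>lborel)"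
proof -
  obtain g where g: "linear g" "\<And>x. g (h x) = x" "\<And>x. h (g x) = x"
    using linear_injective_isomorphism[OF assms] by blast
  define d where "d = \<bar>det (matrix g)\<bar>"
  have "inj g" using g(3) by (metis injI)
  then have d: "d > 0"
    using det_nz_iff_inj[OF g(1)] by (simp add: d_def)
  have [measurable]: "h \<in> borel \<rightarrow>\<^sub>M borel"
    using assms(1) by (rule borel_measurable_linear)
  have "lborel = scale_measure (ennreal (1 / d)) (distr lborel borel h)"
  proof (rule lborel_eqI)
    fix l u :: "(real, 'm) vec" assume le: "\<And>b. b \<in> Basis \<Longrightarrow> l \<bullet> b \<le> u \<bullet> b"
    have vim: "h -` box l u = g ` box l u"
      using g by (auto simp: image_iff) metis
    have bnd: "bounded (g ` box l u)"
      using g(1) by (intro bounded_linear_image bounded_box linear_conv_bounded_linear[THEN iffD1])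
    have [measurable]: "g ` box l u \<in> sets borel"
      using measurable_sets_borel[of h borel "box l u"] by (simp flip: vim)
    have "measure lborel (g ` box l u) = d * measure lborel (box l u)"
      using measure_linear_image[OF g(1), of "box l u"] by (simp add: d_def)
    moreover have "emeasure lborel (g ` box l u) = ennreal (measure lborel (g ` box l u))"
        "emeasure lborel (box l u) = ennreal (measure lborel (box l u))"
      using emeasure_bounded_finite[OF bnd] emeasure_lborel_box_finite[of l u]
      by (auto intro!: emeasure_eq_ennreal_measure)
    ultimately have "emeasure lborel (g ` box l u) = ennreal d * emeasure lborel (box l u)"
      using d by (simp only: ennreal_mult less_imp_le measure_nonneg)
    then have "emeasure (distr lborel borel h) (box l u) = ennreal d * emeasure lborel (box l u)"
      by (subst emeasure_distr) (auto simp: vim)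
    then have "emeasure (scale_measure (ennreal (1 / d)) (distr lborel borel h)) (box l u) =
        (ennreal (1 / d) * ennreal d) * emeasure lborel (box l u)"
      by (simp only: emeasure_scale_measure mult.assoc)
    also have "ennreal (1 / d) * ennreal d = 1"
      using d by (simp flip: ennreal_mult)
    finally show "emeasure (scale_measure (ennreal (1 / d)) (distr lborel borel h)) (box l u) =
        (\<Prod>b\<in>Basis. (u - l) \<bullet> b)"
      using le by simp
  qed simp
  then have *: "(\<integral>\<^sup>+x. f x \<partial>lborel) = ennreal (1 / d) * (\<integral>\<^sup>+x. f (h x) \<partial>lborel)"
    if [measurable]: "f \<in> borel_measurable borel" for f
  proof -
    have "(\<integral>\<^sup>+x. f x \<partial>lborel) = (\<integral>\<^sup>+x. f x \<partial>(scale_measure (ennreal (1 / d)) (distr lborel borel h)))"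
      using \<open>lborel = _\<close> by simp
    also have "\<dots> = ennreal (1 / d) * (\<integral>\<^sup>+x. f x \<partial>(distr lborel borel h))"
      by (rule nn_integral_scale_measure) simp
    also have "(\<integral>\<^sup>+x. f x \<partial>(distr lborel borel h)) = (\<integral>\<^sup>+x. f (h x) \<partial>lborel)"
      by (rule nn_integral_distr) auto
    finally show ?thesis .
  qed
  have "(\<integral>\<^sup>+x. f (h x) \<partial>lborel) = ennreal d * (\<integral>\<^sup>+x. f x \<partial>lborel)"
    if "f \<in> borel_measurable borel" for f
  proof -
    have "ennreal d * ennreal (1 / d) = 1"
      using d by (simp flip: ennreal_mult)
    then show ?thesis
      unfolding *[OF that] mult.assoc[symmetric] by simp
  qed
  then show ?thesis by blast
qed

text \<open>
  Coordinates with respect to the standard basis carry Lebesgue measure of a Euclidean space to Lebesgue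
  measure of \<open>\<real>\<^sup>m\<close>, so that determinants of real matrices apply to \<open>\<complex>\<^sup>k\<close>.
\<close>

lemma lborel_isometric_coordinates:
  assumes card: "CARD('m::finite) = DIM('a::euclidean_space)"
  shows "\<exists>\<iota> \<kappa>. linear \<iota> \<and> linear \<kappa> \<and> (\<forall>v :: real^'m. \<kappa> (\<iota> v) = v) \<and> (\<forall>x :: 'a. \<iota> (\<kappa> x) = x) \<and>
           distr lborel borel \<iota> = (lborel :: 'a measure)"
proof -
  obtain \<beta> :: "'m \<Rightarrow> 'a" where \<beta>: "bij_betw \<beta> UNIV Basis"
    using finite_same_card_bij[of "UNIV :: 'm set" "Basis :: 'a set"] card by auto
  have \<beta>_Basis: "\<beta> i \<in> Basis" for i using \<beta> by (auto simp: bij_betw_def)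
  have \<beta>_inner: "\<beta> i \<bullet> \<beta> j = (if i = j then 1 else 0)" for i j
    using \<beta> by (simp add: inner_Basis \<beta>_Basis bij_betw_def inj_eq)
  define \<iota> where "\<iota> v = (\<Sum>i\<in>UNIV. v $ i *\<^sub>R \<beta> i)" for v :: "real^'m"
  define \<kappa> where "\<kappa> x = (\<chi> i. x \<bullet> \<beta> i)" for x
  have lin: "linear \<iota>" "linear \<kappa>"
    by (auto intro!: linearI simp: \<iota>_def \<kappa>_def vec_eq_iff scaleR_add_left sum.distrib scaleR_sum_right inner_add_left)
  have inner_\<iota>: "\<iota> v \<bullet> \<beta> i = v $ i" for v i
    unfolding \<iota>_def by (simp add: inner_sum_left \<beta>_inner if_distrib[of "\<lambda>x. _ * x"] cong: if_cong)
  have \<kappa>\<iota>: "\<kappa> (\<iota> v) = v" for v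
    by (simp add: \<kappa>_def inner_\<iota>)
  have \<iota>\<kappa>: "\<iota> (\<kappa> x) = x" for x
  proof -
    have "\<iota> (\<kappa> x) = (\<Sum>i\<in>UNIV. (x \<bullet> \<beta> i) *\<^sub>R \<beta> i)"
      by (simp add: \<iota>_def \<kappa>_def)
    also have "\<dots> = (\<Sum>b\<in>Basis. (x \<bullet> b) *\<^sub>R b)"
      by (rule sum.reindex_bij_betw[OF \<beta>])
    finally show ?thesis by (simp add: euclidean_representation)
  qed
  have [measurable]: "\<iota> \<in> borel \<rightarrow>\<^sub>M borel"
    using lin(1) by (rule borel_measurable_linear)
  have range_\<beta>: "Basis = range \<beta>" using \<beta> by (simp add: bij_betw_def)
  have ball_Basis: "(\<forall>b\<in>Basis. P b) \<longleftrightarrow> (\<forall>i. P (\<beta> i))" for P :: "'a \<Rightarrow> bool"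
    by (subst range_\<beta>) simp
  have "lborel = distr lborel borel \<iota>"
  proof (rule lborel_eqI)
    fix l u :: 'a assume le: "\<And>b. b \<in> Basis \<Longrightarrow> l \<bullet> b \<le> u \<bullet> b"
    have "\<iota> v \<in> box l u \<longleftrightarrow> v \<in> box (\<kappa> l) (\<kappa> u)" for v
    proof -
      have "\<iota> v \<in> box l u \<longleftrightarrow> (\<forall>b\<in>Basis. l \<bullet> b < \<iota> v \<bullet> b \<and> \<iota> v \<bullet> b < u \<bullet> b)"
        by (simp add: mem_box)
      also have "\<dots> \<longleftrightarrow> v \<in> box (\<kappa> l) (\<kappa> u)"
        unfolding ball_Basis by (simp add: inner_\<iota> mem_box_cart \<kappa>_def)
      finally show ?thesis .
    qed
    then have "\<iota> -` box l u = box (\<kappa> l) (\<kappa> u)"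
      by blast
    then have "emeasure (distr lborel borel \<iota>) (box l u) = emeasure lborel (box (\<kappa> l) (\<kappa> u))"
      by (subst emeasure_distr) auto
    also have "\<dots> = ennreal (\<Prod>b\<in>Basis. (\<kappa> u - \<kappa> l) \<bullet> b)"
      by (rule emeasure_lborel_box) (auto simp: Basis_vec_def inner_axis \<kappa>_def le \<beta>_Basis)
    also have "(\<Prod>b\<in>Basis. (\<kappa> u - \<kappa> l) \<bullet> b) = (\<Prod>i\<in>UNIV. (\<kappa> u - \<kappa> l) \<bullet> axis i 1)"
      by (rule prod.reindex_bij_betw[symmetric])
         (auto simp: bij_betw_def inj_on_def axis_eq_axis Basis_vec_def)
    also have "\<dots> = (\<Prod>i\<in>UNIV. (u - l) \<bullet> \<beta> i)"
      by (simp add: inner_axis \<kappa>_def inner_diff_left)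
    also have "\<dots> = (\<Prod>b\<in>Basis. (u - l) \<bullet> b)"
      by (rule prod.reindex_bij_betw[OF \<beta>])
    finally show "emeasure (distr lborel borel \<iota>) (box l u) = (\<Prod>b\<in>Basis. (u - l) \<bullet> b)" .
  qed simp
  with lin \<kappa>\<iota> \<iota>\<kappa> show ?thesis by metis
qed

lemma linear_change_of_variables:
  fixes h :: "complex^'k::finite \<Rightarrow> complex^'k"
  assumes "linear h" "inj h"
  shows "\<exists>d. \<forall>f\<in>borel_measurable borel. (\<integral>\<^sup>+x. f (h x) \<partial>lborel) = ennreal d * (\<integral>\<^sup>+x. f x \<partial>lborel)"
proof -
  \<comment> \<open>The type \<open>'k bit0\<close> serves as a well-ordered index set for the \<open>2 * CARD('k)\<close> real coordinates.\<close>
  have "CARD('k bit0) = DIM(complex^'k)"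
    by simp
  from lborel_isometric_coordinates[OF this] obtain \<iota> \<kappa>
    where \<iota>: "linear \<iota>" "linear \<kappa>" "\<And>v :: real^'k bit0. \<kappa> (\<iota> v) = v" "\<And>x :: complex^'k. \<iota> (\<kappa> x) = x"
      "distr lborel borel \<iota> = (lborel :: (complex^'k) measure)" by blast
  have [measurable]: "\<iota> \<in> borel \<rightarrow>\<^sub>M borel" "h \<in> borel \<rightarrow>\<^sub>M borel"
    using \<iota>(1) assms(1)
    by (auto intro: borel_measurable_linear)
  have lin: "linear (\<lambda>v. \<kappa> (h (\<iota> v)))"
    using linear_compose[OF linear_compose[OF \<iota>(1) assms(1)] \<iota>(2)] by (simp add: o_def)
  have inj: "inj (\<lambda>v. \<kappa> (h (\<iota> v)))"
    using assms(2) \<iota>(3,4) by (metis (mono_tags, lifting) injD injI)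
  obtain d where d: "\<And>f. f \<in> borel_measurable borel \<Longrightarrow>
      (\<integral>\<^sup>+x. f (\<kappa> (h (\<iota> x))) \<partial>lborel) = ennreal d * (\<integral>\<^sup>+x. f x \<partial>lborel)"
    using linear_change_of_variables_cart[OF lin inj] by blast
  have pull: "(\<integral>\<^sup>+x. f x \<partial>lborel) = (\<integral>\<^sup>+v. f (\<iota> v) \<partial>lborel)"
    if "f \<in> borel_measurable borel" for f :: "complex^'k \<Rightarrow> ennreal"
    using that by (subst \<iota>(5)[symmetric], subst nn_integral_distr) auto
  have "(\<integral>\<^sup>+x. f (h x) \<partial>lborel) = ennreal d * (\<integral>\<^sup>+x. f x \<partial>lborel)"
    if [measurable]: "f \<in> borel_measurable borel" for f
  proof -
    have "(\<integral>\<^sup>+x. f (h x) \<partial>lborel) = (\<integral>\<^sup>+v. f (h (\<iota> v)) \<partial>lborel)"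
      by (rule pull) simp
    also have "\<dots> = (\<integral>\<^sup>+v. f (\<iota> (\<kappa> (h (\<iota> v)))) \<partial>lborel)"
      by (simp add: \<iota>(4))
    also have "\<dots> = ennreal d * (\<integral>\<^sup>+v. f (\<iota> v) \<partial>lborel)"
      by (rule d) simp
    also have "(\<integral>\<^sup>+v. f (\<iota> v) \<partial>lborel) = (\<integral>\<^sup>+x. f x \<partial>lborel)"
      by (rule pull[symmetric]) simp
    finally show ?thesis .
  qed
  then show ?thesis by blast
qed

text \<open>
  The function \<open>\<bar>x\<bar> powr -\<theta>\<close>, cut off outside \<open>[-1, 1]\<close>, with value \<open>\<infinity>\<close> at 0.
\<close>

definition pole :: "real \<Rightarrow> real \<Rightarrow> ennreal" where
  "pole \<theta> x = inverse (ennreal (\<bar>x\<bar> powr \<theta>)) * indicator {-1..1} x"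

lemma pole_measurable [measurable]: "pole \<theta> \<in> borel_measurable borel"
  unfolding pole_def by measurable

lemma nn_integral_pole_finite:
  assumes "\<theta> < 1"
  shows "(\<integral>\<^sup>+x. pole \<theta> x \<partial>lborel) < \<infinity>"
proof -
  define p where "p x = ennreal (indicator {0..1} x * x powr - \<theta>)" for x :: real
  have [measurable]: "p \<in> borel_measurable borel" unfolding p_def by measurable
  have "(\<integral>\<^sup>+x. p x \<partial>lborel) = ennreal (1 powr (- \<theta> + 1) / (- \<theta> + 1))"
    unfolding p_def using assms
    by (intro nn_integral_has_integral_lebesgue has_integral_powr_from_0) auto
  then have fin: "(\<integral>\<^sup>+x. p x \<partial>lborel) < \<infinity>" by simp
  have refl: "(\<integral>\<^sup>+x. p (- x) \<partial>lborel) = (\<integral>\<^sup>+x. p x \<partial>lborel)"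
    by (subst lborel_distr_uminus[symmetric], subst nn_integral_distr) auto
  have "AE x in lborel. x \<noteq> (0 :: real)"
    by (rule AE_lborel_singleton)
  then have "AE x in lborel. pole \<theta> x \<le> p x + p (- x)"
  proof eventually_elim
    case (elim x)
    have "inverse (ennreal (\<bar>x\<bar> powr \<theta>)) = ennreal (\<bar>x\<bar> powr - \<theta>)"
      using elim by (simp add: inverse_ennreal powr_minus)
    then show ?case
      using elim by (cases "x > 0") (auto simp: pole_def p_def indicator_def)
  qed
  then have "(\<integral>\<^sup>+x. pole \<theta> x \<partial>lborel) \<le> (\<integral>\<^sup>+x. p x + p (- x) \<partial>lborel)"
    by (rule nn_integral_mono_AE)
  also have "\<dots> = (\<integral>\<^sup>+x. p x \<partial>lborel) + (\<integral>\<^sup>+x. p (- x) \<partial>lborel)"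
    by (rule nn_integral_add) auto
  also have "\<dots> < \<infinity>"
    using fin by (simp add: refl)
  finally show ?thesis .
qed

lemma prod_Basis_complex_vec:
  fixes w :: "complex^'k::finite" and f :: "real \<Rightarrow> 'b::comm_monoid_mult"
  shows "(\<Prod>b\<in>Basis. f (w \<bullet> b)) = (\<Prod>j\<in>UNIV. f (Re (w $ j)) * f (Im (w $ j)))"
proof -
  have bij: "bij_betw (\<lambda>(j, u). axis j u) ((UNIV :: 'k set) \<times> Basis) (Basis :: (complex^'k) set)"
    by (auto simp: bij_betw_def inj_on_def axis_eq_axis Basis_vec_def Basis_complex_def)
  have "(\<Prod>b\<in>Basis. f (w \<bullet> b)) = (\<Prod>x\<in>UNIV \<times> Basis. f (w \<bullet> (case x of (j, u) \<Rightarrow> axis j u)))"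
    by (rule prod.reindex_bij_betw[OF bij, symmetric])
  also have "\<dots> = (\<Prod>j\<in>UNIV. \<Prod>u\<in>Basis. f (w \<bullet> axis j u))"
    by (simp add: prod.cartesian_product case_prod_unfold)
  also have "\<dots> = (\<Prod>j\<in>UNIV. f (Re (w $ j)) * f (Im (w $ j)))"
    by (intro prod.cong) (auto simp: Basis_complex_def inner_axis inner_complex_def)
  finally show ?thesis .
qed

text \<open>
  In the linear coordinates given by \<open>h\<close>, the integral is a product of integrals over the real line.
\<close>

lemma nn_integral_linear_poles_finite:
  fixes h :: "complex^'k::finite \<Rightarrow> complex^'k"
  assumes "linear h" "inj h" "\<theta> < 1"
  shows "(\<integral>\<^sup>+z. (\<Prod>j\<in>UNIV. pole \<theta> (Re (h z $ j)) * pole \<theta> (Im (h z $ j))) \<partial>lborel) < \<infinity>"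
proof -
  define \<Phi> where "\<Phi> w = (\<Prod>b\<in>Basis. pole \<theta> (w \<bullet> b))" for w :: "complex^'k"
  have [measurable]: "\<Phi> \<in> borel_measurable borel" unfolding \<Phi>_def by measurable
  obtain d where d: "(\<integral>\<^sup>+z. \<Phi> (h z) \<partial>lborel) = ennreal d * (\<integral>\<^sup>+z. \<Phi> z \<partial>lborel)"
    using linear_change_of_variables[OF assms(1,2)] by (metis \<open>\<Phi> \<in> borel_measurable borel\<close>)
  have "(\<integral>\<^sup>+z. \<Phi> z \<partial>lborel) = (\<Prod>b\<in>(Basis :: (complex^'k) set). (\<integral>\<^sup>+x. pole \<theta> x \<partial>lborel))"
    unfolding \<Phi>_def by (rule nn_integral_lborel_prod) auto
  also have "\<dots> < \<infinity>"
    using nn_integral_pole_finite[OF assms(3)] by (simp add: power_less_top_ennreal)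
  finally have "(\<integral>\<^sup>+z. \<Phi> (h z) \<partial>lborel) < \<infinity>"
    unfolding d by (simp add: ennreal_mult_less_top)
  then show ?thesis by (simp add: \<Phi>_def prod_Basis_complex_vec)
qed

section \<open>The lower bound for generic subspaces\<close>

lemma ex_smallest_indices:
  fixes y :: "'n::finite \<Rightarrow> real"
  assumes "k \<le> CARD('n)"
  shows "\<exists>T. card T = k \<and> (\<forall>i\<in>T. \<forall>j. j \<notin> T \<longrightarrow> y i \<le> y j)"
  using assms
proof (induction k)
  case (Suc k)
  then obtain T where T: "card T = k" "\<And>i j. i \<in> T \<Longrightarrow> j \<notin> T \<Longrightarrow> y i \<le> y j" by auto
  have "T \<noteq> UNIV" using T Suc.prems by auto
  then have ne: "- T \<noteq> {}" by auto
  define i where "i = arg_min_on y (- T)"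
  have i: "i \<notin> T" "\<And>j. j \<notin> T \<Longrightarrow> y i \<le> y j"
    using arg_min_if_finite(1)[OF _ ne, of y] arg_min_least[OF _ ne, of _ y] by (auto simp: i_def)
  have "card (insert i T) = Suc k" using i(1) T(1) by simp
  moreover have "\<forall>i'\<in>insert i T. \<forall>j. j \<notin> insert i T \<longrightarrow> y i' \<le> y j"
    using T(2) i(2) by auto
  ultimately show ?case by blast
qed simp

text \<open>
  Let \<open>r\<close> be the largest of the numbers \<open>y i\<close>, \<open>i \<in> T\<close>, and take logarithms to base \<open>r\<close> of the numbers \<open>min (y i) r\<close>.
  Outside \<open>T\<close>, and where the maximum \<open>r\<close> is attained, the weight is 1; on \<open>T\<close> nothing is cut off. Cutting off at \<open>r\<close>
  can only make monomials smaller.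
\<close>

lemma ex_adapted_weight:
  fixes y :: "'n::finite \<Rightarrow> real"
  assumes y: "\<And>i. 0 < y i" "\<And>i. y i < 1"
    and T: "T \<noteq> {}" "\<And>i j. i \<in> T \<Longrightarrow> j \<notin> T \<Longrightarrow> y i \<le> y j"
  shows "\<exists>r a. 0 < r \<and> r < 1 \<and> a \<in> S_set (card T) \<and> vec_min a = 1 \<and>
     r powr ((\<Sum>i\<in>UNIV. a $ i) - (real CARD('n) - real (card T))) = (\<Prod>i\<in>T. y i) \<and>
     (\<forall>m. r powr (a \<bullet> (\<chi> i. real (m $ i))) \<le> (\<Prod>i\<in>UNIV. y i ^ (m $ i)))"
proof -
  define r where "r = Max (y ` T)"
  have "r \<in> y ` T" unfolding r_def using T(1) by (intro Max_in) auto
  then obtain i0 where i0: "i0 \<in> T" "y i0 = r" by auto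
  have r: "0 < r" "r < 1" using y i0 by metis+
  have y_le: "y i \<le> r" if "i \<in> T" for i
    unfolding r_def using that by (intro Max_ge) auto
  have y_ge: "r \<le> y j" if "j \<notin> T" for j
    using T(2)[OF i0(1) that] i0 by simp
  define a :: "real^'n" where "a = (\<chi> i. log r (min (y i) r))"
  have powr_a: "r powr (a $ i) = min (y i) r" for i
    using r y(1)[of i] by (simp add: a_def)
  have a_out: "a $ i = 1" if "r \<le> y i" for i
    using r that by (simp add: a_def min_def)
  have a_ge: "a $ i \<ge> 1" for i
  proof (rule ccontr)
    assume "\<not> a $ i \<ge> 1"
    then have "r powr 1 < r powr (a $ i)"
      using r by (intro powr_less_mono') auto
    with powr_a[of i] r show False by simp
  qed
  have min_a: "vec_min a = 1"
    unfolding vec_min_def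
  proof (rule Min_eqI)
    show "1 \<in> range (($) a)"
      using a_out[of i0] i0 by (metis order_refl rangeI)
  qed (use a_ge in auto)
  have "insert i0 (- T) \<subseteq> argmin_set a"
    using a_out i0 y_ge by (auto simp: argmin_set_def min_a)
  then have "card (insert i0 (- T)) \<le> card (argmin_set a)"
    by (intro card_mono) auto
  moreover have "card (insert i0 (- T)) = CARD('n) + 1 - card T"
    using i0(1) card_mono[of UNIV T] by (simp add: Compl_eq_Diff_UNIV card_Diff_subset Suc_diff_le)
  ultimately have S: "a \<in> S_set (card T)"
    using a_ge by (auto simp: S_set_def intro: less_le_trans[of 0 1])
  have sum_a: "(\<Sum>i\<in>UNIV. a $ i) - (real CARD('n) - real (card T)) = (\<Sum>i\<in>T. a $ i)"
  proof -
    have "(\<Sum>i\<in>UNIV. a $ i) = (\<Sum>i\<in>T. a $ i) + (\<Sum>i\<in>- T. a $ i)"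
      by (subst sum.union_disjoint[symmetric]) (auto simp: Compl_partition)
    also have "(\<Sum>i\<in>- T. a $ i) = real (card (- T))"
      using a_out y_ge by simp
    also have "real (card (- T)) = real CARD('n) - real (card T)"
      using card_mono[of UNIV T] by (simp add: Compl_eq_Diff_UNIV card_Diff_subset of_nat_diff)
    finally show ?thesis by simp
  qed
  have "r powr (\<Sum>i\<in>T. a $ i) = (\<Prod>i\<in>T. r powr (a $ i))"
    using r by (simp add: powr_sum)
  also have "\<dots> = (\<Prod>i\<in>T. y i)"
    using y_le by (intro prod.cong) (auto simp: powr_a)
  finally have prodT: "r powr (\<Sum>i\<in>T. a $ i) = (\<Prod>i\<in>T. y i)" .
  have "r powr (a \<bullet> (\<chi> i. real (m $ i))) \<le> (\<Prod>i\<in>UNIV. y i ^ (m $ i))" for m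
  proof -
    have "r powr (a \<bullet> (\<chi> i. real (m $ i))) = (\<Prod>i\<in>UNIV. (r powr (a $ i)) ^ (m $ i))"
      using r by (simp add: inner_vec_def powr_sum powr_power_real mult.commute)
    also have "\<dots> \<le> (\<Prod>i\<in>UNIV. y i ^ (m $ i))"
      using y(1) r(1) by (intro prod_mono conjI power_mono) (auto simp: powr_a less_imp_le)
    finally show ?thesis .
  qed
  moreover have "r powr ((\<Sum>i\<in>UNIV. a $ i) - (real CARD('n) - real (card T))) = (\<Prod>i\<in>T. y i)"
    unfolding sum_a by (rule prodT)
  ultimately show ?thesis
    using r S min_a by (intro exI[of _ r] exI[of _ a] conjI allI)
qed

lemma inverse_prod_ennreal:
  assumes "finite A"
  shows "inverse (\<Prod>i\<in>A. ennreal (f i)) = (\<Prod>i\<in>A. inverse (ennreal (f i)))"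
proof -
  from assms have "(\<Prod>i\<in>A. ennreal (f i)) < top \<and>
      inverse (\<Prod>i\<in>A. ennreal (f i)) = (\<Prod>i\<in>A. inverse (ennreal (f i)))"
    by (induction A rule: finite_induct) (auto simp: ennreal_inverse_mult ennreal_mult_less_top)
  then show ?thesis ..
qed

text \<open>
  As \<open>\<bar>Re w\<bar> * \<bar>Im w\<bar> \<le> \<bar>w\<bar>\<^sup>2\<close>, a pole in one complex variable is bounded by a product of two real ones.
\<close>

lemma inverse_norm_power_le_poles:
  assumes "\<theta> > 0" "cmod w \<le> 1"
  shows "inverse (ennreal (cmod w powr (2 * \<theta>))) \<le> pole \<theta> (Re w) * pole \<theta> (Im w)"
proof -
  have Re: "\<bar>Re w\<bar> \<le> 1" and Im: "\<bar>Im w\<bar> \<le> 1"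
    using abs_Re_le_cmod[of w] abs_Im_le_cmod[of w] assms(2) by linarith+
  have "\<bar>Re w\<bar> powr \<theta> * \<bar>Im w\<bar> powr \<theta> \<le> cmod w powr \<theta> * cmod w powr \<theta>"
    using assms(1) by (intro mult_mono powr_mono2 abs_Re_le_cmod abs_Im_le_cmod) auto
  also have "\<dots> = cmod w powr (2 * \<theta>)"
    by (simp flip: powr_add)
  finally have "inverse (ennreal (cmod w powr (2 * \<theta>))) \<le>
      inverse (ennreal (\<bar>Re w\<bar> powr \<theta> * \<bar>Im w\<bar> powr \<theta>))"
    by (intro ennreal_inverse_antimono ennreal_leI)
  also have "\<dots> = inverse (ennreal (\<bar>Re w\<bar> powr \<theta>)) * inverse (ennreal (\<bar>Im w\<bar> powr \<theta>))"
    by (simp add: ennreal_mult ennreal_inverse_mult)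
  also have "\<dots> = pole \<theta> (Re w) * pole \<theta> (Im w)"
    using Re Im by (simp add: pole_def abs_le_iff)
  finally show ?thesis .
qed

lemma lct_nonneg: "0 \<le> lct (J :: 'k::finite germ set)"
proof -
  have "(\<integral>\<^sup>+x\<in>cball 0 1. neg_power (\<Sum>g\<leftarrow>ideal_gens J. (cmod (rep_germ g x))\<^sup>2) 0 \<partial>lborel) < \<infinity>"
    using emeasure_lborel_cball_finite[of "0 :: complex^'k" 1] by (simp add: neg_power_def)
  then show ?thesis
    unfolding lct_def lct_gens_def zero_ereal_def
    by (intro Sup_upper CollectI exI[of _ 0] conjI exI[of _ "cball 0 1"]) auto
qed

text \<open>
  At each point of a small ball, the weight adapted to the \<open>k\<close> smallest coordinates bounds the integrand by a
  product of poles in these coordinates. Which coordinates these are depends on the point, so the sum over all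
  selections \<open>\<sigma>\<close> of \<open>k\<close> coordinates is used; each summand is integrable, because the selected coordinates
  are linear coordinates of \<open>\<complex>\<^sup>k\<close> and \<open>s / s' < 1\<close>.
\<close>

theorem le_lct_restrict_ideal:
  fixes I :: "'n::finite germ set" and L :: "(complex^'n) set"
  assumes I: "ideal.subspace I"
    and M0: "finite M0" "\<And>m. m \<in> M0 \<Longrightarrow> dominated (gens_norm (ideal_gens I)) (germ_monom m)"
    and generic: "\<And>\<sigma> :: 'k::finite \<Rightarrow> 'n. inj \<sigma> \<Longrightarrow>
          inj (\<lambda>z. (\<chi> j. ((coordinates L :: complex^'k^'n) *v z) $ \<sigma> j) :: complex^'k)"
    and weights: "\<And>a. a \<in> S_set CARD('k) \<Longrightarrow> vec_min a = 1 \<Longrightarrow>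
          \<exists>m\<in>M0. s' * (a \<bullet> (\<chi> i. real (m $ i))) \<le> (\<Sum>i\<in>UNIV. a $ i) - (real CARD('n) - real CARD('k))"
    and s: "0 \<le> s" "s < s'" and kn: "CARD('k) \<le> CARD('n)"
  shows "ereal s \<le> lct (restrict_ideal L I :: 'k germ set)"
proof (cases "s = 0")
  case True
  then show ?thesis using lct_nonneg by (simp add: zero_ereal_def)
next
  case False
  then have s_pos: "s > 0" using s by simp
  define \<theta> where "\<theta> = s / s'"
  have \<theta>: "0 < \<theta>" "\<theta> < 1" using s s_pos by (auto simp: \<theta>_def)
  let ?M = "coordinates L :: complex^'k^'n"
  define gs where "gs = ideal_gens I"
  define hs :: "'k germ list" where "hs = ideal_gens (restrict_ideal L I)"
  let ?bound = "\<lambda>m z C. (cmod (monom_fun m (?M *v z)))\<^sup>2 \<le> C * (gens_norm hs z)\<^sup>2"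
  have gs: "I = ideal.span (set gs)"
    unfolding gs_def by (rule span_ideal_gens[OF I])
  have hs: "restrict_ideal L I = ideal.span (set hs)"
    unfolding hs_def by (rule span_ideal_gens) (simp add: restrict_ideal_def)
  have "\<forall>m\<in>M0. \<exists>C. \<forall>\<^sub>F z in nhds 0. ?bound m z C"
  proof
    fix m assume "m \<in> M0"
    then obtain C where "\<forall>\<^sub>F z in nhds 0. (cmod (rep_germ (germ_monom m) (?M *v z)))\<^sup>2 \<le> C * (gens_norm hs z)\<^sup>2"
      using restrict_ideal_lower[OF gs hs M0(2)[unfolded gs_def[symmetric]]] by blast
    moreover have "\<forall>\<^sub>F z in nhds 0. rep_germ (germ_monom m) (?M *v z) = monom_fun m (?M *v z)"
      using rep_germ_monom by (rule eventually_compose_filterlim) (rule filterlim_matrix_vector_mult)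
    ultimately have "\<forall>\<^sub>F z in nhds 0. ?bound m z C"
      by eventually_elim simp
    then show "\<exists>C. \<forall>\<^sub>F z in nhds 0. ?bound m z C" ..
  qed
  from bchoice[OF this] obtain c
    where c: "\<forall>m\<in>M0. \<forall>\<^sub>F z in nhds 0. ?bound m z (c m)" ..
  define C where "C = 1 + (\<Sum>m\<in>M0. \<bar>c m\<bar>)"
  have C: "C > 0" "\<And>m. m \<in> M0 \<Longrightarrow> c m \<le> C"
  proof -
    show "C > 0" by (simp add: C_def add_pos_nonneg sum_nonneg)
    show "c m \<le> C" if "m \<in> M0" for m
      using member_le_sum[OF that, of "\<lambda>m. \<bar>c m\<bar>"] M0(1) by (simp add: C_def)
  qed
  have "\<forall>\<^sub>F z in nhds 0. \<forall>m\<in>M0. ?bound m z (c m)"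
    using c M0(1) by (simp add: eventually_ball_finite)
  moreover have "\<forall>\<^sub>F z in nhds 0. \<forall>i. cmod ((?M *v z) $ i) \<le> 1 / 2"
    using eventually_small_coords[of "\<lambda>_. 1 / 2"] by (rule eventually_compose_filterlim) (simp, rule filterlim_matrix_vector_mult)
  ultimately have "\<forall>\<^sub>F z in nhds 0. (\<forall>m\<in>M0. ?bound m z C) \<and>
      (\<forall>i. cmod ((?M *v z) $ i) \<le> 1 / 2)"
  proof eventually_elim
    case (elim z)
    have "?bound m z C" if "m \<in> M0" for m
      using elim(1) that mult_right_mono[OF C(2)[OF that], of "(gens_norm hs z)\<^sup>2"] by fastforce
    with elim(2) show ?case by blast
  qed
  then obtain e where e: "e > 0"
      "\<And>z m. dist z 0 < e \<Longrightarrow> m \<in> M0 \<Longrightarrow> ?bound m z C"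
      "\<And>z i. dist z 0 < e \<Longrightarrow> cmod ((?M *v z) $ i) \<le> 1 / 2"
    unfolding eventually_nhds_metric by blast
  define K where "K = cball (0 :: complex^'k) (e / 2)"
  define \<Sigma> where "\<Sigma> = {\<sigma> :: 'k \<Rightarrow> 'n. inj \<sigma>}"
  define P where "P \<sigma> z = (\<Prod>j\<in>UNIV. pole \<theta> (Re ((?M *v z) $ \<sigma> j)) * pole \<theta> (Im ((?M *v z) $ \<sigma> j)))"    for \<sigma> :: "'k \<Rightarrow> 'n" and z
  define B where "B = C powr s"
  have B: "B > 0" using C by (simp add: B_def)
  have main: "neg_power (\<Sum>g\<leftarrow>hs. (cmod (rep_germ g z))\<^sup>2) s \<le> ennreal B * (\<Sum>\<sigma>\<in>\<Sigma>. P \<sigma> z)" if z: "z \<in> K" for z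
  proof -
    have dz: "dist z 0 < e" using z e(1) by (auto simp: K_def)
    define y where "y i = cmod ((?M *v z) $ i)" for i
    have y: "0 \<le> y i" "y i \<le> 1 / 2" for i using e(3)[OF dz] by (auto simp: y_def)
    obtain T where T: "card T = CARD('k)" "\<And>i j. i \<in> T \<Longrightarrow> j \<notin> T \<Longrightarrow> y i \<le> y j"
      using ex_smallest_indices[OF kn, of y] by blast
    obtain \<sigma> :: "'k \<Rightarrow> 'n" where \<sigma>: "bij_betw \<sigma> UNIV T"
      using finite_same_card_bij[of "UNIV :: 'k set" T] T(1) by auto
    then have \<sigma>_in: "\<sigma> \<in> \<Sigma>" by (simp add: \<Sigma>_def bij_betw_def)
    have T_ne: "T \<noteq> {}" using T(1) by auto
    define F where "F = (gens_norm hs z)\<^sup>2"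
    \<comment> \<open>If some coordinate vanishes, then so does one with index in \<open>T\<close>, and the left-hand side is 0.\<close>
    have real_bound: "(\<Prod>i\<in>T. y i) powr (2 * \<theta>) \<le> B * F powr s"
    proof (cases "\<forall>i. y i > 0")
      case False
      then obtain i where "\<not> y i > 0" by blast
      with y(1)[of i] have i: "y i = 0" by linarith
      have "\<exists>j\<in>T. y j = 0"
      proof (cases "i \<in> T")
        case out: False
        obtain j where "j \<in> T" using T_ne by blast
        with T(2)[OF this out] i y(1)[of j] show ?thesis by auto
      qed (use i in blast)
      then have prod0: "(\<Prod>i\<in>T. y i) = 0" by simp
      show ?thesis unfolding prod0 using B by simp
    next
      case True
      have y0: "0 < y i" and y1: "y i < 1" for i using True y(2)[of i] by auto
      obtain r a where r: "0 < r" "r < 1" and a: "a \<in> S_set CARD('k)" "vec_min a = 1"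
         and prodT: "r powr ((\<Sum>i\<in>UNIV. a $ i) - (real CARD('n) - real CARD('k))) = (\<Prod>i\<in>T. y i)"
         and mon: "\<And>m. r powr (a \<bullet> (\<chi> i. real (m $ i))) \<le> (\<Prod>i\<in>UNIV. y i ^ (m $ i))"
        using ex_adapted_weight[where y = y and T = T, OF y0 y1 T_ne T(2), unfolded T(1)] by blast
      obtain m where m: "m \<in> M0"
          "s' * (a \<bullet> (\<chi> i. real (m $ i))) \<le> (\<Sum>i\<in>UNIV. a $ i) - (real CARD('n) - real CARD('k))"
        using weights[OF a] by blast
      define q where "q = a \<bullet> (\<chi> i. real (m $ i))"
      define N where "N = (\<Sum>i\<in>UNIV. a $ i) - (real CARD('n) - real CARD('k))"
      have "s * q = \<theta> * (s' * q)" using s s_pos by (simp add: \<theta>_def)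
      also have "\<dots> \<le> \<theta> * N" using m(2) \<theta>(1) unfolding q_def N_def by (intro mult_left_mono) auto
      finally have sq: "s * q \<le> \<theta> * N" .
      have "(\<Prod>i\<in>T. y i) powr (2 * \<theta>) = r powr (2 * (\<theta> * N))"
        unfolding prodT[symmetric] powr_powr N_def by (rule arg_cong[where f = "\<lambda>x. r powr x"]) simp
      also have "\<dots> \<le> r powr (2 * (s * q))"
        using r sq by (intro powr_mono') auto
      also have "\<dots> = ((r powr q)\<^sup>2) powr s"
        using r by (simp add: powr_power_real powr_powr mult.commute[of s])
      also have "\<dots> \<le> (C * F) powr s"
      proof (intro powr_mono2)
        have "r powr q \<le> cmod (monom_fun m (?M *v z))"
          using mon[of m] by (simp add: q_def norm_monom_fun y_def)
        then have "(r powr q)\<^sup>2 \<le> (cmod (monom_fun m (?M *v z)))\<^sup>2"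
          by (intro power_mono) auto
        also have "\<dots> \<le> C * F" unfolding F_def by (rule e(2)[OF dz m(1)])
        finally show "(r powr q)\<^sup>2 \<le> C * F" .
      qed (use s in auto)
      also have "\<dots> = B * F powr s"
        using C by (simp add: B_def F_def powr_mult)
      finally show ?thesis .
    qed
    have "inverse (ennreal (F powr s)) = ennreal B * (inverse (ennreal B) * inverse (ennreal (F powr s)))"
    proof -
      have "ennreal B * inverse (ennreal B) = 1"
        using B by (simp add: inverse_ennreal flip: ennreal_mult)
      then show ?thesis by (simp add: mult.assoc[symmetric])
    qed
    also have "inverse (ennreal B) * inverse (ennreal (F powr s)) = inverse (ennreal (B * F powr s))"
      using B by (simp add: ennreal_mult ennreal_inverse_mult)
    also have "ennreal B * \<dots> \<le> ennreal B * inverse (ennreal ((\<Prod>i\<in>T. y i) powr (2 * \<theta>)))"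
      using real_bound by (intro mult_left_mono ennreal_inverse_antimono ennreal_leI) auto
    also have "inverse (ennreal ((\<Prod>i\<in>T. y i) powr (2 * \<theta>))) = (\<Prod>i\<in>T. inverse (ennreal (y i powr (2 * \<theta>))))"
      using y(1) by (simp add: prod_powr_distrib inverse_prod_ennreal flip: prod_ennreal)
    also have "\<dots> = (\<Prod>j\<in>UNIV. inverse (ennreal (y (\<sigma> j) powr (2 * \<theta>))))"
      by (rule prod.reindex_bij_betw[OF \<sigma>, symmetric])
    also have "\<dots> \<le> P \<sigma> z"
      unfolding P_def y_def
    proof (rule prod_mono_ennreal)
      fix j
      show "inverse (ennreal (cmod ((?M *v z) $ \<sigma> j) powr (2 * \<theta>))) \<le>
          pole \<theta> (Re ((?M *v z) $ \<sigma> j)) * pole \<theta> (Im ((?M *v z) $ \<sigma> j))"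
        using y(2)[of "\<sigma> j"] by (intro inverse_norm_power_le_poles \<theta>) (simp add: y_def)
    qed
    also have "P \<sigma> z \<le> (\<Sum>\<sigma>\<in>\<Sigma>. P \<sigma> z)"
      using \<sigma>_in by (intro member_le_sum) (auto simp: \<Sigma>_def)
    finally have "inverse (ennreal (F powr s)) \<le> ennreal B * (\<Sum>\<sigma>\<in>\<Sigma>. P \<sigma> z)"
      by (simp add: mult_left_mono)
    then show ?thesis
      using False by (simp add: neg_power_def F_def gens_norm_squared)
  qed
  have lin: "linear (\<lambda>z. (\<chi> j. (?M *v z) $ \<sigma> j) :: complex^'k)" for \<sigma> :: "'k \<Rightarrow> 'n"
    using matrix_vector_mult_bounded(1)[of ?M]
    by (auto intro!: linearI simp: vec_eq_iff linear_add linear_scale)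
  have P_fin: "(\<integral>\<^sup>+z. P \<sigma> z \<partial>lborel) < \<infinity>" if "\<sigma> \<in> \<Sigma>" for \<sigma>
    using nn_integral_linear_poles_finite[OF lin generic \<theta>(2), of \<sigma>] that
    by (simp add: P_def \<Sigma>_def)
  have [measurable]: "(\<lambda>z. (?M *v z) $ i) \<in> borel_measurable borel" for i
    using matrix_vector_mult_bounded(1)[of ?M]
    by (intro borel_measurable_continuous_onI continuous_on_component linear_continuous_on linear_conv_bounded_linear[THEN iffD1])
  have [measurable]: "P \<sigma> \<in> borel_measurable borel" for \<sigma>
    unfolding P_def by measurable
  have "(\<integral>\<^sup>+z\<in>K. neg_power (\<Sum>g\<leftarrow>hs. (cmod (rep_germ g z))\<^sup>2) s \<partial>lborel) \<le>
      (\<integral>\<^sup>+z. ennreal B * (\<Sum>\<sigma>\<in>\<Sigma>. P \<sigma> z) \<partial>lborel)"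
    using main by (intro nn_integral_mono) (auto simp: indicator_def)
  also have "\<dots> = ennreal B * (\<Sum>\<sigma>\<in>\<Sigma>. \<integral>\<^sup>+z. P \<sigma> z \<partial>lborel)"
    by (simp add: nn_integral_cmult nn_integral_sum)
  also have "\<dots> < \<infinity>"
    using P_fin by (simp add: ennreal_mult_less_top \<Sigma>_def)
  finally have "(\<integral>\<^sup>+z\<in>K. neg_power (\<Sum>g\<leftarrow>hs. (cmod (rep_germ g z))\<^sup>2) s \<partial>lborel) < \<infinity>" .
  moreover have "compact K" "0 \<in> interior K"
    using e(1) by (auto simp: K_def)
  ultimately show ?thesis
    unfolding lct_def lct_gens_def hs_def[symmetric] using s
    by (intro Sup_upper CollectI exI[of _ s] conjI exI[of _ K]) auto
qed

section \<open>Subspaces in general position\<close>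

text \<open>
  Any \<open>k\<close> of the \<open>n\<close> coordinate functions are linearly independent on the column space.
\<close>

definition generic_matrix :: "complex^'k^'n \<Rightarrow> bool" where
  "generic_matrix M \<longleftrightarrow> (\<forall>\<sigma> :: 'k::finite \<Rightarrow> 'n::finite. inj \<sigma> \<longrightarrow> det (\<chi> j. M $ \<sigma> j) \<noteq> 0)"

lemma select_rows_mult: "(\<chi> j. (M *v z) $ \<sigma> j) = (\<chi> j. M $ \<sigma> j) *v z"
  by (simp add: vec_eq_iff matrix_vector_mult_def)

lemma det_nz_iff_kernel: "det (A :: complex^'k::finite^'k) \<noteq> 0 \<longleftrightarrow> (\<forall>z. A *v z = 0 \<longrightarrow> z = 0)"
  by (simp only: invertible_det_nz[symmetric] invertible_left_inverse matrix_left_invertible_ker)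

definition generic_subspaces :: "'k::finite itself \<Rightarrow> (complex^'n::finite) set set" where
  "generic_subspaces _ = {range ((*v) M) | M :: complex^'k^'n. generic_matrix M}"

lemma inj_matrix_iff_kernel:
  "inj ((*v) M) \<longleftrightarrow> (\<forall>z. M *v z = 0 \<longrightarrow> z = 0)" for M :: "complex^'k::finite^'n::finite"
  using linear_injective_0[OF matrix_vector_mult_bounded(1)[of M]] by simp

lemma inj_generic_matrix:
  fixes M :: "complex^'k::finite^'n::finite"
  assumes "generic_matrix M" "CARD('k) \<le> CARD('n)"
  shows "inj ((*v) M)"
proof -
  obtain \<sigma> :: "'k \<Rightarrow> 'n" where \<sigma>: "inj \<sigma>"
    using card_le_inj[of "UNIV :: 'k set" "UNIV :: 'n set"] assms(2) by auto
  have "z = 0" if "M *v z = 0" for z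
  proof -
    have "(\<chi> j. M $ \<sigma> j) *v z = 0"
      using that by (simp add: vec_eq_iff flip: select_rows_mult)
    then show ?thesis
      using assms(1) \<sigma> det_nz_iff_kernel unfolding generic_matrix_def by blast
  qed
  then show ?thesis by (simp add: inj_matrix_iff_kernel)
qed

text \<open>
  Genericity depends only on the column space: a vector in the kernel of a selection of rows of \<open>M\<close>
  is mapped by \<open>M\<close> to a point \<open>N *v w\<close> whose selected coordinates vanish.
\<close>

lemma generic_matrix_same_range:
  fixes M N :: "complex^'k::finite^'n::finite"
  assumes "generic_matrix N" "inj ((*v) M)" "range ((*v) M) = range ((*v) N)"
  shows "generic_matrix M"
  unfolding generic_matrix_def
proof (intro allI impI)
  fix \<sigma> :: "'k \<Rightarrow> 'n" assume \<sigma>: "inj \<sigma>"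
  have "z = 0" if z: "(\<chi> j. M $ \<sigma> j) *v z = 0" for z
  proof -
    obtain w where w: "M *v z = N *v w" using assms(3) by (metis rangeE rangeI)
    have "(\<chi> j. N $ \<sigma> j) *v w = 0"
      using z by (simp add: w flip: select_rows_mult)
    then have "w = 0"
      using assms(1) \<sigma> det_nz_iff_kernel unfolding generic_matrix_def by blast
    then have "M *v z = 0" using w by simp
    then show "z = 0" using assms(2) by (simp add: inj_matrix_iff_kernel)
  qed
  then show "det (\<chi> j. M $ \<sigma> j) \<noteq> 0"
    using det_nz_iff_kernel by blast
qed

lemma polynomial_functions_sum:
  "finite A \<Longrightarrow> (\<And>a. a \<in> A \<Longrightarrow> f a \<in> polynomial_functions) \<Longrightarrow>
     (\<lambda>M. \<Sum>a\<in>A. f a M) \<in> polynomial_functions"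
proof (induction A rule: finite_induct)
  case empty
  show ?case unfolding sum.empty by (rule polynomial_functions.const)
next
  case (insert a A)
  then show ?case
    unfolding sum.insert[OF insert.hyps] by (intro polynomial_functions.add) simp_all
qed

lemma polynomial_functions_prod:
  "finite A \<Longrightarrow> (\<And>a. a \<in> A \<Longrightarrow> f a \<in> polynomial_functions) \<Longrightarrow>
     (\<lambda>M. \<Prod>a\<in>A. f a M) \<in> polynomial_functions"
proof (induction A rule: finite_induct)
  case empty
  show ?case unfolding prod.empty by (rule polynomial_functions.const)
next
  case (insert a A)
  then show ?case
    unfolding prod.insert[OF insert.hyps] by (intro polynomial_functions.mult) simp_all
qed

lemma polynomial_functions_minor:
  "(\<lambda>M :: complex^'k::finite^'n::finite. det (\<chi> j. M $ \<sigma> j)) \<in> polynomial_functions"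
  unfolding det_def vec_lambda_beta
proof (rule polynomial_functions_sum)
  fix p :: "'k \<Rightarrow> 'k"
  have "(\<lambda>M :: complex^'k^'n. \<Prod>i\<in>UNIV. M $ \<sigma> i $ p i) \<in> polynomial_functions"
    by (rule polynomial_functions_prod) (simp_all add: polynomial_functions.entry)
  then show "(\<lambda>M :: complex^'k^'n. of_int (sign p) * (\<Prod>i\<in>UNIV. M $ \<sigma> i $ p i)) \<in> polynomial_functions"
    by (rule polynomial_functions.mult[OF polynomial_functions.const])
qed (simp add: finite_permutations)

lemma zariski_open_generic_matrix: "zariski_open {M :: complex^'k::finite^'n::finite. generic_matrix M}"
proof -
  define p where "p M = (\<Prod>\<sigma>\<in>{\<sigma> :: 'k \<Rightarrow> 'n. inj \<sigma>}. det (\<chi> j. M $ \<sigma> j))"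
    for M :: "complex^'k^'n"
  have "p \<in> polynomial_functions"
    unfolding p_def by (intro polynomial_functions_prod polynomial_functions_minor) simp
  moreover have "{M. generic_matrix M} = {M. \<exists>q\<in>{p}. q M \<noteq> 0}"
    by (auto simp: p_def generic_matrix_def)
  ultimately show ?thesis
    unfolding zariski_open_def by blast
qed

lemma vec_dim_range_inj:
  fixes M :: "complex^'k::finite^'n::finite"
  assumes "inj ((*v) M)"
  shows "vec.dim (range ((*v) M)) = CARD('k)"
proof -
  have "vec.dim (range ((*v) M)) = vec.dim (UNIV :: (complex^'k) set)"
    using assms by (intro vec.dim_image_eq matrix_vector_mul_linear_gen) auto
  then show ?thesis by (simp add: vec.dim_UNIV card_cart_basis)
qed

lemma generic_subspaces_open:
  assumes "CARD('k::finite) \<le> CARD('n::finite)"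
  shows "grassmann_zariski_open TYPE('k) (generic_subspaces TYPE('k) :: (complex^'n) set set)"
  unfolding grassmann_zariski_open_def
proof
  show "(generic_subspaces TYPE('k) :: (complex^'n) set set) \<subseteq> grassmannian CARD('k)"
    using inj_generic_matrix[OF _ assms]
    by (auto simp: generic_subspaces_def grassmannian_def vec_dim_range_inj
        intro!: vec.subspace_image)
  have "{M :: complex^'k^'n. inj ((*v) M) \<and> range ((*v) M) \<in> generic_subspaces TYPE('k)} = {M. generic_matrix M}"
    using inj_generic_matrix[OF _ assms] generic_matrix_same_range
    by (auto simp: generic_subspaces_def)
  then show "zariski_open {M :: complex^'k^'n. inj ((*v) M) \<and> range ((*v) M) \<in> generic_subspaces TYPE('k)}"
    using zariski_open_generic_matrix by simp
qed

text \<open>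
  The rows are powers of distinct numbers, as in a Vandermonde matrix: a vector in the kernel of \<open>k\<close> of them
  would be a polynomial of degree less than \<open>k\<close> with \<open>k\<close> zeros.
\<close>

lemma ex_generic_matrix:
  "\<exists>M :: complex^'k::finite^'n::finite. generic_matrix M"
proof -
  obtain e :: "'k \<Rightarrow> nat" where e: "bij_betw e UNIV {..<CARD('k)}"
    using ex_bij_betw_finite_nat[of "UNIV :: 'k set"] by (auto simp: atLeast0LessThan)
  obtain x :: "'n \<Rightarrow> nat" where x: "inj x"
    using finite_imp_inj_to_nat_seg[of "UNIV :: 'n set"] by auto
  define M :: "complex^'k^'n" where "M = (\<chi> i j. of_nat (x i) ^ e j)"
  have "z = 0" if \<sigma>: "inj \<sigma>" and z: "(\<chi> j. M $ \<sigma> j) *v z = 0" for \<sigma> :: "'k \<Rightarrow> 'n" and z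
  proof -
    define p :: "complex poly" where "p = (\<Sum>j\<in>UNIV. monom (z $ j) (e j))"
    have deg: "degree p < CARD('k)"
      unfolding p_def using e
      by (intro degree_sum_less order_le_less_trans[OF degree_monom_le]) (auto simp: bij_betw_def)
    have "poly p (of_nat (x (\<sigma> i))) = 0" for i
      using z by (simp add: p_def poly_sum poly_monom vec_eq_iff matrix_vector_mult_def M_def mult.commute)
    then have "range (\<lambda>i. of_nat (x (\<sigma> i)) :: complex) \<subseteq> {t. poly p t = 0}" by auto
    moreover have "card (range (\<lambda>i. of_nat (x (\<sigma> i)) :: complex)) = CARD('k)"
      using x \<sigma> by (intro card_image) (auto simp: inj_def)
    ultimately have "p = 0 \<or> CARD('k) \<le> degree p"
      using card_poly_roots_bound[of p] card_mono[OF poly_roots_finite[of p]] order_trans by metis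
    with deg have "p = 0" by simp
    have "z $ j = 0" for j
    proof -
      have "coeff p (e j) = (\<Sum>i\<in>UNIV. if i = j then z $ i else 0)"
        unfolding p_def coeff_sum coeff_monom using e
        by (intro sum.cong refl if_cong) (simp add: bij_betw_def inj_eq)
      then show ?thesis using \<open>p = 0\<close> by simp
    qed
    then show ?thesis by (simp add: vec_eq_iff)
  qed
  then have "generic_matrix M"
    unfolding generic_matrix_def using det_nz_iff_kernel by blast
  then show ?thesis ..
qed

text \<open>
  The matrix \<open>coordinates L\<close> need not be the one that witnesses the genericity of \<open>L\<close>, but both have the same
  range. So the selected rows of the former give a surjective map as those of the latter do, and surjective
  endomorphisms are injective.
\<close>

lemma generic_subspace_projections:
  fixes L :: "(complex^'n::finite) set" and \<sigma> :: "'k::finite \<Rightarrow> 'n"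
  assumes L: "L \<in> generic_subspaces TYPE('k)" and \<sigma>: "inj \<sigma>" and kn: "CARD('k) \<le> CARD('n)"
  shows "inj (\<lambda>z. (\<chi> j. ((coordinates L :: complex^'k^'n) *v z) $ \<sigma> j) :: complex^'k)"
proof -
  let ?M = "coordinates L :: complex^'k^'n"
  obtain N :: "complex^'k^'n" where N: "generic_matrix N" "range ((*v) N) = L"
    using L by (auto simp: generic_subspaces_def)
  then have rM: "range ((*v) ?M) = L"
    unfolding coordinates_def by (intro someI_ex[of "\<lambda>M. range ((*v) M) = L"]) blast
  have "surj ((*v) (\<chi> j. ?M $ \<sigma> j))"
  proof
    have "y \<in> range ((*v) (\<chi> j. ?M $ \<sigma> j))" for y
    proof -
      have "inj ((*v) (\<chi> j. N $ \<sigma> j))"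
        using N(1) \<sigma> det_nz_iff_kernel inj_matrix_iff_kernel unfolding generic_matrix_def by blast
      then have "surj ((*v) (\<chi> j. N $ \<sigma> j))"
        by (intro linear_injective_imp_surjective matrix_vector_mult_bounded) simp_all
      then obtain w where w: "y = (\<chi> j. N $ \<sigma> j) *v w" by blast
      obtain z where z: "?M *v z = N *v w"
        using rM N(2) by (metis rangeE rangeI)
      have "y = (\<chi> j. ?M $ \<sigma> j) *v z"
        unfolding w select_rows_mult[symmetric] z ..
      then show ?thesis by blast
    qed
    then show "UNIV \<subseteq> range ((*v) (\<chi> j. ?M $ \<sigma> j))" by blast
  qed simp
  then have "inj ((*v) (\<chi> j. ?M $ \<sigma> j))"
    by (intro linear_surjective_imp_injective matrix_vector_mult_bounded) auto
  then show ?thesis by (simp add: select_rows_mult)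
qed

section \<open>Newton polyhedra and monomial reductions\<close>

lemma germ_monom_0: "germ_monom 0 = (1 :: 'n::finite germ)"
proof (rule germ_eqI)
  show "\<forall>\<^sub>F x in nhds 0. rep_germ (germ_monom 0) x = rep_germ (1 :: 'n germ) x"
    using rep_germ_monom[where m = "0 :: nat^'n"] rep_germ_one[where 'a = 'n]
    by eventually_elim simp
qed

text \<open>
  Finitely many monomials of the integral closure suffice to express the generators of \<open>I\<close>. Being integral over \<open>I\<close>, they
  are in turn dominated by these generators. The constant monomial is not among them, as \<open>I\<close> is proper.
\<close>

lemma ex_monomial_reduction:
  assumes I: "ideal.subspace I" "I \<noteq> {0}" "I \<noteq> UNIV" and mon: "monomial_ideal (integral_closure I)"
  shows "\<exists>M0. finite M0 \<and> M0 \<noteq> {} \<and> 0 \<notin> M0 \<and> set (ideal_gens I) \<subseteq> ideal.span (germ_monom ` M0) \<and>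
     (\<forall>m\<in>M0. dominated (gens_norm (ideal_gens I)) (germ_monom m))"
proof -
  define gs where "gs = ideal_gens I"
  have gs: "I = ideal.span (set gs)" unfolding gs_def by (rule span_ideal_gens[OF I(1)])
  obtain M where M: "integral_closure I = ideal.span (germ_monom ` M)"
    using mon by (auto simp: monomial_ideal_def)
  have "set gs \<subseteq> I" unfolding gs by (rule ideal.span_superset)
  also have "\<dots> \<subseteq> ideal.span (germ_monom ` M)"
    using subset_integral_closure[OF I(1)] by (simp add: M)
  finally obtain Z where Z: "Z \<subseteq> germ_monom ` M" "finite Z" "set gs \<subseteq> ideal.span Z"
    using finite_generating_subset[of "set gs" "germ_monom ` M"] by auto
  obtain M0 where M0: "M0 \<subseteq> M" "finite M0" "Z = germ_monom ` M0"
    using finite_subset_image[OF Z(2,1)] by blast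
  have closure: "germ_monom m \<in> integral_closure I" if "m \<in> M0" for m
    unfolding M using that M0(1) by (intro ideal.span_base imageI) auto
  have "dominated (gens_norm gs) (germ_monom m)" if "m \<in> M0" for m
  proof (rule dominated_integral_closure[OF _ _ closure[OF that]])
    show "dominated (gens_norm gs) g" if "g \<in> I" for g
      using that unfolding gs by (elim dominated_span[rotated]) (rule dominated_gen)
  qed simp
  moreover have "0 \<notin> M0"
    using closure[of 0] one_in_integral_closure[OF I(1)] I(3) by (auto simp: germ_monom_0)
  moreover have "M0 \<noteq> {}"
  proof
    assume "M0 = {}"
    then have "set gs \<subseteq> {0}" using Z(3) M0(3) by simp
    then have "I \<subseteq> {0}"
      unfolding gs by (intro ideal.span_minimal) auto
    then show False using I(1,2) ideal.subspace_0 by blast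
  qed
  ultimately show ?thesis
    using M0 Z(3) by (intro exI[of _ M0]) (auto simp: gs_def)
qed

lemma real_exponent_inner: "(a :: real^'n::finite) \<bullet> (\<chi> i. real (m $ i)) = (\<Sum>i\<in>UNIV. a $ i * real (m $ i))"
  by (simp add: inner_vec_def)

text \<open>
  A half-space with nonnegative normal vector that contains the exponents of the generators contains the orthants
  attached to them and all convex hulls.
\<close>

lemma newton_ideal_lower:
  fixes a :: "real^'n::finite"
  assumes a: "\<And>i. a $ i \<ge> 0"
    and supp: "\<And>g k. g \<in> set (ideal_gens I) \<Longrightarrow> germ_coeff g k \<noteq> 0 \<Longrightarrow> l \<le> a \<bullet> (\<chi> i. real (k $ i))"
    and x: "x \<in> newton_ideal I"
  shows "l \<le> a \<bullet> x"
proof -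
  have "newton_germ g \<subseteq> {x. l \<le> a \<bullet> x}" if "g \<in> set (ideal_gens I)" for g
    unfolding newton_germ_def
  proof (rule hull_minimal)
    show "{(\<chi> i. real (k $ i)) + u |k u. germ_coeff g k \<noteq> 0 \<and> (\<forall>i. u $ i \<ge> 0)} \<subseteq> {x. l \<le> a \<bullet> x}"
    proof clarify
      fix k and u :: "real^'n" assume k: "germ_coeff g k \<noteq> 0" and u: "\<forall>i. 0 \<le> u $ i"
      have "0 \<le> a \<bullet> u" using a u by (auto simp: inner_vec_def intro!: sum_nonneg)
      with supp[OF that k] show "l \<le> a \<bullet> ((\<chi> i. real (k $ i)) + u)"
        by (simp add: inner_add_right)
    qed
  qed (rule convex_halfspace_ge)
  then have "newton_ideal I \<subseteq> {x. l \<le> a \<bullet> x}"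
    unfolding newton_ideal_def by (intro hull_minimal convex_halfspace_ge) auto
  with x show ?thesis by blast
qed

lemma exponent_in_newton_ideal:
  assumes "g \<in> set (ideal_gens I)" "germ_coeff g k \<noteq> 0"
  shows "(\<chi> i. real (k $ i)) \<in> newton_ideal I"
proof -
  have "(\<chi> i. real (k $ i)) = (\<chi> i. real (k $ i)) + 0" by simp
  then have "(\<chi> i. real (k $ i)) \<in> newton_germ g"
    unfolding newton_germ_def using assms(2) by (intro hull_inc) fastforce
  then show ?thesis
    unfolding newton_ideal_def using assms(1) by (intro hull_inc) blast
qed

lemma newton_ideal_nonempty:
  assumes "ideal.subspace I" "I \<noteq> {0}"
  shows "newton_ideal I \<noteq> {}"
proof -
  have "\<exists>g\<in>set (ideal_gens I). g \<noteq> 0"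
  proof (rule ccontr)
    assume "\<not> ?thesis"
    then have "ideal.span (set (ideal_gens I)) \<subseteq> {0}"
      by (intro ideal.span_minimal) auto
    then show False
      using assms ideal.subspace_0[OF assms(1)] span_ideal_gens[OF assms(1)] by blast
  qed
  then obtain g k where "g \<in> set (ideal_gens I)" "germ_coeff g k \<noteq> 0"
    by (auto simp: germ_coeff_eq_0_iff)
  then show ?thesis using exponent_in_newton_ideal by blast
qed

lemma bdd_below_newton_ideal:
  fixes a :: "real^'n::finite"
  assumes "\<And>i. a $ i \<ge> 0"
  shows "bdd_below ((\<bullet>) a ` newton_ideal I)"
proof (rule bdd_belowI2)
  fix x assume "x \<in> newton_ideal I"
  then show "0 \<le> a \<bullet> x"
    using assms by (rule_tac newton_ideal_lower[of a I]) (auto simp: inner_vec_def intro!: sum_nonneg)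
qed

lemma ell_le_exponent:
  fixes a :: "real^'n::finite"
  assumes "\<And>i. a $ i \<ge> 0" "g \<in> set (ideal_gens I)" "germ_coeff g k \<noteq> 0"
  shows "ell a I \<le> a \<bullet> (\<chi> i. real (k $ i))"
  unfolding ell_def
  by (intro cINF_lower bdd_below_newton_ideal exponent_in_newton_ideal[OF assms(2,3)] assms(1))

lemma le_ell:
  fixes a :: "real^'n::finite"
  assumes "ideal.subspace I" "I \<noteq> {0}" "\<And>x. x \<in> newton_ideal I \<Longrightarrow> l \<le> a \<bullet> x"
  shows "l \<le> ell a I"
  unfolding ell_def by (intro cINF_greatest newton_ideal_nonempty assms)

lemma ell_scaleR_le:
  fixes a :: "real^'n::finite"
  assumes I: "ideal.subspace I" "I \<noteq> {0}" and a: "\<And>i. a $ i \<ge> 0" and c: "c > 0"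
  shows "c * ell a I \<le> ell (c *\<^sub>R a) I"
proof (rule le_ell[OF I])
  fix x assume "x \<in> newton_ideal I"
  then have "ell a I \<le> a \<bullet> x"
    unfolding ell_def by (intro cINF_lower bdd_below_newton_ideal a)
  then show "c * ell a I \<le> (c *\<^sub>R a) \<bullet> x"
    using c by simp
qed

lemma ell_scaleR:
  fixes a :: "real^'n::finite"
  assumes I: "ideal.subspace I" "I \<noteq> {0}" and a: "\<And>i. a $ i \<ge> 0" and c: "c > 0"
  shows "ell (c *\<^sub>R a) I = c * ell a I"
proof (rule antisym)
  have "inverse c * ell (c *\<^sub>R a) I \<le> ell (inverse c *\<^sub>R (c *\<^sub>R a)) I"
    using a c by (intro ell_scaleR_le[OF I]) auto
  then have "inverse c * ell (c *\<^sub>R a) I \<le> ell a I"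
    using c by simp
  then have "c * (inverse c * ell (c *\<^sub>R a) I) \<le> c * ell a I"
    using c by (intro mult_left_mono) auto
  then show "ell (c *\<^sub>R a) I \<le> c * ell a I"
    using c by simp
qed (rule ell_scaleR_le[OF assms])

text \<open>
  The generators lie in the ideal of the germs whose support has at least the least weight of \<open>M0\<close>. That weight is
  positive, since 0 is not in \<open>M0\<close>.
\<close>

lemma ell_monomial_reduction:
  fixes a :: "real^'n::finite"
  assumes I: "ideal.subspace I" "I \<noteq> {0}" and M0: "finite M0" "M0 \<noteq> {}" "0 \<notin> M0"
    and gens: "set (ideal_gens I) \<subseteq> ideal.span (germ_monom ` M0)" and a: "\<And>i. a $ i > 0"
  shows "\<exists>m\<in>M0. a \<bullet> (\<chi> i. real (m $ i)) \<le> ell a I" "ell a I > 0"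
proof -
  define w where "w m = a \<bullet> (\<chi> i. real (m $ i))" for m
  define l where "l = Min (w ` M0)"
  have l_le: "l \<le> w m" if "m \<in> M0" for m
    unfolding l_def using that M0(1) by (intro Min_le) auto
  have "l \<in> w ` M0" unfolding l_def using M0 by (intro Min_in) auto
  then obtain m where m: "m \<in> M0" "w m = l" by auto
  let ?V = "{h. \<forall>k. germ_coeff h k \<noteq> 0 \<longrightarrow> l \<le> a \<bullet> (\<chi> i. real (k $ i))}"
  have sub: "ideal.span (germ_monom ` M0) \<subseteq> ?V"
    using l_le a
    by (intro ideal.span_minimal subspace_supported)
       (auto simp: germ_coeff_monom w_def less_imp_le split: if_splits)
  have supp: "l \<le> a \<bullet> (\<chi> i. real (k $ i))"
    if "g \<in> set (ideal_gens I)" "germ_coeff g k \<noteq> 0" for g k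
    using subsetD[OF sub subsetD[OF gens that(1)]] that(2) by simp
  have l_ell: "l \<le> ell a I"
  proof (rule le_ell[OF I])
    show "l \<le> a \<bullet> x" if "x \<in> newton_ideal I" for x
      by (rule newton_ideal_lower[OF less_imp_le[OF a] supp that])
  qed
  with m show "\<exists>m\<in>M0. a \<bullet> (\<chi> i. real (m $ i)) \<le> ell a I"
    by (auto simp: w_def)
  have "m \<noteq> 0" using m(1) M0(3) by blast
  then obtain i where i: "m $ i \<noteq> 0" by (auto simp: vec_eq_iff)
  have "0 < a $ i * real (m $ i)" using a i by simp
  also have "\<dots> \<le> (\<Sum>i\<in>UNIV. a $ i * real (m $ i))"
    using a by (intro member_le_sum) (auto simp: less_imp_le)
  also have "\<dots> = l" using m(2) by (simp add: w_def real_exponent_inner)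
  finally show "ell a I > 0" using l_ell by simp
qed

section \<open>The generic log canonical threshold\<close>

text \<open>
  The infimum \<open>V\<close> bounds the threshold on all subspaces and is attained on the generic ones. A number \<open>v\<close> with the
  properties that define \<open>lct_generic\<close> is the threshold of some subspace, so \<open>v \<le> V\<close>; and it bounds the thresholds
  of generic subspaces, so \<open>V \<le> v\<close>. The second equality holds because numerator and denominator are homogeneous
  of degree 1 in \<open>a\<close>, so that \<open>a\<close> may be divided by its least entry.
\<close>

theorem theorem8p4:
  fixes I :: "'n::finite germ set" and k :: nat
  assumes "ideal.subspace I" and "I \<noteq> {0}" and "I \<noteq> UNIV"
    and "monomial_ideal (integral_closure I)"
    and "k \<in> {1..CARD('n)}" and "k = CARD('k::finite)"
  shows "lct_generic TYPE('k) I =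
           (INF a\<in>S_set k.
              ereal (((\<Sum>i\<in>UNIV. a $ i) - (real CARD('n) - real k) * vec_min a) / ell a I)) \<and>
         (INF a\<in>S_set k.
              ereal (((\<Sum>i\<in>UNIV. a $ i) - (real CARD('n) - real k) * vec_min a) / ell a I)) =
           (INF a\<in>S_set k \<inter> A_set.
              ereal (((\<Sum>i\<in>UNIV. a $ i) - (real CARD('n) - real k)) / ell a I))"
proof
  note I = assms(1,2,3)
  let ?V' = "(INF a\<in>S_set k \<inter> A_set. ereal (((\<Sum>i\<in>UNIV. a $ i) - (real CARD('n) - real k)) / ell a I))"
  have kn: "CARD('k) \<le> CARD('n)" using assms(5,6) by simp
  obtain M0 where M0: "finite M0" "M0 \<noteq> {}" "0 \<notin> M0"
      "set (ideal_gens I) \<subseteq> ideal.span (germ_monom ` M0)"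
      "\<And>m. m \<in> M0 \<Longrightarrow> dominated (gens_norm (ideal_gens I)) (germ_monom m)"
    using ex_monomial_reduction[OF I assms(4)] by blast
  define W where "W a = ((\<Sum>i\<in>UNIV. a $ i) - (real CARD('n) - real k) * vec_min a) / ell a I" for a :: "real^'n"
  define V where "V = (INF a\<in>S_set k. ereal (W a))"
  have S_pos: "a $ i > 0" if "a \<in> S_set k" for a :: "real^'n" and i
    using that by (simp add: S_set_def)
  have ell_pos: "ell a I > 0" if "a \<in> S_set k" for a
    by (rule ell_monomial_reduction(2)[OF I(1,2) M0(1-4) S_pos[OF that]])
  have upper: "lct (restrict_ideal L I :: 'k germ set) \<le> V" for L
    unfolding V_def
  proof (rule INF_greatest)
    fix a :: "real^'n" assume a: "a \<in> S_set k"
    show "lct (restrict_ideal L I :: 'k germ set) \<le> ereal (W a)"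
      unfolding W_def assms(6)
      by (rule lct_restrict_ideal_le[OF I(1) S_pos[OF a] ell_pos[OF a]])
         (intro ell_le_exponent less_imp_le[OF S_pos[OF a]])
  qed
  have lower: "V \<le> lct (restrict_ideal L I :: 'k germ set)" if L: "L \<in> generic_subspaces TYPE('k)" for L
  proof (rule dense_le)
    fix v assume v: "v < V"
    obtain s where s: "v < ereal s" "ereal s < V" using ereal_dense2[OF v] by blast
    obtain s' where s': "ereal s < ereal s'" "ereal s' < V" using ereal_dense2[OF s(2)] by blast
    show "v \<le> lct (restrict_ideal L I :: 'k germ set)"
    proof (cases "s \<ge> 0")
      case False
      then have "v \<le> 0" using s(1) by (metis ereal_less_eq(5) less_imp_le not_le order_trans)
      then show ?thesis using lct_nonneg order_trans by blast
    next
      case True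
      have "ereal s \<le> lct (restrict_ideal L I :: 'k germ set)"
      proof (rule le_lct_restrict_ideal[OF I(1) M0(1,5)])
        show "inj (\<lambda>z. (\<chi> j. ((coordinates L :: complex^'k^'n) *v z) $ \<sigma> j) :: complex^'k)"
          if "inj \<sigma>" for \<sigma> :: "'k \<Rightarrow> 'n"
          by (rule generic_subspace_projections[OF L that kn])
        fix a :: "real^'n" assume a: "a \<in> S_set CARD('k)" "vec_min a = 1"
        then have aS: "a \<in> S_set k" by (simp add: assms(6))
        obtain m where m: "m \<in> M0" "a \<bullet> (\<chi> i. real (m $ i)) \<le> ell a I"
          using ell_monomial_reduction(1)[OF I(1,2) M0(1-4) S_pos[OF aS]] by blast
        have "V \<le> ereal (W a)" unfolding V_def using aS by (rule INF_lower)
        with s'(2) have "s' \<le> W a" by (metis ereal_less_eq(3) less_imp_le order_trans)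
        then have "s' * ell a I \<le> (\<Sum>i\<in>UNIV. a $ i) - (real CARD('n) - real CARD('k))"
          using ell_pos[OF aS] a(2) by (simp add: W_def assms(6) pos_le_divide_eq)
        moreover have "s' * (a \<bullet> (\<chi> i. real (m $ i))) \<le> s' * ell a I"
          using m(2) s'(1) True by (intro mult_left_mono) auto
        ultimately show "\<exists>m\<in>M0. s' * (a \<bullet> (\<chi> i. real (m $ i))) \<le>
            (\<Sum>i\<in>UNIV. a $ i) - (real CARD('n) - real CARD('k))"
          using m(1) by force
      qed (use True s'(1) kn in auto)
      with s(1) show ?thesis by simp
    qed
  qed
  have L_ne: "(generic_subspaces TYPE('k) :: (complex^'n) set set) \<noteq> {}"
    using ex_generic_matrix by (auto simp: generic_subspaces_def)
  have "lct_generic TYPE('k) I = V"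
    unfolding lct_generic_def
  proof (rule the_equality)
    show "(\<exists>U. grassmann_zariski_open TYPE('k) U \<and> U \<noteq> {} \<and>
              (\<forall>L\<in>U. lct (restrict_ideal L I :: 'k germ set) = V)) \<and>
          (\<forall>L\<in>grassmannian CARD('k). lct (restrict_ideal L I :: 'k germ set) \<le> V)"
      using generic_subspaces_open[OF kn] L_ne upper lower
      by (intro conjI exI[of _ "generic_subspaces TYPE('k)"] ballI antisym) auto
  next
    fix v
    assume v: "(\<exists>U. grassmann_zariski_open TYPE('k) U \<and> U \<noteq> {} \<and>
              (\<forall>L\<in>U. lct (restrict_ideal L I :: 'k germ set) = v)) \<and>
          (\<forall>L\<in>grassmannian CARD('k). lct (restrict_ideal L I :: 'k germ set) \<le> v)"
    then obtain U L where "L \<in> U" "lct (restrict_ideal L I :: 'k germ set) = v"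
      by blast
    then have "v \<le> V" using upper by blast
    moreover obtain L' where L': "L' \<in> (generic_subspaces TYPE('k) :: (complex^'n) set set)"
      using L_ne by blast
    then have "L' \<in> grassmannian CARD('k)"
      using generic_subspaces_open[OF kn] by (auto simp: grassmann_zariski_open_def)
    then have "V \<le> v" using v lower[OF L'] order_trans by blast
    ultimately show "v = V" by (rule antisym)
  qed
  then show "lct_generic TYPE('k) I =
           (INF a\<in>S_set k.
              ereal (((\<Sum>i\<in>UNIV. a $ i) - (real CARD('n) - real k) * vec_min a) / ell a I))"
    by (simp add: V_def W_def)
  have "V = ?V'"
  proof (rule antisym)
    show "V \<le> ?V'"
    proof (rule INF_greatest)
      fix a :: "real^'n" assume a: "a \<in> S_set k \<inter> A_set"
      then have "V \<le> ereal (W a)" unfolding V_def by (intro INF_lower) auto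
      then show "V \<le> ereal (((\<Sum>i\<in>UNIV. a $ i) - (real CARD('n) - real k)) / ell a I)"
        using a by (simp add: W_def A_set_def)
    qed
    show "?V' \<le> V"
      unfolding V_def
    proof (rule INF_greatest)
      fix a :: "real^'n" assume a: "a \<in> S_set k"
      define c where "c = 1 / vec_min a"
      have min_pos: "vec_min a > 0" using vec_min_pos S_pos[OF a] by blast
      then have c: "c > 0" by (simp add: c_def)
      have vm: "vec_min (c *\<^sub>R a) = c * vec_min a"
        unfolding vec_min_def using c mono_Min_commute[of "\<lambda>x. c * x" "range (($) a)"]
        by (simp add: image_image monoI mult_left_mono)
      have "argmin_set (c *\<^sub>R a) = argmin_set a"
        using c by (simp add: argmin_set_def vm)
      then have "c *\<^sub>R a \<in> S_set k \<inter> A_set"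
        using a c min_pos by (auto simp: S_set_def A_set_def vm) (simp add: c_def)
      then have "?V' \<le>
          ereal (((\<Sum>i\<in>UNIV. (c *\<^sub>R a) $ i) - (real CARD('n) - real k)) / ell (c *\<^sub>R a) I)"
        by (rule INF_lower)
      also have "((\<Sum>i\<in>UNIV. (c *\<^sub>R a) $ i) - (real CARD('n) - real k)) / ell (c *\<^sub>R a) I = W a"
      proof -
        have "(\<Sum>i\<in>UNIV. (c *\<^sub>R a) $ i) - (real CARD('n) - real k) =
            c * ((\<Sum>i\<in>UNIV. a $ i) - (real CARD('n) - real k) * vec_min a)"
          using min_pos by (simp add: c_def sum_distrib_left[symmetric] sum_divide_distrib[symmetric] diff_divide_distrib)
        moreover have "ell (c *\<^sub>R a) I = c * ell a I"
          by (rule ell_scaleR[OF I(1,2) less_imp_le[OF S_pos[OF a]] c])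
        ultimately show ?thesis using c by (simp add: W_def)
      qed
      finally show "?V' \<le>
          ereal (W a)" .
    qed
  qed
  then show "(INF a\<in>S_set k.
              ereal (((\<Sum>i\<in>UNIV. a $ i) - (real CARD('n) - real k) * vec_min a) / ell a I)) =
           (INF a\<in>S_set k \<inter> A_set.
              ereal (((\<Sum>i\<in>UNIV. a $ i) - (real CARD('n) - real k)) / ell a I))"
    by (simp add: V_def W_def)
qed

end
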